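(* Let $R$ be a commutative integral domain with unit and let $M$ be a finite monoid satisfying the $R$-C.A. condition. Then the monoid algebra $A=R[M]$ is a cell algebra. Moreover, the choice of a cell algebra structure (with cell basis) on each group algebra $R[G_D]$, $D$ a $\mathcal{D}$-class of $M$, gives rise to a cell basis of $A$, namely the standard cell basis $$C=\{\,{}_{(R_i,s)}C_{(L_j,t)}^{(D,\lambda)} : (D,\lambda)\in\Lambda,\ (R_i,s)\in L(D,\lambda),\ (L_j,t)\in R(D,\lambda)\}$$ with poset $\Lambda$, as described in the context.
   Context: Cell algebra: let $R$ be a commutative integral domain with $1$ and $A$ an associative unital $R$-algebra. Let $\Lambda$ be a finite poset and, for each $\lambda\in\Lambda$, let $L(\lambda),R(\lambda)$ be finite sets (left and right indices). Suppose for $\lambda\in\Lambda$, $s\in L(\lambda)$, $t\in R(\lambda)$ there is an element ${}_sC_t^\lambda\in A$ such that $(\lambda,s,t)\mapsto{}_sC_t^\lambda$ is injective and the set $C$ of all these elements is a free $R$-basis of $A$. Put $\hat A^\lambda=R\text{-span}\{{}_sC_t^\mu:\mu\in\Lambda,\ \mu>\lambda,\ s\in L(\mu),\ t\in R(\mu)\}$. $A$ is a cell algebra with poset $\Lambda$ and cell basis $C$ if (i) for all $a\in A$, $\lambda\in\Lambda$, $s,s'\in L(\lambda)$ there is $r_L=r_L(a,\lambda,s,s')\in R$ such that for every $t\in R(\lambda)$, $a\cdot{}_sC_t^\lambda\equiv\sum_{s'\in L(\lambda)}r_L(a,\lambda,s,s')\,{}_{s'}C_t^\lambda \bmod \hat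 A^\lambda$; and (ii) for all $a\in A$, $\lambda\in\Lambda$, $t,t'\in R(\lambda)$ there is $r_R=r_R(a,\lambda,t,t')\in R$ such that for every $s\in L(\lambda)$, ${}_sC_t^\lambda\cdot a\equiv\sum_{t'\in R(\lambda)}r_R(a,\lambda,t,t')\,{}_sC_{t'}^\lambda\bmod\hat A^\lambda$. Monoid notation: $\mathcal{L},\mathcal{R},\mathcal{H},\mathcal{D}$ are Green's relations on $M$ ($x\mathcal{L}y$ iff $Mx=My$; $x\mathcal{R}y$ iff $xM=yM$). The $\mathcal{D}$-classes are partially ordered by $D_x\le D_y$ iff $x\in MyM$. For each $\mathcal{D}$-class $D$ fix a base element $\gamma\in D$ and let $H=H_\gamma$ be its $\mathcal{H}$-class. Put $RT(H)=\{m\in M:Hm\subseteq H\}$; for $m\in RT(H)$ let $r_m:H\to H$, $h\mapsto hm$ (a bijection). The Schutzenberger group of $D$ is $G_D=G_H^R=\{r_m:m\in RT(H)\}$ with product $r_mr_n=r_{mn}$; up to isomorphism it depends only on $D$. The map $\phi_H^R:G_D\to H$, $r_m\mapsto\gamma m$, is a bijection, extended linearly to $R[G_D]\to R[H]$. $R$-C.A. condition: $R[G_D]$ has a cell algebra structure for every $\mathcal{D}$-class $D$ of $M$. Egg-box: let $R_1,\dots,R_{n(D,R)}$ be the $\mathcal{R}$-classes and $L_1,\dots,L_{n(D,L)}$ the $\mathcal{L}$-classes in $D$, with ${}_iH_j=R_i\cap L_j$ and ${}_1H_1=H$. Fix elements $a_i,\bar a_i,b_j,\bar b_j\in M$ (they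 exist by Green's lemma) such that for every $j$, $h\mapsto a_ih$ is a bijection ${}_1H_j\to{}_iH_j$ with inverse $h\mapsto\bar a_ih$, and for every $i$, $h\mapsto hb_j$ is a bijection ${}_iH_1\to{}_iH_j$ with inverse $h\mapsto h\bar b_j$. Standard cell basis: for each $D$ let $R[G_D]$ have the chosen cell structure with poset $\Lambda_D$, index sets $L_D(\lambda),R_D(\lambda)$ and cell basis $\{{}_sC_t^\lambda\}$. Let $\Lambda$ be the set of pairs $(D,\lambda)$, $D$ a $\mathcal{D}$-class, $\lambda\in\Lambda_D$, with $(D_1,\lambda_1)>(D_2,\lambda_2)$ iff $D_1<D_2$, or $D_1=D_2$ and $\lambda_1>\lambda_2$ in $\Lambda_{D_1}$. Let $L(D,\lambda)$ be the set of pairs $(R_i,s)$ with $R_i$ an $\mathcal{R}$-class in $D$, $s\in L_D(\lambda)$; let $R(D,\lambda)$ be the set of pairs $(L_j,t)$ with $L_j$ an $\mathcal{L}$-class in $D$, $t\in R_D(\lambda)$; and put ${}_{(R_i,s)}C_{(L_j,t)}^{(D,\lambda)}=a_i\,\phi_H^R({}_sC_t^\lambda)\,b_j\in R[{}_iH_j]$. *)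

theory Defs
  imports "HOL-Algebra.Algebra"
begin

section \<open>Associative algebras, spans and free bases\<close>

text \<open>
  The locale \<^locale>\<open>algebra\<close> of HOL-Algebra describes commutative algebras; here the
  multiplication of \<open>A\<close> need not be commutative.
\<close>

locale assoc_algebra = module R A + A?: ring A for R (structure) and A (structure) +
  assumes smult_mult_left:
      "\<lbrakk>c \<in> carrier R; x \<in> carrier A; y \<in> carrier A\<rbrakk>
        \<Longrightarrow> (c \<odot>\<^bsub>A\<^esub> x) \<otimes>\<^bsub>A\<^esub> y = c \<odot>\<^bsub>A\<^esub> (x \<otimes>\<^bsub>A\<^esub> y)"
    and smult_mult_right:
      "\<lbrakk>c \<in> carrier R; x \<in> carrier A; y \<in> carrier A\<rbrakk>
        \<Longrightarrow> x \<otimes>\<^bsub>A\<^esub> (c \<odot>\<^bsub>A\<^esub> y) = c \<odot>\<^bsub>A\<^esub> (x \<otimes>\<^bsub>A\<^esub> y)"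

definition lin_span :: "('r, 'x) ring_scheme \<Rightarrow> ('r, 'a, 'y) module_scheme \<Rightarrow> 'a set \<Rightarrow> 'a set"
  where "lin_span R A S =
    {(\<Oplus>\<^bsub>A\<^esub>b\<in>F. c b \<odot>\<^bsub>A\<^esub> b) | F c. finite F \<and> F \<subseteq> S \<and> c \<in> F \<rightarrow> carrier R}"

definition lin_indep :: "('r, 'x) ring_scheme \<Rightarrow> ('r, 'a, 'y) module_scheme \<Rightarrow> 'a set \<Rightarrow> bool"
  where "lin_indep R A S \<longleftrightarrow>
    (\<forall>F c. finite F \<and> F \<subseteq> S \<and> c \<in> F \<rightarrow> carrier R \<and>
       (\<Oplus>\<^bsub>A\<^esub>b\<in>F. c b \<odot>\<^bsub>A\<^esub> b) = \<zero>\<^bsub>A\<^esub> \<longrightarrow> (\<forall>b\<in>F. c b = \<zero>\<^bsub>R\<^esub>))"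

definition free_basis :: "('r, 'x) ring_scheme \<Rightarrow> ('r, 'a, 'y) module_scheme \<Rightarrow> 'a set \<Rightarrow> bool"
  where "free_basis R A B \<longleftrightarrow>
    B \<subseteq> carrier A \<and> lin_indep R A B \<and> lin_span R A B = carrier A"


section \<open>Cell algebras\<close>

text \<open>
  A candidate for a cell structure: a poset \<open>\<Lambda>\<close> (carrier and non-strict order relation),
  the left and right index sets, and the elements \<open>\<^sub>sC\<^sub>t\<^sup>\<nu>\<close>, written
  \<open>cell_elem cd \<nu> s t\<close> (the letter \<open>\<lambda>\<close> is reserved in HOL).
\<close>

record ('l, 'i, 'j, 'a) cell_datum =
  cell_poset :: "'l set"
  cell_le :: "'l rel"
  cell_left :: "'l \<Rightarrow> 'i set"
  cell_right :: "'l \<Rightarrow> 'j set"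
  cell_elem :: "'l \<Rightarrow> 'i \<Rightarrow> 'j \<Rightarrow> 'a"

definition cell_index :: "('l, 'i, 'j, 'a) cell_datum \<Rightarrow> ('l \<times> 'i \<times> 'j) set"
  where "cell_index cd =
    (SIGMA \<nu>:cell_poset cd. cell_left cd \<nu> \<times> cell_right cd \<nu>)"

definition cell_basis :: "('l, 'i, 'j, 'a) cell_datum \<Rightarrow> 'a set"
  where "cell_basis cd = (\<lambda>(\<nu>, s, t). cell_elem cd \<nu> s t) ` cell_index cd"

definition cell_hat ::
    "('r, 'x) ring_scheme \<Rightarrow> ('r, 'a, 'y) module_scheme \<Rightarrow> ('l, 'i, 'j, 'a) cell_datum \<Rightarrow> 'l \<Rightarrow> 'a set"
  where "cell_hat R A cd \<nu> = lin_span R A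
    {cell_elem cd \<mu> s t | \<mu> s t. \<mu> \<in> cell_poset cd \<and> (\<nu>, \<mu>) \<in> cell_le cd \<and> \<nu> \<noteq> \<mu> \<and>
       s \<in> cell_left cd \<mu> \<and> t \<in> cell_right cd \<mu>}"

locale cell_structure = assoc_algebra R A + domain R
  for R :: "('r, 'x) ring_scheme" (structure) and A :: "('r, 'a, 'y) module_scheme" (structure)
    and cd :: "('l, 'i, 'j, 'a) cell_datum" +
  assumes finite_poset: "finite (cell_poset cd)"
    and partial_order: "partial_order_on (cell_poset cd) (cell_le cd)"
    and finite_left: "\<nu> \<in> cell_poset cd \<Longrightarrow> finite (cell_left cd \<nu>)"
    and finite_right: "\<nu> \<in> cell_poset cd \<Longrightarrow> finite (cell_right cd \<nu>)"
    and inj_elem: "inj_on (\<lambda>(\<nu>, s, t). cell_elem cd \<nu> s t) (cell_index cd)"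
    and basis: "free_basis R A (cell_basis cd)"
    and left_mult:
      "\<lbrakk>a \<in> carrier A; \<nu> \<in> cell_poset cd; s \<in> cell_left cd \<nu>\<rbrakk> \<Longrightarrow>
        \<exists>r \<in> cell_left cd \<nu> \<rightarrow> carrier R. \<forall>t \<in> cell_right cd \<nu>.
          a \<otimes>\<^bsub>A\<^esub> cell_elem cd \<nu> s t
            \<ominus>\<^bsub>A\<^esub> (\<Oplus>\<^bsub>A\<^esub>s'\<in>cell_left cd \<nu>. r s' \<odot>\<^bsub>A\<^esub> cell_elem cd \<nu> s' t)
          \<in> cell_hat R A cd \<nu>"
    and right_mult:
      "\<lbrakk>a \<in> carrier A; \<nu> \<in> cell_poset cd; t \<in> cell_right cd \<nu>\<rbrakk> \<Longrightarrow>
        \<exists>r \<in> cell_right cd \<nu> \<rightarrow> carrier R. \<forall>s \<in> cell_left cd \<nu>.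
          cell_elem cd \<nu> s t \<otimes>\<^bsub>A\<^esub> a
            \<ominus>\<^bsub>A\<^esub> (\<Oplus>\<^bsub>A\<^esub>t'\<in>cell_right cd \<nu>. r t' \<odot>\<^bsub>A\<^esub> cell_elem cd \<nu> s t')
          \<in> cell_hat R A cd \<nu>"

text \<open>
  HOL cannot quantify existentially over types. As the poset and all index sets are
  finite, they can be relabelled by natural numbers, so nothing is lost by using \<open>nat\<close>.
\<close>

definition is_cell_algebra :: "('r, 'x) ring_scheme \<Rightarrow> ('r, 'a, 'y) module_scheme \<Rightarrow> bool"
  where "is_cell_algebra R A \<longleftrightarrow>
    (\<exists>cd :: (nat, nat, nat, 'a) cell_datum. cell_structure R A cd)"


section \<open>The algebra of a finite monoid\<close>

text \<open>
  The elements of \<open>R[M]\<close> are the functions from \<open>M\<close> to \<open>R\<close>, with convolution as product.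
  There is no finite-support condition, so this is only meaningful for finite \<open>M\<close>.
\<close>

definition monoid_algebra ::
    "('r, 'x) ring_scheme \<Rightarrow> ('m, 'y) monoid_scheme \<Rightarrow> ('r, 'm \<Rightarrow> 'r) module"
  where "monoid_algebra R M =
    \<lparr>partial_object.carrier = carrier M \<rightarrow>\<^sub>E carrier R,
     monoid.mult = (\<lambda>f g. \<lambda>x\<in>carrier M.
       \<Oplus>\<^bsub>R\<^esub>p \<in> {p \<in> carrier M \<times> carrier M. fst p \<otimes>\<^bsub>M\<^esub> snd p = x}. f (fst p) \<otimes>\<^bsub>R\<^esub> g (snd p)),
     monoid.one = (\<lambda>x\<in>carrier M. if x = \<one>\<^bsub>M\<^esub> then \<one>\<^bsub>R\<^esub> else \<zero>\<^bsub>R\<^esub>),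
     ring.zero = (\<lambda>x\<in>carrier M. \<zero>\<^bsub>R\<^esub>),
     ring.add = (\<lambda>f g. \<lambda>x\<in>carrier M. f x \<oplus>\<^bsub>R\<^esub> g x),
     module.smult = (\<lambda>c f. \<lambda>x\<in>carrier M. c \<otimes>\<^bsub>R\<^esub> f x)\<rparr>"

definition monoid_elem ::
    "('r, 'x) ring_scheme \<Rightarrow> ('m, 'y) monoid_scheme \<Rightarrow> 'm \<Rightarrow> 'm \<Rightarrow> 'r"
  where "monoid_elem R M m = (\<lambda>x\<in>carrier M. if x = m then \<one>\<^bsub>R\<^esub> else \<zero>\<^bsub>R\<^esub>)"


section \<open>Green's relations\<close>

definition green_L :: "('m, 'y) monoid_scheme \<Rightarrow> 'm rel"
  where "green_L M = {(x, y). x \<in> carrier M \<and> y \<in> carrier M \<and>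
    carrier M #>\<^bsub>M\<^esub> x = carrier M #>\<^bsub>M\<^esub> y}"

definition green_R :: "('m, 'y) monoid_scheme \<Rightarrow> 'm rel"
  where "green_R M = {(x, y). x \<in> carrier M \<and> y \<in> carrier M \<and>
    x <#\<^bsub>M\<^esub> carrier M = y <#\<^bsub>M\<^esub> carrier M}"

definition green_H :: "('m, 'y) monoid_scheme \<Rightarrow> 'm rel"
  where "green_H M = green_L M \<inter> green_R M"

definition green_D :: "('m, 'y) monoid_scheme \<Rightarrow> 'm rel"
  where "green_D M = green_L M O green_R M"

definition D_classes :: "('m, 'y) monoid_scheme \<Rightarrow> 'm set set"
  where "D_classes M = carrier M // green_D M"

definition D_le :: "('m, 'y) monoid_scheme \<Rightarrow> 'm set \<Rightarrow> 'm set \<Rightarrow> bool"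
  where "D_le M D1 D2 \<longleftrightarrow>
    (\<exists>x\<in>D1. \<exists>y\<in>D2. x \<in> (carrier M #>\<^bsub>M\<^esub> y) <#>\<^bsub>M\<^esub> carrier M)"

definition R_classes_in :: "('m, 'y) monoid_scheme \<Rightarrow> 'm set \<Rightarrow> 'm set set"
  where "R_classes_in M D = {K \<in> carrier M // green_R M. K \<subseteq> D}"

definition L_classes_in :: "('m, 'y) monoid_scheme \<Rightarrow> 'm set \<Rightarrow> 'm set set"
  where "L_classes_in M D = {K \<in> carrier M // green_L M. K \<subseteq> D}"


section \<open>Schutzenberger groups\<close>

definition RT :: "('m, 'y) monoid_scheme \<Rightarrow> 'm set \<Rightarrow> 'm set"
  where "RT M H = {m \<in> carrier M. H #>\<^bsub>M\<^esub> m \<subseteq> H}"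

definition right_transl :: "('m, 'y) monoid_scheme \<Rightarrow> 'm set \<Rightarrow> 'm \<Rightarrow> 'm \<Rightarrow> 'm"
  where "right_transl M H m = (\<lambda>h\<in>H. h \<otimes>\<^bsub>M\<^esub> m)"

text \<open>
  The product is \<open>r\<^sub>m r\<^sub>n = r\<^bsub>mn\<^esub>\<close>, that is, first \<open>r\<^sub>m\<close> and then \<open>r\<^sub>n\<close>.
\<close>

definition schutz_group :: "('m, 'y) monoid_scheme \<Rightarrow> 'm set \<Rightarrow> ('m \<Rightarrow> 'm) monoid"
  where "schutz_group M H =
    \<lparr>partial_object.carrier = right_transl M H ` RT M H,
     monoid.mult = (\<lambda>f g. compose H g f),
     monoid.one = right_transl M H \<one>\<^bsub>M\<^esub>\<rparr>"

text \<open>\<open>G\<^sub>D\<close> for the \<open>\<D>\<close>-class of \<open>\<gamma>\<close>, computed from the \<open>\<H>\<close>-class of \<open>\<gamma>\<close>.\<close>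

abbreviation schutz_group_at :: "('m, 'y) monoid_scheme \<Rightarrow> 'm \<Rightarrow> ('m \<Rightarrow> 'm) monoid"
  where "schutz_group_at M \<gamma> \<equiv> schutz_group M (green_H M `` {\<gamma>})"

text \<open>
  The linear extension \<open>R[G\<^sub>D] \<rightarrow> R[H] \<subseteq> R[M]\<close> of \<open>r\<^sub>m \<mapsto> \<gamma>m\<close>. Since \<open>\<gamma> \<in> H\<close>,
  the element \<open>\<gamma>m\<close> is the value of the map \<open>r\<^sub>m\<close> at \<open>\<gamma>\<close>.
\<close>

definition schutz_phi ::
    "('r, 'x) ring_scheme \<Rightarrow> ('m, 'y) monoid_scheme \<Rightarrow> 'm \<Rightarrow> (('m \<Rightarrow> 'm) \<Rightarrow> 'r) \<Rightarrow> 'm \<Rightarrow> 'r"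
  where "schutz_phi R M \<gamma> f =
    (\<Oplus>\<^bsub>monoid_algebra R M\<^esub>g\<in>carrier (schutz_group_at M \<gamma>).
       f g \<odot>\<^bsub>monoid_algebra R M\<^esub> monoid_elem R M (g \<gamma>))"

definition base_choice :: "('m, 'y) monoid_scheme \<Rightarrow> ('m set \<Rightarrow> 'm) \<Rightarrow> bool"
  where "base_choice M \<gamma> \<longleftrightarrow> (\<forall>D\<in>D_classes M. \<gamma> D \<in> D)"

definition CA_condition ::
    "('r, 'x) ring_scheme \<Rightarrow> ('m, 'y) monoid_scheme \<Rightarrow> ('m set \<Rightarrow> 'm) \<Rightarrow> bool"
  where "CA_condition R M \<gamma> \<longleftrightarrow>
    (\<forall>D\<in>D_classes M. is_cell_algebra R (monoid_algebra R (schutz_group_at M (\<gamma> D))))"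


section \<open>The standard cell basis\<close>

text \<open>
  The elements \<open>a\<^sub>i\<close>, \<open>\<bar>a\<^sub>i\<close> are indexed by the \<open>\<R>\<close>-class \<open>R\<^sub>i\<close> itself, and \<open>b\<^sub>j\<close>,
  \<open>\<bar>b\<^sub>j\<close> by the \<open>\<L>\<close>-class \<open>L\<^sub>j\<close>; such a class determines its \<open>\<D>\<close>-class. The distinguished
  classes \<open>R\<^sub>1\<close> and \<open>L\<^sub>1\<close> are those of the base element \<open>\<gamma> D\<close>.
\<close>

definition eggbox_choice ::
    "('m, 'y) monoid_scheme \<Rightarrow> ('m set \<Rightarrow> 'm) \<Rightarrow>
     ('m set \<Rightarrow> 'm) \<Rightarrow> ('m set \<Rightarrow> 'm) \<Rightarrow> ('m set \<Rightarrow> 'm) \<Rightarrow> ('m set \<Rightarrow> 'm) \<Rightarrow> bool"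
  where "eggbox_choice M \<gamma> a a' b b' \<longleftrightarrow>
    (\<forall>D\<in>D_classes M.
      (let R1 = green_R M `` {\<gamma> D}; L1 = green_L M `` {\<gamma> D} in
        (\<forall>Ri\<in>R_classes_in M D. a Ri \<in> carrier M \<and> a' Ri \<in> carrier M \<and>
          (\<forall>Lj\<in>L_classes_in M D.
            bij_betw (\<lambda>h. a Ri \<otimes>\<^bsub>M\<^esub> h) (R1 \<inter> Lj) (Ri \<inter> Lj) \<and>
            (\<forall>h \<in> Ri \<inter> Lj. a' Ri \<otimes>\<^bsub>M\<^esub> h = inv_into (R1 \<inter> Lj) (\<lambda>k. a Ri \<otimes>\<^bsub>M\<^esub> k) h))) \<and>
        (\<forall>Lj\<in>L_classes_in M D. b Lj \<in> carrier M \<and> b' Lj \<in> carrier M \<and>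
          (\<forall>Ri\<in>R_classes_in M D.
            bij_betw (\<lambda>h. h \<otimes>\<^bsub>M\<^esub> b Lj) (Ri \<inter> L1) (Ri \<inter> Lj) \<and>
            (\<forall>h \<in> Ri \<inter> Lj. h \<otimes>\<^bsub>M\<^esub> b' Lj = inv_into (Ri \<inter> L1) (\<lambda>k. k \<otimes>\<^bsub>M\<^esub> b Lj) h)))))"

definition standard_poset ::
    "('m, 'y) monoid_scheme \<Rightarrow> ('m set \<Rightarrow> ('l, 'i, 'j, 'a) cell_datum) \<Rightarrow> ('m set \<times> 'l) set"
  where "standard_poset M cd = (SIGMA D:D_classes M. cell_poset (cd D))"

text \<open>The order of the \<open>\<D>\<close>-classes enters reversed: lower \<open>\<D>\<close>-classes are larger in \<open>\<Lambda>\<close>.\<close>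

definition standard_le ::
    "('m, 'y) monoid_scheme \<Rightarrow> ('m set \<Rightarrow> ('l, 'i, 'j, 'a) cell_datum) \<Rightarrow> ('m set \<times> 'l) rel"
  where "standard_le M cd =
    {((D2, \<nu>2), (D1, \<nu>1)).
       (D2, \<nu>2) \<in> standard_poset M cd \<and> (D1, \<nu>1) \<in> standard_poset M cd \<and>
       (D_le M D1 D2 \<and> D1 \<noteq> D2 \<or> D1 = D2 \<and> (\<nu>2, \<nu>1) \<in> cell_le (cd D1))}"

definition standard_cell_datum ::
    "('r, 'x) ring_scheme \<Rightarrow> ('m, 'y) monoid_scheme \<Rightarrow> ('m set \<Rightarrow> 'm) \<Rightarrow>
     ('m set \<Rightarrow> 'm) \<Rightarrow> ('m set \<Rightarrow> 'm) \<Rightarrow>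
     ('m set \<Rightarrow> ('l, 'i, 'j, ('m \<Rightarrow> 'm) \<Rightarrow> 'r) cell_datum) \<Rightarrow>
     ('m set \<times> 'l, 'm set \<times> 'i, 'm set \<times> 'j, 'm \<Rightarrow> 'r) cell_datum"
  where "standard_cell_datum R M \<gamma> a b cd =
    \<lparr>cell_poset = standard_poset M cd,
     cell_le = standard_le M cd,
     cell_left = (\<lambda>(D, \<nu>). R_classes_in M D \<times> cell_left (cd D) \<nu>),
     cell_right = (\<lambda>(D, \<nu>). L_classes_in M D \<times> cell_right (cd D) \<nu>),
     cell_elem = (\<lambda>(D, \<nu>) (Ri, s) (Lj, t).
       monoid_elem R M (a Ri)
         \<otimes>\<^bsub>monoid_algebra R M\<^esub> schutz_phi R M (\<gamma> D) (cell_elem (cd D) \<nu> s t)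
         \<otimes>\<^bsub>monoid_algebra R M\<^esub> monoid_elem R M (b Lj))\<rparr>"

end

theory Submission
  imports Defs
begin

text \<open>
  The cells \<open>R\<^sub>i \<inter> L\<^sub>j\<close> of the egg-boxes partition \<open>M\<close>, and
  \<open>g \<mapsto> a\<^sub>i g(\<gamma>) b\<^sub>j\<close> is a bijection from the Schutzenberger group \<open>G\<^sub>D\<close> onto such a cell
  (\<open>coord_bij\<close>). As a module, \<open>R[M]\<close> is therefore a direct sum of copies of the group algebras
  \<open>R[G\<^sub>D]\<close>, one copy for each cell, and the standard family is the union of the copies of their cell
  bases (\<open>std_elem\<close>). So it is a basis (\<open>std_basis\<close>).

  For the multiplication axioms it is enough to multiply by elements \<open>m\<close> of \<open>M\<close>, as the congruences
  required are stable under linear combinations (\<open>uniform_congruence_submodule\<close>). Since \<open>M\<close> is finite,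
  \<open>\<D>\<close>-classes are the classes of elements generating the same two-sided ideal, and multiplication
  by \<open>m\<close> can leave a \<open>\<D>\<close>-class \<open>D\<close> only downwards. For a fixed row \<open>R\<^sub>i\<close> of \<open>D\<close> there are two
  possibilities (\<open>coord_left_mult\<close>). Either \<open>m\<close> sends every cell of the row strictly below \<open>D\<close>; then
  the products lie in the submodule spanned by later elements, because the order of the
  \<open>\<D>\<close>-classes is reversed in the poset. Or there are a row \<open>R\<^sub>k\<close> and one element \<open>u\<close> of \<open>G\<^sub>D\<close> such that
  \<open>m\<close> maps each cell \<open>R\<^sub>i \<inter> L\<^sub>j\<close> to \<open>R\<^sub>k \<inter> L\<^sub>j\<close> and acts there, in the coordinates above, as left
  multiplication by \<open>u\<close>. Then the coefficients of \<open>u\<close> for the cell structure of \<open>R[G\<^sub>D]\<close> also serve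
  for \<open>m\<close>, and they depend neither on the column nor on the right index. Right multiplication is
  treated in the same way, with \<open>u\<close> acting from the right (\<open>coord_right_mult\<close>).

  That \<open>R[M]\<close> is a cell algebra follows because egg-box translations exist by Green's lemma
  (\<open>eggbox_choice_exists\<close>), and because the finite index sets may be renamed by natural numbers
  (\<open>cell_structure_relabel\<close>).
\<close>

section \<open>Linear maps, spans and independent families\<close>

definition linear_map ::
    "('r, 'x) ring_scheme \<Rightarrow> ('r, 'a, 'y) module_scheme \<Rightarrow> ('r, 'b, 'z) module_scheme \<Rightarrow> ('a \<Rightarrow> 'b) \<Rightarrow> bool"
  where "linear_map R A B F \<longleftrightarrow>
    F \<in> carrier A \<rightarrow> carrier B \<and>
    (\<forall>x\<in>carrier A. \<forall>y\<in>carrier A. F (x \<oplus>\<^bsub>A\<^esub> y) = F x \<oplus>\<^bsub>B\<^esub> F y) \<and>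
    (\<forall>c\<in>carrier R. \<forall>x\<in>carrier A. F (c \<odot>\<^bsub>A\<^esub> x) = c \<odot>\<^bsub>B\<^esub> F x)"

lemma linear_mapI:
  assumes "\<And>x. x \<in> carrier A \<Longrightarrow> F x \<in> carrier B"
    and "\<And>x y. \<lbrakk>x \<in> carrier A; y \<in> carrier A\<rbrakk> \<Longrightarrow> F (x \<oplus>\<^bsub>A\<^esub> y) = F x \<oplus>\<^bsub>B\<^esub> F y"
    and "\<And>c x. \<lbrakk>c \<in> carrier R; x \<in> carrier A\<rbrakk> \<Longrightarrow> F (c \<odot>\<^bsub>A\<^esub> x) = c \<odot>\<^bsub>B\<^esub> F x"
  shows "linear_map R A B F"
  using assms by (auto simp: linear_map_def)

lemma linear_mapD:
  assumes "linear_map R A B F"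
  shows "x \<in> carrier A \<Longrightarrow> F x \<in> carrier B"
    and "\<lbrakk>x \<in> carrier A; y \<in> carrier A\<rbrakk> \<Longrightarrow> F (x \<oplus>\<^bsub>A\<^esub> y) = F x \<oplus>\<^bsub>B\<^esub> F y"
    and "\<lbrakk>c \<in> carrier R; x \<in> carrier A\<rbrakk> \<Longrightarrow> F (c \<odot>\<^bsub>A\<^esub> x) = c \<odot>\<^bsub>B\<^esub> F x"
  using assms by (auto simp: linear_map_def)

lemma linear_map_zero:
  assumes "module R A" and "module R B" and F: "linear_map R A B F"
  shows "F \<zero>\<^bsub>A\<^esub> = \<zero>\<^bsub>B\<^esub>"
proof -
  interpret A: module R A by fact
  interpret B: module R B by fact
  have "F (\<zero>\<^bsub>R\<^esub> \<odot>\<^bsub>A\<^esub> \<zero>\<^bsub>A\<^esub>) = \<zero>\<^bsub>R\<^esub> \<odot>\<^bsub>B\<^esub> F \<zero>\<^bsub>A\<^esub>"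
    using linear_mapD(3)[OF F] by blast
  then show ?thesis
    using linear_mapD(1)[OF F] by simp
qed

lemma linear_map_finsum:
  assumes "module R A" and "module R B" and F: "linear_map R A B F"
    and c: "c \<in> J \<rightarrow> carrier R" and v: "v \<in> J \<rightarrow> carrier A"
  shows "F (\<Oplus>\<^bsub>A\<^esub>x\<in>J. c x \<odot>\<^bsub>A\<^esub> v x) = (\<Oplus>\<^bsub>B\<^esub>x\<in>J. c x \<odot>\<^bsub>B\<^esub> F (v x))"
proof -
  interpret A: module R A by fact
  interpret B: module R B by fact
  note [simp] = linear_mapD[OF F]
  show ?thesis
    using c v
  proof (induction J rule: infinite_finite_induct)
    case (insert x J)
    then have "(\<lambda>x. c x \<odot>\<^bsub>A\<^esub> v x) \<in> J \<rightarrow> carrier A" "(\<lambda>x. c x \<odot>\<^bsub>B\<^esub> F (v x)) \<in> J \<rightarrow> carrier B"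
      by (auto simp: Pi_iff)
    with insert show ?case
      by (simp add: A.M.finsum_insert B.M.finsum_insert)
  qed (simp_all add: linear_map_zero[OF assms(1-3)])
qed

lemma linear_map_minus:
  assumes "module R A" and "module R B" and F: "linear_map R A B F"
    and "x \<in> carrier A" "y \<in> carrier A"
  shows "F (x \<ominus>\<^bsub>A\<^esub> y) = F x \<ominus>\<^bsub>B\<^esub> F y"
proof -
  interpret A: module R A by fact
  interpret B: module R B by fact
  have "F (\<ominus>\<^bsub>A\<^esub> y) \<oplus>\<^bsub>B\<^esub> F y = F (\<ominus>\<^bsub>A\<^esub> y \<oplus>\<^bsub>A\<^esub> y)"
    using assms(5) by (simp add: linear_mapD(2)[OF F])
  also have "\<dots> = \<zero>\<^bsub>B\<^esub>"
    using assms by (simp add: A.M.l_neg linear_map_zero)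
  finally have "F (\<ominus>\<^bsub>A\<^esub> y) = \<ominus>\<^bsub>B\<^esub> F y"
    using assms(5) linear_mapD(1)[OF F] by (simp add: B.M.minus_equality)
  then show ?thesis
    using assms(4,5) by (simp add: a_minus_def linear_mapD(2)[OF F])
qed

lemma linear_map_compose:
  assumes "linear_map R A B F" and "linear_map R B C F'"
  shows "linear_map R A C (\<lambda>x. F' (F x))"
  using assms by (auto simp: linear_map_def Pi_iff)

lemma linear_map_id: "linear_map R B B (\<lambda>x. x)"
  by (simp add: linear_map_def)

lemma linear_map_zero_map: "module R A \<Longrightarrow> module R B \<Longrightarrow> linear_map R A B (\<lambda>_. \<zero>\<^bsub>B\<^esub>)"
proof -
  assume "module R A" "module R B"
  then interpret B: module R B by simp
  show "linear_map R A B (\<lambda>_. \<zero>\<^bsub>B\<^esub>)"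
    by (rule linear_mapI) simp_all
qed

context module
begin

lemma submodule_finsum:
  assumes N: "submodule N R M" and c: "c \<in> J \<rightarrow> carrier R" and v: "v \<in> J \<rightarrow> N"
  shows "(\<Oplus>\<^bsub>M\<^esub>x\<in>J. c x \<odot>\<^bsub>M\<^esub> v x) \<in> N"
proof -
  note sub = submoduleE[OF N]
  have zero: "\<zero>\<^bsub>M\<^esub> \<in> N"
    using subgroup.one_closed[OF submodule.axioms(1)[OF N]] by simp
  show ?thesis
    using c v
  proof (induction J rule: infinite_finite_induct)
    case (insert x J)
    then have "(\<lambda>x. c x \<odot>\<^bsub>M\<^esub> v x) \<in> J \<rightarrow> carrier M" "v x \<in> carrier M"
      using sub(1) by (auto simp: Pi_iff)
    with insert show ?case
      by (simp add: M.finsum_insert sub)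
  qed (simp_all add: zero)
qed

lemma lin_span_submodule:
  assumes S: "S \<subseteq> carrier M"
  shows "submodule (lin_span R M S) R M"
proof (rule submoduleI)
  \<comment> \<open>A combination over \<open>F\<close> is one over any larger finite set, by padding with zero coefficients.\<close>
  have extend: "\<exists>c' \<in> F' \<rightarrow> carrier R. (\<Oplus>\<^bsub>M\<^esub>b\<in>F. c b \<odot>\<^bsub>M\<^esub> b) = (\<Oplus>\<^bsub>M\<^esub>b\<in>F'. c' b \<odot>\<^bsub>M\<^esub> b)"
    if "finite F'" "F \<subseteq> F'" "F' \<subseteq> S" "c \<in> F \<rightarrow> carrier R" for F F' c
  proof (rule bexI[where x = "\<lambda>b. if b \<in> F then c b else \<zero>"])
    show "(\<Oplus>\<^bsub>M\<^esub>b\<in>F. c b \<odot>\<^bsub>M\<^esub> b) = (\<Oplus>\<^bsub>M\<^esub>b\<in>F'. (if b \<in> F then c b else \<zero>) \<odot>\<^bsub>M\<^esub> b)"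
      using that S
      by (intro M.add.finprod_mono_neutral_cong_left) (auto simp: subset_iff Pi_iff)
  qed (use that in auto)
  have mem: "c \<in> F \<rightarrow> carrier R \<Longrightarrow> F \<subseteq> S \<Longrightarrow> (\<lambda>b. c b \<odot>\<^bsub>M\<^esub> b) \<in> F \<rightarrow> carrier M" for c F
    using S by auto
  show "lin_span R M S \<subseteq> carrier M"
    using mem by (auto simp: lin_span_def intro!: M.finsum_closed)
  show "\<zero>\<^bsub>M\<^esub> \<in> lin_span R M S"
    by (auto simp: lin_span_def intro!: exI[where x = "{}"])
  show smult: "r \<odot>\<^bsub>M\<^esub> x \<in> lin_span R M S" if rx: "r \<in> carrier R" "x \<in> lin_span R M S" for r x
  proof -
    obtain F c where F: "finite F" "F \<subseteq> S" "c \<in> F \<rightarrow> carrier R" "x = (\<Oplus>\<^bsub>M\<^esub>b\<in>F. c b \<odot>\<^bsub>M\<^esub> b)"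
      using rx(2) by (auto simp: lin_span_def)
    have "r \<odot>\<^bsub>M\<^esub> x = (\<Oplus>\<^bsub>M\<^esub>b\<in>F. r \<odot>\<^bsub>M\<^esub> (c b \<odot>\<^bsub>M\<^esub> b))"
      using F mem[OF F(3,2)] rx(1) by (simp add: finsum_smult_ldistr)
    also have "\<dots> = (\<Oplus>\<^bsub>M\<^esub>b\<in>F. (r \<otimes> c b) \<odot>\<^bsub>M\<^esub> b)"
      using F S rx(1)
      by (intro M.finsum_cong') (auto simp: smult_assoc1 Pi_iff subset_iff)
    finally show ?thesis
      using F rx(1) unfolding lin_span_def
      by (intro CollectI exI[where x = F] exI[where x = "\<lambda>b. r \<otimes> c b"]) auto
  qed
  show "x \<oplus>\<^bsub>M\<^esub> y \<in> lin_span R M S" if xy: "x \<in> lin_span R M S" "y \<in> lin_span R M S" for x y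
  proof -
    obtain F c where F: "finite F" "F \<subseteq> S" "c \<in> F \<rightarrow> carrier R" "x = (\<Oplus>\<^bsub>M\<^esub>b\<in>F. c b \<odot>\<^bsub>M\<^esub> b)"
      using xy(1) by (auto simp: lin_span_def)
    obtain F' d where F': "finite F'" "F' \<subseteq> S" "d \<in> F' \<rightarrow> carrier R" "y = (\<Oplus>\<^bsub>M\<^esub>b\<in>F'. d b \<odot>\<^bsub>M\<^esub> b)"
      using xy(2) by (auto simp: lin_span_def)
    let ?U = "F \<union> F'"
    have U: "finite ?U" "?U \<subseteq> S"
      using F F' by auto
    obtain c' where c': "c' \<in> ?U \<rightarrow> carrier R" "x = (\<Oplus>\<^bsub>M\<^esub>b\<in>?U. c' b \<odot>\<^bsub>M\<^esub> b)"
      using extend[OF U(1) _ U(2) F(3)] F(4) by auto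
    obtain d' where d': "d' \<in> ?U \<rightarrow> carrier R" "y = (\<Oplus>\<^bsub>M\<^esub>b\<in>?U. d' b \<odot>\<^bsub>M\<^esub> b)"
      using extend[OF U(1) _ U(2) F'(3)] F'(4) by auto
    have "x \<oplus>\<^bsub>M\<^esub> y = (\<Oplus>\<^bsub>M\<^esub>b\<in>?U. c' b \<odot>\<^bsub>M\<^esub> b \<oplus>\<^bsub>M\<^esub> d' b \<odot>\<^bsub>M\<^esub> b)"
      using mem[OF c'(1) U(2)] mem[OF d'(1) U(2)] by (simp add: c' d' M.finsum_addf)
    also have "\<dots> = (\<Oplus>\<^bsub>M\<^esub>b\<in>?U. (c' b \<oplus> d' b) \<odot>\<^bsub>M\<^esub> b)"
      using c'(1) d'(1) S U(2)
      by (intro M.finsum_cong') (auto simp: smult_l_distr Pi_iff subset_iff)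
    finally show ?thesis
      using U c'(1) d'(1) unfolding lin_span_def
      by (intro CollectI exI[where x = ?U] exI[where x = "\<lambda>b. c' b \<oplus> d' b"]) auto
  qed
  show "\<ominus>\<^bsub>M\<^esub> x \<in> lin_span R M S" if "x \<in> lin_span R M S" for x
  proof -
    have "x \<in> carrier M"
      using that mem by (auto simp: lin_span_def intro!: M.finsum_closed)
    then have "\<ominus>\<^bsub>M\<^esub> x = (\<ominus> \<one>) \<odot>\<^bsub>M\<^esub> x"
      by (simp add: smult_l_minus)
    then show ?thesis
      using smult[OF _ that, of "\<ominus> \<one>"] by simp
  qed
qed

lemma lin_span_base:
  assumes "S \<subseteq> carrier M" "x \<in> S"
  shows "x \<in> lin_span R M S"
  unfolding lin_span_def using assms
  by (intro CollectI exI[where x = "{x}"] exI[where x = "\<lambda>_. \<one>"]) auto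

lemma submodule_zero: "submodule N R M \<Longrightarrow> \<zero>\<^bsub>M\<^esub> \<in> N"
  using subgroup.one_closed[OF submodule.axioms(1)] by force

end

lemma linear_map_lin_span:
  assumes "module R A" and "module R B" and F: "linear_map R A B F"
    and N: "submodule N R B" and S: "S \<subseteq> carrier A" and FS: "F ` S \<subseteq> N"
    and x: "x \<in> lin_span R A S"
  shows "F x \<in> N"
proof -
  interpret B: module R B by fact
  obtain J c where J: "J \<subseteq> S" "c \<in> J \<rightarrow> carrier R" "x = (\<Oplus>\<^bsub>A\<^esub>b\<in>J. c b \<odot>\<^bsub>A\<^esub> b)"
    using x by (auto simp: lin_span_def)
  have "F x = (\<Oplus>\<^bsub>B\<^esub>b\<in>J. c b \<odot>\<^bsub>B\<^esub> F b)"
    using linear_map_finsum[OF assms(1-3), of c J "\<lambda>b. b"] J S by auto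
  then show ?thesis
    using B.submodule_finsum[OF N J(2)] FS J(1) by auto
qed

definition indep_family ::
    "('r, 'x) ring_scheme \<Rightarrow> ('r, 'a, 'y) module_scheme \<Rightarrow> ('i \<Rightarrow> 'a) \<Rightarrow> 'i set \<Rightarrow> bool"
  where "indep_family R A e I \<longleftrightarrow>
    (\<forall>c \<in> I \<rightarrow> carrier R. (\<Oplus>\<^bsub>A\<^esub>i\<in>I. c i \<odot>\<^bsub>A\<^esub> e i) = \<zero>\<^bsub>A\<^esub> \<longrightarrow> (\<forall>i\<in>I. c i = \<zero>\<^bsub>R\<^esub>))"

lemma indep_familyD:
  assumes "indep_family R A e I" and "c \<in> I \<rightarrow> carrier R"
    and "(\<Oplus>\<^bsub>A\<^esub>i\<in>I. c i \<odot>\<^bsub>A\<^esub> e i) = \<zero>\<^bsub>A\<^esub>" and "i \<in> I"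
  shows "c i = \<zero>\<^bsub>R\<^esub>"
  using assms by (simp add: indep_family_def)

context module
begin

lemma indep_family_if_lin_indep:
  assumes I: "finite I" "inj_on e I" "e ` I \<subseteq> carrier M" and ind: "lin_indep R M (e ` I)"
  shows "indep_family R M e I"
  unfolding indep_family_def
proof (intro ballI impI)
  fix c i
  assume c: "c \<in> I \<rightarrow> carrier R" and zero: "(\<Oplus>\<^bsub>M\<^esub>i\<in>I. c i \<odot>\<^bsub>M\<^esub> e i) = \<zero>\<^bsub>M\<^esub>" and i: "i \<in> I"
  let ?c = "\<lambda>b. c (inv_into I e b)"
  have inv: "j \<in> I \<Longrightarrow> inv_into I e (e j) = j" for j
    using I(2) by simp
  have mem: "c j \<in> carrier R" "e j \<in> carrier M" if "j \<in> I" for j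
    using that c I(3) by auto
  have "(\<Oplus>\<^bsub>M\<^esub>b\<in>e ` I. ?c b \<odot>\<^bsub>M\<^esub> b) = (\<Oplus>\<^bsub>M\<^esub>i\<in>I. ?c (e i) \<odot>\<^bsub>M\<^esub> e i)"
    using I by (intro M.finsum_reindex) (auto simp: inv mem)
  also have "\<dots> = \<zero>\<^bsub>M\<^esub>"
    unfolding zero[symmetric] by (intro M.finsum_cong') (auto simp: inv mem)
  finally have "(\<Oplus>\<^bsub>M\<^esub>b\<in>e ` I. ?c b \<odot>\<^bsub>M\<^esub> b) = \<zero>\<^bsub>M\<^esub>" .
  moreover have "?c \<in> e ` I \<rightarrow> carrier R"
    by (auto simp: inv mem)
  ultimately have "?c (e i) = \<zero>"
    using ind i I(1) unfolding lin_indep_def by blast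
  then show "c i = \<zero>"
    by (simp add: inv i)
qed

text \<open>
  An independent family over a nontrivial ring is injective, so that for families over a finite index
  set "injective with linearly independent image" and "independent family" mean the same. The family
  version is the one that can be transported along index maps.
\<close>

lemma lin_indep_if_indep_family:
  assumes nontriv: "\<one> \<noteq> \<zero>"
    and I: "finite I" "e ` I \<subseteq> carrier M" and ind: "indep_family R M e I"
  shows "inj_on e I" and "lin_indep R M (e ` I)"
proof -
  show inj: "inj_on e I"
  proof (rule inj_onI, rule ccontr)
    fix i j assume ij: "i \<in> I" "j \<in> I" "e i = e j" "i \<noteq> j"
    \<comment> \<open>If \<open>e i = e j\<close>, the relation \<open>e i - e j = 0\<close> is nontrivial.\<close>
    let ?c = "\<lambda>k. if k = i then \<one> else if k = j then \<ominus> \<one> else \<zero>"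
    have e: "e i \<in> carrier M" "e j \<in> carrier M"
      using I ij by auto
    have "(\<Oplus>\<^bsub>M\<^esub>k\<in>I. ?c k \<odot>\<^bsub>M\<^esub> e k) = (\<Oplus>\<^bsub>M\<^esub>k\<in>{i, j}. ?c k \<odot>\<^bsub>M\<^esub> e k)"
      using I ij by (intro M.add.finprod_mono_neutral_cong_right) auto
    also have "\<dots> = \<zero>\<^bsub>M\<^esub>"
      using ij(3,4) e by (simp add: smult_l_minus M.r_neg)
    finally have "(\<Oplus>\<^bsub>M\<^esub>k\<in>I. ?c k \<odot>\<^bsub>M\<^esub> e k) = \<zero>\<^bsub>M\<^esub>" .
    moreover have "?c \<in> I \<rightarrow> carrier R"
      by auto
    ultimately have "?c i = \<zero>"
      using indep_familyD[OF ind, of ?c, OF _ _ ij(1)] by blast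
    then show False
      using nontriv by simp
  qed
  show "lin_indep R M (e ` I)"
    unfolding lin_indep_def
  proof (intro allI impI ballI, elim conjE)
    fix F c b
    assume F: "F \<subseteq> e ` I" "c \<in> F \<rightarrow> carrier R" and b: "b \<in> F"
      and zero: "(\<Oplus>\<^bsub>M\<^esub>b\<in>F. c b \<odot>\<^bsub>M\<^esub> b) = \<zero>\<^bsub>M\<^esub>"
    let ?c = "\<lambda>b. if b \<in> F then c b else \<zero>"
    have "(\<Oplus>\<^bsub>M\<^esub>i\<in>I. ?c (e i) \<odot>\<^bsub>M\<^esub> e i) = (\<Oplus>\<^bsub>M\<^esub>b\<in>e ` I. ?c b \<odot>\<^bsub>M\<^esub> b)"
      using I inj F by (intro M.finsum_reindex[symmetric]) (auto simp: Pi_iff subset_iff)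
    also have "\<dots> = (\<Oplus>\<^bsub>M\<^esub>b\<in>F. c b \<odot>\<^bsub>M\<^esub> b)"
      using I F by (intro M.add.finprod_mono_neutral_cong_right) (auto simp: Pi_iff subset_iff)
    also note zero
    finally have "(\<Oplus>\<^bsub>M\<^esub>i\<in>I. ?c (e i) \<odot>\<^bsub>M\<^esub> e i) = \<zero>\<^bsub>M\<^esub>" .
    moreover have "(\<lambda>i. ?c (e i)) \<in> I \<rightarrow> carrier R"
      using F(2) by auto
    ultimately have "\<forall>i\<in>I. ?c (e i) = \<zero>"
      using indep_familyD[OF ind, of "\<lambda>i. ?c (e i)"] by blast
    then show "c b = \<zero>"
      using F(1) b by force
  qed
qed

text \<open>
  Both multiplication axioms of a cell algebra ask for a congruence whose coefficients do not depend
  on a parameter \<open>t\<close>. The elements admitting such coefficients form a submodule, because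
  coefficients can be added and scaled uniformly in \<open>t\<close>; so the axioms need only be verified for
  multiplication by the elements of a generating set. The map \<open>F t\<close> will be a left or a right
  multiplication.
\<close>

lemma uniform_congruence_submodule:
  assumes N: "submodule N R M" and S: "finite S"
    and e: "\<And>s t. \<lbrakk>s \<in> S; t \<in> T\<rbrakk> \<Longrightarrow> e s t \<in> carrier M"
    and F: "\<And>t. t \<in> T \<Longrightarrow> linear_map R M M (F t)"
    and J: "J = {x \<in> carrier M. \<exists>r \<in> S \<rightarrow> carrier R. \<forall>t\<in>T.
      F t x \<ominus>\<^bsub>M\<^esub> (\<Oplus>\<^bsub>M\<^esub>s\<in>S. r s \<odot>\<^bsub>M\<^esub> e s t) \<in> N}"
  shows "submodule J R M"
proof -
  note sub = submoduleE[OF N] submodule_zero[OF N]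
  note lin = linear_mapD[OF F]
  have mod: "module R M"
    by unfold_locales
  have mem: "(\<lambda>s. r s \<odot>\<^bsub>M\<^esub> e s t) \<in> S \<rightarrow> carrier M" if "t \<in> T" "r \<in> S \<rightarrow> carrier R" for r t
    using e that by auto
  show ?thesis
  proof (rule submoduleI)
    show "J \<subseteq> carrier M"
      by (auto simp: J)
    have "(\<Oplus>\<^bsub>M\<^esub>s\<in>S. \<zero> \<odot>\<^bsub>M\<^esub> e s t) = \<zero>\<^bsub>M\<^esub>" if "t \<in> T" for t
      using e that by (intro M.add.finprod_one_eqI) auto
    then have "F t \<zero>\<^bsub>M\<^esub> \<ominus>\<^bsub>M\<^esub> (\<Oplus>\<^bsub>M\<^esub>s\<in>S. \<zero> \<odot>\<^bsub>M\<^esub> e s t) \<in> N" if "t \<in> T" for t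
      using linear_map_zero[OF mod mod F[OF that]] that sub by (simp add: a_minus_def)
    then show "\<zero>\<^bsub>M\<^esub> \<in> J"
      by (auto simp: J intro!: bexI[where x = "\<lambda>_. \<zero>"])
  next
    fix x y assume xy: "x \<in> J" "y \<in> J"
    then obtain r q where r: "r \<in> S \<rightarrow> carrier R" and q: "q \<in> S \<rightarrow> carrier R"
      and rN: "\<And>t. t \<in> T \<Longrightarrow> F t x \<ominus>\<^bsub>M\<^esub> (\<Oplus>\<^bsub>M\<^esub>s\<in>S. r s \<odot>\<^bsub>M\<^esub> e s t) \<in> N"
      and qN: "\<And>t. t \<in> T \<Longrightarrow> F t y \<ominus>\<^bsub>M\<^esub> (\<Oplus>\<^bsub>M\<^esub>s\<in>S. q s \<odot>\<^bsub>M\<^esub> e s t) \<in> N"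
      by (auto simp: J)
    have x: "x \<in> carrier M" "y \<in> carrier M"
      using xy by (auto simp: J)
    have "F t (x \<oplus>\<^bsub>M\<^esub> y) \<ominus>\<^bsub>M\<^esub> (\<Oplus>\<^bsub>M\<^esub>s\<in>S. (r s \<oplus> q s) \<odot>\<^bsub>M\<^esub> e s t) \<in> N" if t: "t \<in> T" for t
    proof -
      have "(\<Oplus>\<^bsub>M\<^esub>s\<in>S. (r s \<oplus> q s) \<odot>\<^bsub>M\<^esub> e s t)
          = (\<Oplus>\<^bsub>M\<^esub>s\<in>S. r s \<odot>\<^bsub>M\<^esub> e s t \<oplus>\<^bsub>M\<^esub> q s \<odot>\<^bsub>M\<^esub> e s t)"
        using r q e t by (intro M.finsum_cong') (auto simp: smult_l_distr Pi_iff)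
      also have "\<dots> = (\<Oplus>\<^bsub>M\<^esub>s\<in>S. r s \<odot>\<^bsub>M\<^esub> e s t) \<oplus>\<^bsub>M\<^esub> (\<Oplus>\<^bsub>M\<^esub>s\<in>S. q s \<odot>\<^bsub>M\<^esub> e s t)"
        using mem t r q by (simp add: M.finsum_addf)
      finally have "F t (x \<oplus>\<^bsub>M\<^esub> y) \<ominus>\<^bsub>M\<^esub> (\<Oplus>\<^bsub>M\<^esub>s\<in>S. (r s \<oplus> q s) \<odot>\<^bsub>M\<^esub> e s t)
          = (F t x \<ominus>\<^bsub>M\<^esub> (\<Oplus>\<^bsub>M\<^esub>s\<in>S. r s \<odot>\<^bsub>M\<^esub> e s t)) \<oplus>\<^bsub>M\<^esub> (F t y \<ominus>\<^bsub>M\<^esub> (\<Oplus>\<^bsub>M\<^esub>s\<in>S. q s \<odot>\<^bsub>M\<^esub> e s t))"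
        using x t lin mem[OF t r] mem[OF t q]
        by (simp add: a_minus_def M.minus_add M.a_ac)
      then show ?thesis
        using sub(5)[OF rN[OF t] qN[OF t]] by simp
    qed
    then show "x \<oplus>\<^bsub>M\<^esub> y \<in> J"
      using r q x by (auto simp: J intro!: bexI[where x = "\<lambda>s. r s \<oplus> q s"])
  next
    have smult: "k \<odot>\<^bsub>M\<^esub> x \<in> J" if k: "k \<in> carrier R" and xX: "x \<in> J" for k x
    proof -
    obtain r where r: "r \<in> S \<rightarrow> carrier R"
      and rN: "\<And>t. t \<in> T \<Longrightarrow> F t x \<ominus>\<^bsub>M\<^esub> (\<Oplus>\<^bsub>M\<^esub>s\<in>S. r s \<odot>\<^bsub>M\<^esub> e s t) \<in> N"
      using xX by (auto simp: J)
    have x: "x \<in> carrier M"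
      using xX by (auto simp: J)
    have "F t (k \<odot>\<^bsub>M\<^esub> x) \<ominus>\<^bsub>M\<^esub> (\<Oplus>\<^bsub>M\<^esub>s\<in>S. (k \<otimes> r s) \<odot>\<^bsub>M\<^esub> e s t) \<in> N" if t: "t \<in> T" for t
    proof -
      have "(\<Oplus>\<^bsub>M\<^esub>s\<in>S. (k \<otimes> r s) \<odot>\<^bsub>M\<^esub> e s t) = (\<Oplus>\<^bsub>M\<^esub>s\<in>S. k \<odot>\<^bsub>M\<^esub> (r s \<odot>\<^bsub>M\<^esub> e s t))"
        using r e t k by (intro M.finsum_cong') (auto simp: smult_assoc1 Pi_iff)
      also have "\<dots> = k \<odot>\<^bsub>M\<^esub> (\<Oplus>\<^bsub>M\<^esub>s\<in>S. r s \<odot>\<^bsub>M\<^esub> e s t)"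
        using mem t r k S by (simp add: finsum_smult_ldistr)
      finally have "F t (k \<odot>\<^bsub>M\<^esub> x) \<ominus>\<^bsub>M\<^esub> (\<Oplus>\<^bsub>M\<^esub>s\<in>S. (k \<otimes> r s) \<odot>\<^bsub>M\<^esub> e s t)
          = k \<odot>\<^bsub>M\<^esub> (F t x \<ominus>\<^bsub>M\<^esub> (\<Oplus>\<^bsub>M\<^esub>s\<in>S. r s \<odot>\<^bsub>M\<^esub> e s t))"
        using x t k lin mem[OF t r]
        by (simp add: a_minus_def smult_r_distr smult_r_minus)
      then show ?thesis
        using sub(4)[OF k rN[OF t]] by simp
    qed
    then show ?thesis
      using r x k by (auto simp: J intro!: bexI[where x = "\<lambda>s. k \<otimes> r s"])
    qed
    show "k \<odot>\<^bsub>M\<^esub> x \<in> J" if "k \<in> carrier R" "x \<in> J" for k x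
      using smult that .
    fix x assume xX: "x \<in> J"
    then have "\<ominus>\<^bsub>M\<^esub> x = (\<ominus> \<one>) \<odot>\<^bsub>M\<^esub> x"
      by (simp add: J smult_l_minus)
    then show "\<ominus>\<^bsub>M\<^esub> x \<in> J"
      using smult[OF _ xX, of "\<ominus> \<one>"] by simp
  qed
qed

end

lemma (in module) finsum_single_block:
  assumes fin: "finite B" "finite C" and k: "k \<in> B"
    and e: "\<And>i j. \<lbrakk>i \<in> B; j \<in> C\<rbrakk> \<Longrightarrow> e (i, j) \<in> carrier M" and r: "r \<in> C \<rightarrow> carrier R"
  shows "(\<Oplus>\<^bsub>M\<^esub>p\<in>B \<times> C. (if fst p = k then r (snd p) else \<zero>) \<odot>\<^bsub>M\<^esub> e p)
    = (\<Oplus>\<^bsub>M\<^esub>j\<in>C. r j \<odot>\<^bsub>M\<^esub> e (k, j))"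
proof -
  let ?f = "\<lambda>p. (if fst p = k then r (snd p) else \<zero>) \<odot>\<^bsub>M\<^esub> e p"
  have mem: "?f \<in> B \<times> C \<rightarrow> carrier M"
    using e r by (auto simp: Pi_iff)
  have "(\<Oplus>\<^bsub>M\<^esub>p\<in>B \<times> C. ?f p) = (\<Oplus>\<^bsub>M\<^esub>p\<in>Pair k ` C. ?f p)"
    using mem fin k e by (intro M.add.finprod_mono_neutral_cong_right) auto
  also have "\<dots> = (\<Oplus>\<^bsub>M\<^esub>j\<in>C. ?f (k, j))"
    using mem k by (intro M.finsum_reindex) (auto simp: Pi_iff inj_on_def)
  finally show ?thesis
    by simp
qed

section \<open>The algebra of a finite monoid\<close>

locale finite_monoid = monoid M for M (structure) +
  assumes finite_carrier: "finite (carrier M)"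

locale finite_monoid_algebra = cring R + M: finite_monoid M
  for R :: "('r, 'x) ring_scheme" (structure) and M :: "('m, 'y) monoid_scheme"
begin

abbreviation "RM \<equiv> monoid_algebra R M"

abbreviation delta ("\<delta>") where "\<delta> \<equiv> monoid_elem R M"

lemma algebra_apply:
  "carrier RM = carrier M \<rightarrow>\<^sub>E carrier R"
  "x \<in> carrier M \<Longrightarrow> \<zero>\<^bsub>RM\<^esub> x = \<zero>"
  "x \<in> carrier M \<Longrightarrow> (f \<oplus>\<^bsub>RM\<^esub> g) x = f x \<oplus> g x"
  "x \<in> carrier M \<Longrightarrow> (c \<odot>\<^bsub>RM\<^esub> f) x = c \<otimes> f x"
  "x \<in> carrier M \<Longrightarrow> \<delta> m x = (if x = m then \<one> else \<zero>)"
  by (simp_all add: monoid_algebra_def monoid_elem_def)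

lemma algebra_one: "\<one>\<^bsub>RM\<^esub> = \<delta> \<one>\<^bsub>M\<^esub>"
  by (simp add: monoid_algebra_def monoid_elem_def)

lemma algebra_mult_apply:
  "x \<in> carrier M \<Longrightarrow> (f \<otimes>\<^bsub>RM\<^esub> g) x =
    (\<Oplus>p \<in> {p \<in> carrier M \<times> carrier M. fst p \<otimes>\<^bsub>M\<^esub> snd p = x}. f (fst p) \<otimes> g (snd p))"
  by (simp add: monoid_algebra_def)

lemma coeff_closed: "f \<in> carrier RM \<Longrightarrow> x \<in> carrier M \<Longrightarrow> f x \<in> carrier R"
  by (auto simp: algebra_apply)

lemma algebra_eqI:
  "\<lbrakk>f \<in> carrier RM; g \<in> carrier RM; \<And>x. x \<in> carrier M \<Longrightarrow> f x = g x\<rbrakk> \<Longrightarrow> f = g"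
  unfolding algebra_apply(1) by (rule PiE_ext)

lemma algebra_closed:
  "\<zero>\<^bsub>RM\<^esub> \<in> carrier RM"
  "\<lbrakk>f \<in> carrier RM; g \<in> carrier RM\<rbrakk> \<Longrightarrow> f \<oplus>\<^bsub>RM\<^esub> g \<in> carrier RM"
  "\<lbrakk>c \<in> carrier R; f \<in> carrier RM\<rbrakk> \<Longrightarrow> c \<odot>\<^bsub>RM\<^esub> f \<in> carrier RM"
  "\<delta> m \<in> carrier RM"
  by (auto simp: monoid_algebra_def monoid_elem_def)

lemma algebra_mult_closed:
  assumes "f \<in> carrier RM" "g \<in> carrier RM"
  shows "f \<otimes>\<^bsub>RM\<^esub> g \<in> carrier RM"
proof -
  have "(\<Oplus>p \<in> {p \<in> carrier M \<times> carrier M. fst p \<otimes>\<^bsub>M\<^esub> snd p = x}. f (fst p) \<otimes> g (snd p)) \<in> carrier R" for x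
    using assms by (intro finsum_closed) (auto simp: coeff_closed)
  then show ?thesis
    by (auto simp: monoid_algebra_def)
qed

lemma algebra_module: "module R RM"
proof (rule moduleI)
  show "abelian_group RM"
  proof (rule abelian_groupI)
    fix f assume f: "f \<in> carrier RM"
    let ?g = "\<lambda>x\<in>carrier M. \<ominus> f x"
    have "?g \<in> carrier RM"
      using f by (auto simp: algebra_apply)
    moreover have "?g \<oplus>\<^bsub>RM\<^esub> f = \<zero>\<^bsub>RM\<^esub>"
      using f calculation
      by (intro algebra_eqI) (auto simp: algebra_closed algebra_apply(2-) l_neg coeff_closed)
    ultimately show "\<exists>y\<in>carrier RM. y \<oplus>\<^bsub>RM\<^esub> f = \<zero>\<^bsub>RM\<^esub>"
      by blast
  qed (auto intro!: algebra_eqI simp: algebra_closed algebra_apply(2-) coeff_closed a_ac)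
qed (auto intro!: algebra_eqI simp: algebra_closed algebra_apply(2-) coeff_closed is_cring
  l_distr r_distr m_assoc)

sublocale RM: module R RM
  by (rule algebra_module)

lemma finsum_apply:
  assumes "F \<in> I \<rightarrow> carrier RM" and x: "x \<in> carrier M"
  shows "(\<Oplus>\<^bsub>RM\<^esub>i\<in>I. F i) x = (\<Oplus>i\<in>I. F i x)"
  using assms(1)
proof (induction I rule: infinite_finite_induct)
  case (insert i I)
  then have "F \<in> I \<rightarrow> carrier RM" "F i \<in> carrier RM" "(\<lambda>i. F i x) \<in> I \<rightarrow> carrier R"
    using x by (auto simp: coeff_closed Pi_iff)
  with insert x show ?case
    by (simp add: RM.M.finsum_insert finsum_insert algebra_apply(3) coeff_closed)
qed (simp_all add: x algebra_apply(2))

lemma delta_expansion: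
  assumes f: "f \<in> carrier RM"
  shows "(\<Oplus>\<^bsub>RM\<^esub>x\<in>carrier M. f x \<odot>\<^bsub>RM\<^esub> \<delta> x) = f"
proof (rule algebra_eqI)
  have mem: "(\<lambda>x. f x \<odot>\<^bsub>RM\<^esub> \<delta> x) \<in> carrier M \<rightarrow> carrier RM"
    using f by (auto simp: algebra_closed coeff_closed)
  then show "(\<Oplus>\<^bsub>RM\<^esub>x\<in>carrier M. f x \<odot>\<^bsub>RM\<^esub> \<delta> x) \<in> carrier RM"
    by (rule RM.M.finsum_closed)
  fix y assume y: "y \<in> carrier M"
  have "(\<Oplus>\<^bsub>RM\<^esub>x\<in>carrier M. f x \<odot>\<^bsub>RM\<^esub> \<delta> x) y = (\<Oplus>x\<in>carrier M. if y = x then f x else \<zero>)"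
    using f y mem by (subst finsum_apply) (auto intro!: finsum_cong' simp: algebra_apply(2-) coeff_closed)
  also have "\<dots> = f y"
    using f y M.finite_carrier by (intro finsum_singleton) (auto simp: coeff_closed)
  finally show "(\<Oplus>\<^bsub>RM\<^esub>x\<in>carrier M. f x \<odot>\<^bsub>RM\<^esub> \<delta> x) y = f y" .
qed (rule f)

lemma linear_map_delta_expansion:
  assumes "module R B" "linear_map R RM B F" "f \<in> carrier RM"
  shows "F f = (\<Oplus>\<^bsub>B\<^esub>x\<in>carrier M. f x \<odot>\<^bsub>B\<^esub> F (\<delta> x))"
proof -
  have "F f = F (\<Oplus>\<^bsub>RM\<^esub>x\<in>carrier M. f x \<odot>\<^bsub>RM\<^esub> \<delta> x)"
    by (simp add: delta_expansion assms(3))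
  also have "\<dots> = (\<Oplus>\<^bsub>B\<^esub>x\<in>carrier M. f x \<odot>\<^bsub>B\<^esub> F (\<delta> x))"
    using assms(3) by (intro linear_map_finsum[OF algebra_module assms(1,2)]) (auto simp: algebra_closed coeff_closed)
  finally show ?thesis .
qed

lemma linear_map_eqI:
  assumes B: "module R B" and F: "linear_map R RM B F" "linear_map R RM B F'"
    and "\<And>x. x \<in> carrier M \<Longrightarrow> F (\<delta> x) = F' (\<delta> x)" and f: "f \<in> carrier RM"
  shows "F f = F' f"
proof -
  interpret B: module R B by fact
  show ?thesis
    unfolding linear_map_delta_expansion[OF B F(1) f] linear_map_delta_expansion[OF B F(2) f]
    using assms(4) f linear_mapD(1)[OF F(2)]
    by (intro B.M.finsum_cong') (auto simp: coeff_closed algebra_closed)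
qed

text \<open>
  The monoid elements generate \<open>R[M]\<close>.
\<close>

lemma submodule_eq_carrierI:
  assumes N: "submodule N R RM" and "\<And>x. x \<in> carrier M \<Longrightarrow> \<delta> x \<in> N"
  shows "carrier RM \<subseteq> N"
proof
  fix f assume f: "f \<in> carrier RM"
  have "(\<Oplus>\<^bsub>RM\<^esub>x\<in>carrier M. f x \<odot>\<^bsub>RM\<^esub> \<delta> x) \<in> N"
    using assms f by (intro RM.submodule_finsum) (auto simp: coeff_closed)
  then show "f \<in> N"
    by (simp add: delta_expansion f)
qed

lemma linear_map_mult_right:
  assumes g: "g \<in> carrier RM"
  shows "linear_map R RM RM (\<lambda>f. f \<otimes>\<^bsub>RM\<^esub> g)"
proof (rule linear_mapI)
  let ?P = "\<lambda>x. {p \<in> carrier M \<times> carrier M. fst p \<otimes>\<^bsub>M\<^esub> snd p = x}"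
  have P: "finite (?P x)" for x
    using M.finite_carrier by auto
  have mem: "(\<lambda>p. f (fst p) \<otimes> g (snd p)) \<in> ?P x \<rightarrow> carrier R" if "f \<in> carrier RM" for f x
    using g that by (auto simp: coeff_closed)
  fix f assume f: "f \<in> carrier RM"
  show "f \<otimes>\<^bsub>RM\<^esub> g \<in> carrier RM"
    using f g by (rule algebra_mult_closed)
  show "(f \<oplus>\<^bsub>RM\<^esub> h) \<otimes>\<^bsub>RM\<^esub> g = f \<otimes>\<^bsub>RM\<^esub> g \<oplus>\<^bsub>RM\<^esub> h \<otimes>\<^bsub>RM\<^esub> g" if h: "h \<in> carrier RM" for h
  proof (rule algebra_eqI)
    fix x assume x: "x \<in> carrier M"
    have "((f \<oplus>\<^bsub>RM\<^esub> h) \<otimes>\<^bsub>RM\<^esub> g) x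
        = (\<Oplus>p\<in>?P x. f (fst p) \<otimes> g (snd p) \<oplus> h (fst p) \<otimes> g (snd p))"
      unfolding algebra_mult_apply[OF x] using f g h
      by (intro finsum_cong') (auto simp: algebra_apply(2-) coeff_closed l_distr)
    also have "\<dots> = (f \<otimes>\<^bsub>RM\<^esub> g \<oplus>\<^bsub>RM\<^esub> h \<otimes>\<^bsub>RM\<^esub> g) x"
      using mem f h x by (simp add: algebra_mult_apply algebra_apply(2-) finsum_addf)
    finally show "((f \<oplus>\<^bsub>RM\<^esub> h) \<otimes>\<^bsub>RM\<^esub> g) x = (f \<otimes>\<^bsub>RM\<^esub> g \<oplus>\<^bsub>RM\<^esub> h \<otimes>\<^bsub>RM\<^esub> g) x" .
  qed (use f g h in \<open>auto simp: algebra_mult_closed algebra_closed\<close>)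
  show "(c \<odot>\<^bsub>RM\<^esub> f) \<otimes>\<^bsub>RM\<^esub> g = c \<odot>\<^bsub>RM\<^esub> (f \<otimes>\<^bsub>RM\<^esub> g)" if c: "c \<in> carrier R" for c
  proof (rule algebra_eqI)
    fix x assume x: "x \<in> carrier M"
    have "((c \<odot>\<^bsub>RM\<^esub> f) \<otimes>\<^bsub>RM\<^esub> g) x = (\<Oplus>p\<in>?P x. c \<otimes> (f (fst p) \<otimes> g (snd p)))"
      unfolding algebra_mult_apply[OF x] using f g c
      by (intro finsum_cong') (auto simp: algebra_apply(2-) coeff_closed m_assoc)
    also have "\<dots> = (c \<odot>\<^bsub>RM\<^esub> (f \<otimes>\<^bsub>RM\<^esub> g)) x"
      using mem f c x P by (simp add: algebra_mult_apply algebra_apply(2-) finsum_rdistr)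
    finally show "((c \<odot>\<^bsub>RM\<^esub> f) \<otimes>\<^bsub>RM\<^esub> g) x = (c \<odot>\<^bsub>RM\<^esub> (f \<otimes>\<^bsub>RM\<^esub> g)) x" .
  qed (use f g c in \<open>auto simp: algebra_mult_closed algebra_closed\<close>)
qed

lemma linear_map_mult_left:
  assumes g: "g \<in> carrier RM"
  shows "linear_map R RM RM (\<lambda>f. g \<otimes>\<^bsub>RM\<^esub> f)"
proof (rule linear_mapI)
  let ?P = "\<lambda>x. {p \<in> carrier M \<times> carrier M. fst p \<otimes>\<^bsub>M\<^esub> snd p = x}"
  have P: "finite (?P x)" for x
    using M.finite_carrier by auto
  have mem: "(\<lambda>p. g (fst p) \<otimes> f (snd p)) \<in> ?P x \<rightarrow> carrier R" if "f \<in> carrier RM" for f x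
    using g that by (auto simp: coeff_closed)
  fix f assume f: "f \<in> carrier RM"
  show "g \<otimes>\<^bsub>RM\<^esub> f \<in> carrier RM"
    using g f by (rule algebra_mult_closed)
  show "g \<otimes>\<^bsub>RM\<^esub> (f \<oplus>\<^bsub>RM\<^esub> h) = g \<otimes>\<^bsub>RM\<^esub> f \<oplus>\<^bsub>RM\<^esub> g \<otimes>\<^bsub>RM\<^esub> h" if h: "h \<in> carrier RM" for h
  proof (rule algebra_eqI)
    fix x assume x: "x \<in> carrier M"
    have "(g \<otimes>\<^bsub>RM\<^esub> (f \<oplus>\<^bsub>RM\<^esub> h)) x
        = (\<Oplus>p\<in>?P x. g (fst p) \<otimes> f (snd p) \<oplus> g (fst p) \<otimes> h (snd p))"
      unfolding algebra_mult_apply[OF x] using f g h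
      by (intro finsum_cong') (auto simp: algebra_apply(2-) coeff_closed r_distr)
    also have "\<dots> = (g \<otimes>\<^bsub>RM\<^esub> f \<oplus>\<^bsub>RM\<^esub> g \<otimes>\<^bsub>RM\<^esub> h) x"
      using mem f h x by (simp add: algebra_mult_apply algebra_apply(2-) finsum_addf)
    finally show "(g \<otimes>\<^bsub>RM\<^esub> (f \<oplus>\<^bsub>RM\<^esub> h)) x = (g \<otimes>\<^bsub>RM\<^esub> f \<oplus>\<^bsub>RM\<^esub> g \<otimes>\<^bsub>RM\<^esub> h) x" .
  qed (use f g h in \<open>auto simp: algebra_mult_closed algebra_closed\<close>)
  show "g \<otimes>\<^bsub>RM\<^esub> (c \<odot>\<^bsub>RM\<^esub> f) = c \<odot>\<^bsub>RM\<^esub> (g \<otimes>\<^bsub>RM\<^esub> f)" if c: "c \<in> carrier R" for c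
  proof (rule algebra_eqI)
    fix x assume x: "x \<in> carrier M"
    have "(g \<otimes>\<^bsub>RM\<^esub> (c \<odot>\<^bsub>RM\<^esub> f)) x = (\<Oplus>p\<in>?P x. c \<otimes> (g (fst p) \<otimes> f (snd p)))"
      unfolding algebra_mult_apply[OF x] using f g c
      by (intro finsum_cong') (auto simp: algebra_apply(2-) coeff_closed m_lcomm)
    also have "\<dots> = (c \<odot>\<^bsub>RM\<^esub> (g \<otimes>\<^bsub>RM\<^esub> f)) x"
      using mem f c x P by (simp add: algebra_mult_apply algebra_apply(2-) finsum_rdistr)
    finally show "(g \<otimes>\<^bsub>RM\<^esub> (c \<odot>\<^bsub>RM\<^esub> f)) x = (c \<odot>\<^bsub>RM\<^esub> (g \<otimes>\<^bsub>RM\<^esub> f)) x" .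
  qed (use f g c in \<open>auto simp: algebra_mult_closed algebra_closed\<close>)
qed

lemma delta_mult:
  assumes m: "m \<in> carrier M" "n \<in> carrier M"
  shows "\<delta> m \<otimes>\<^bsub>RM\<^esub> \<delta> n = \<delta> (m \<otimes>\<^bsub>M\<^esub> n)"
proof (rule algebra_eqI)
  fix x assume x: "x \<in> carrier M"
  let ?P = "{p \<in> carrier M \<times> carrier M. fst p \<otimes>\<^bsub>M\<^esub> snd p = x}"
  have "(\<delta> m \<otimes>\<^bsub>RM\<^esub> \<delta> n) x = (\<Oplus>p\<in>?P. if (m, n) = p then \<one> else \<zero>)"
    unfolding algebra_mult_apply[OF x]
    by (intro finsum_cong') (auto simp: algebra_apply(2-) split: if_splits)
  also have "\<dots> = \<delta> (m \<otimes>\<^bsub>M\<^esub> n) x"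
  proof (cases "m \<otimes>\<^bsub>M\<^esub> n = x")
    case True
    then have "(\<Oplus>p\<in>?P. if (m, n) = p then \<one> else \<zero>) = \<one>"
      using m M.finite_carrier by (intro finsum_singleton[of "(m, n)" ?P "\<lambda>_. \<one>"]) auto
    then show ?thesis
      using True x by (simp add: algebra_apply(5))
  next
    case False
    then have "(\<Oplus>p\<in>?P. if (m, n) = p then \<one> else \<zero>) = \<zero>"
      by (intro add.finprod_one_eqI) auto
    then show ?thesis
      using False x by (simp add: algebra_apply(5))
  qed
  finally show "(\<delta> m \<otimes>\<^bsub>RM\<^esub> \<delta> n) x = \<delta> (m \<otimes>\<^bsub>M\<^esub> n) x" .
qed (simp_all add: algebra_closed algebra_mult_closed)

text \<open>
  Associativity and the unit laws are identities between maps that are linear in each argument,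
  so they need only be checked on monoid elements.
\<close>

lemma algebra_mult_assoc:
  assumes f: "f \<in> carrier RM" "g \<in> carrier RM" "h \<in> carrier RM"
  shows "(f \<otimes>\<^bsub>RM\<^esub> g) \<otimes>\<^bsub>RM\<^esub> h = f \<otimes>\<^bsub>RM\<^esub> (g \<otimes>\<^bsub>RM\<^esub> h)"
proof -
  have 1: "(\<delta> x \<otimes>\<^bsub>RM\<^esub> \<delta> y) \<otimes>\<^bsub>RM\<^esub> h = \<delta> x \<otimes>\<^bsub>RM\<^esub> (\<delta> y \<otimes>\<^bsub>RM\<^esub> h)"
    if "x \<in> carrier M" "y \<in> carrier M" for x y
  proof (rule linear_map_eqI[where f = h, OF algebra_module])
    show "linear_map R RM RM ((\<otimes>\<^bsub>RM\<^esub>) (\<delta> x \<otimes>\<^bsub>RM\<^esub> \<delta> y))"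
      by (intro linear_map_mult_left algebra_mult_closed algebra_closed)
    show "linear_map R RM RM (\<lambda>a. \<delta> x \<otimes>\<^bsub>RM\<^esub> (\<delta> y \<otimes>\<^bsub>RM\<^esub> a))"
      by (rule linear_map_compose[OF linear_map_mult_left linear_map_mult_left]) (intro f algebra_closed)+
  qed (use that f in \<open>simp_all add: delta_mult M.m_assoc\<close>)
  have 2: "(\<delta> x \<otimes>\<^bsub>RM\<^esub> g) \<otimes>\<^bsub>RM\<^esub> h = \<delta> x \<otimes>\<^bsub>RM\<^esub> (g \<otimes>\<^bsub>RM\<^esub> h)" if "x \<in> carrier M" for x
  proof (rule linear_map_eqI[where f = g, OF algebra_module])
    show "linear_map R RM RM (\<lambda>a. (\<delta> x \<otimes>\<^bsub>RM\<^esub> a) \<otimes>\<^bsub>RM\<^esub> h)"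
      by (rule linear_map_compose[OF linear_map_mult_left linear_map_mult_right]) (intro f algebra_closed)+
    show "linear_map R RM RM (\<lambda>a. \<delta> x \<otimes>\<^bsub>RM\<^esub> (a \<otimes>\<^bsub>RM\<^esub> h))"
      by (rule linear_map_compose[OF linear_map_mult_right linear_map_mult_left]) (intro f algebra_closed)+
  qed (use that f 1 in simp_all)
  show ?thesis
  proof (rule linear_map_eqI[where f = f, OF algebra_module])
    show "linear_map R RM RM (\<lambda>a. (a \<otimes>\<^bsub>RM\<^esub> g) \<otimes>\<^bsub>RM\<^esub> h)"
      by (rule linear_map_compose[OF linear_map_mult_right linear_map_mult_right]) (intro f algebra_closed)+
    show "linear_map R RM RM (\<lambda>a. a \<otimes>\<^bsub>RM\<^esub> (g \<otimes>\<^bsub>RM\<^esub> h))"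
      by (intro linear_map_mult_right algebra_mult_closed f)
  qed (use f 2 in simp_all)
qed

lemma algebra_unit:
  assumes "f \<in> carrier RM"
  shows "\<one>\<^bsub>RM\<^esub> \<otimes>\<^bsub>RM\<^esub> f = f" "f \<otimes>\<^bsub>RM\<^esub> \<one>\<^bsub>RM\<^esub> = f"
  unfolding algebra_one
  by (rule linear_map_eqI[OF algebra_module linear_map_mult_left linear_map_id _ assms]
      linear_map_eqI[OF algebra_module linear_map_mult_right linear_map_id _ assms];
      simp add: algebra_closed delta_mult)+

lemma algebra_assoc_algebra: "assoc_algebra R RM"
proof -
  note lin = linear_mapD[OF linear_map_mult_left] linear_mapD[OF linear_map_mult_right]
  have "ring RM"
    using RM.M.abelian_group_axioms
    by (intro ringI monoidI)
      (auto simp: algebra_mult_closed algebra_mult_assoc algebra_unit[unfolded algebra_one] lin algebra_one algebra_closed)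
  then show ?thesis
    unfolding assoc_algebra_def assoc_algebra_axioms_def
    by (simp add: algebra_module lin)
qed

end

text \<open>
  The universal property of \<open>R[M]\<close> as a free module on \<open>M\<close>: this is the linear map to \<open>A\<close> that extends
  \<open>v\<close>. The map \<open>schutz_phi\<close> has this form.
\<close>

definition lin_ext ::
    "('m, 'y) monoid_scheme \<Rightarrow> ('r, 'a, 'z) module_scheme \<Rightarrow> ('m \<Rightarrow> 'a) \<Rightarrow> ('m \<Rightarrow> 'r) \<Rightarrow> 'a"
  where "lin_ext M A v f = (\<Oplus>\<^bsub>A\<^esub>x\<in>carrier M. f x \<odot>\<^bsub>A\<^esub> v x)"

context finite_monoid_algebra
begin

lemma linear_map_lin_ext:
  assumes "module R A" and v: "v \<in> carrier M \<rightarrow> carrier A"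
  shows "linear_map R RM A (lin_ext M A v)"
proof (rule linear_mapI)
  interpret A: module R A by fact
  have mem: "(\<lambda>x. f x \<odot>\<^bsub>A\<^esub> v x) \<in> carrier M \<rightarrow> carrier A" if "f \<in> carrier RM" for f
    using v that by (auto simp: coeff_closed)
  fix f assume f: "f \<in> carrier RM"
  show "lin_ext M A v f \<in> carrier A"
    unfolding lin_ext_def using mem[OF f] by (rule A.M.finsum_closed)
  show "lin_ext M A v (f \<oplus>\<^bsub>RM\<^esub> g) = lin_ext M A v f \<oplus>\<^bsub>A\<^esub> lin_ext M A v g" if g: "g \<in> carrier RM" for g
  proof -
    have "lin_ext M A v (f \<oplus>\<^bsub>RM\<^esub> g) = (\<Oplus>\<^bsub>A\<^esub>x\<in>carrier M. f x \<odot>\<^bsub>A\<^esub> v x \<oplus>\<^bsub>A\<^esub> g x \<odot>\<^bsub>A\<^esub> v x)"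
      unfolding lin_ext_def using f g v
      by (intro A.M.finsum_cong') (auto simp: algebra_apply(3) A.smult_l_distr coeff_closed Pi_iff)
    then show ?thesis
      using mem[OF f] mem[OF g] by (simp add: lin_ext_def A.M.finsum_addf)
  qed
  show "lin_ext M A v (c \<odot>\<^bsub>RM\<^esub> f) = c \<odot>\<^bsub>A\<^esub> lin_ext M A v f" if c: "c \<in> carrier R" for c
  proof -
    have "lin_ext M A v (c \<odot>\<^bsub>RM\<^esub> f) = (\<Oplus>\<^bsub>A\<^esub>x\<in>carrier M. c \<odot>\<^bsub>A\<^esub> (f x \<odot>\<^bsub>A\<^esub> v x))"
      unfolding lin_ext_def using f c v
      by (intro A.M.finsum_cong') (auto simp: algebra_apply(4) A.smult_assoc1 coeff_closed Pi_iff)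
    then show ?thesis
      using mem[OF f] c M.finite_carrier by (simp add: lin_ext_def A.finsum_smult_ldistr)
  qed
qed

lemma lin_ext_delta:
  assumes "module R A" and v: "v \<in> carrier M \<rightarrow> carrier A" and x: "x \<in> carrier M"
  shows "lin_ext M A v (\<delta> x) = v x"
proof -
  interpret A: module R A by fact
  have "lin_ext M A v (\<delta> x) = (\<Oplus>\<^bsub>A\<^esub>y\<in>carrier M. if x = y then v y else \<zero>\<^bsub>A\<^esub>)"
    unfolding lin_ext_def using v
    by (intro A.M.finsum_cong') (auto simp: algebra_apply(5) Pi_iff)
  also have "\<dots> = v x"
    using v x M.finite_carrier by (intro A.M.finsum_singleton) auto
  finally show ?thesis .
qed

lemma linear_map_of_lin_ext:
  assumes "module R A" "module R B" "linear_map R A B F"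
    and v: "v \<in> carrier M \<rightarrow> carrier A" and f: "f \<in> carrier RM"
  shows "F (lin_ext M A v f) = lin_ext M B (\<lambda>x. F (v x)) f"
  unfolding lin_ext_def using f v
  by (intro linear_map_finsum[OF assms(1-3)]) (auto simp: coeff_closed)

lemma lin_ext_cong:
  assumes "module R A" and "\<And>x. x \<in> carrier M \<Longrightarrow> v x = w x"
    and "w \<in> carrier M \<rightarrow> carrier A" and "f \<in> carrier RM"
  shows "lin_ext M A v f = lin_ext M A w f"
proof -
  interpret A: module R A by fact
  show ?thesis
    unfolding lin_ext_def using assms(2-)
    by (intro A.M.finsum_cong') (auto simp: coeff_closed Pi_iff)
qed

end

section \<open>Green's relations in a finite monoid\<close>

context finite_monoid
begin

abbreviation gen_ideal :: "'a \<Rightarrow> 'a set" where "gen_ideal y \<equiv> (carrier M #> y) <#> carrier M"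

lemma gen_ideal_iff: "x \<in> gen_ideal y \<longleftrightarrow> (\<exists>u\<in>carrier M. \<exists>v\<in>carrier M. x = u \<otimes> y \<otimes> v)"
  by (auto simp: r_coset_def set_mult_def)

lemma gen_idealI: "\<lbrakk>u \<in> carrier M; v \<in> carrier M\<rbrakk> \<Longrightarrow> u \<otimes> y \<otimes> v \<in> gen_ideal y"
  by (auto simp: gen_ideal_iff)

lemma gen_ideal_leftI: "\<lbrakk>u \<in> carrier M; y \<in> carrier M\<rbrakk> \<Longrightarrow> u \<otimes> y \<in> gen_ideal y"
  using gen_idealI[of u \<one> y] by simp

lemma gen_ideal_rightI: "\<lbrakk>u \<in> carrier M; y \<in> carrier M\<rbrakk> \<Longrightarrow> y \<otimes> u \<in> gen_ideal y"
  using gen_idealI[of \<one> u y] by simp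

lemma gen_ideal_refl: "y \<in> carrier M \<Longrightarrow> y \<in> gen_ideal y"
  using gen_ideal_leftI[of \<one> y] by simp

lemma gen_ideal_trans:
  assumes "x \<in> gen_ideal y" "y \<in> gen_ideal z" "z \<in> carrier M"
  shows "x \<in> gen_ideal z"
proof -
  obtain u v u' v' where *: "u \<in> carrier M" "v \<in> carrier M" "u' \<in> carrier M" "v' \<in> carrier M"
    "x = u \<otimes> y \<otimes> v" "y = u' \<otimes> z \<otimes> v'"
    using assms(1,2) unfolding gen_ideal_iff by blast
  then have "x = (u \<otimes> u') \<otimes> z \<otimes> (v' \<otimes> v)"
    using assms(3) by (simp add: m_assoc)
  then show ?thesis
    using * by (auto simp: gen_ideal_iff)
qed

lemma green_L_iff:
  "(x, y) \<in> green_L M \<longleftrightarrow> x \<in> carrier M \<and> y \<in> carrier M \<and>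
    (\<exists>u\<in>carrier M. y = u \<otimes> x) \<and> (\<exists>v\<in>carrier M. x = v \<otimes> y)"
proof (cases "x \<in> carrier M \<and> y \<in> carrier M")
  case True
  have "carrier M #> a \<subseteq> carrier M #> b \<longleftrightarrow> (\<exists>u\<in>carrier M. a = u \<otimes> b)"
    if ab: "a \<in> carrier M" "b \<in> carrier M" for a b
  proof
    assume "carrier M #> a \<subseteq> carrier M #> b"
    moreover have "\<one> \<otimes> a \<in> carrier M #> a"
      unfolding r_coset_def by blast
    ultimately show "\<exists>u\<in>carrier M. a = u \<otimes> b"
      using ab by (auto simp: r_coset_def)
  next
    assume "\<exists>u\<in>carrier M. a = u \<otimes> b"
    then obtain u where u: "u \<in> carrier M" "a = u \<otimes> b"
      by blast
    have "w \<otimes> a = (w \<otimes> u) \<otimes> b" if "w \<in> carrier M" for w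
      using that u ab by (simp add: m_assoc)
    then show "carrier M #> a \<subseteq> carrier M #> b"
      using u(1) by (fastforce simp: r_coset_def)
  qed
  from this[of x y] this[of y x] show ?thesis
    using True by (simp add: green_L_def set_eq_subset) blast
qed (auto simp: green_L_def)

lemma green_R_iff:
  "(x, y) \<in> green_R M \<longleftrightarrow> x \<in> carrier M \<and> y \<in> carrier M \<and>
    (\<exists>u\<in>carrier M. y = x \<otimes> u) \<and> (\<exists>v\<in>carrier M. x = y \<otimes> v)"
proof (cases "x \<in> carrier M \<and> y \<in> carrier M")
  case True
  have "a <# carrier M \<subseteq> b <# carrier M \<longleftrightarrow> (\<exists>u\<in>carrier M. a = b \<otimes> u)"
    if ab: "a \<in> carrier M" "b \<in> carrier M" for a b
  proof
    assume "a <# carrier M \<subseteq> b <# carrier M"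
    moreover have "a \<otimes> \<one> \<in> a <# carrier M"
      unfolding l_coset_def by blast
    ultimately show "\<exists>u\<in>carrier M. a = b \<otimes> u"
      using ab by (auto simp: l_coset_def)
  next
    assume "\<exists>u\<in>carrier M. a = b \<otimes> u"
    then obtain u where u: "u \<in> carrier M" "a = b \<otimes> u"
      by blast
    have "a \<otimes> w = b \<otimes> (u \<otimes> w)" if "w \<in> carrier M" for w
      using that u ab by (simp add: m_assoc)
    then show "a <# carrier M \<subseteq> b <# carrier M"
      using u(1) by (fastforce simp: l_coset_def)
  qed
  from this[of x y] this[of y x] show ?thesis
    using True by (simp add: green_R_def set_eq_subset) blast
qed (auto simp: green_R_def)

lemma equiv_green_L: "equiv (carrier M) (green_L M)"
  by (rule equivI) (auto simp: green_L_def refl_on_def sym_def trans_def)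

lemma equiv_green_R: "equiv (carrier M) (green_R M)"
  by (rule equivI) (auto simp: green_R_def refl_on_def sym_def trans_def)

text \<open>
  Stability of finite monoids. If \<open>x = umxv\<close>, then right multiplication by \<open>v\<close> maps a subset of
  \<open>Mmx\<close> onto \<open>Mx\<close>; as \<open>Mmx \<subseteq> Mx\<close> and both are finite, they coincide.
\<close>

lemma green_L_left_stable:
  assumes x: "x \<in> carrier M" and m: "m \<in> carrier M" and "x \<in> gen_ideal (m \<otimes> x)"
  shows "(x, m \<otimes> x) \<in> green_L M"
proof -
  obtain u v where uv: "u \<in> carrier M" "v \<in> carrier M" and eq: "x = u \<otimes> (m \<otimes> x) \<otimes> v"
    using assms(3) by (auto simp: gen_ideal_iff)
  let ?I = "\<lambda>y. carrier M #> y"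
  have I: "?I y = (\<lambda>w. w \<otimes> y) ` carrier M" for y
    by (auto simp: r_coset_def)
  have fin: "finite (?I y)" for y
    by (simp add: I finite_carrier)
  have sub: "?I (m \<otimes> x) \<subseteq> ?I x"
  proof -
    have "w \<otimes> (m \<otimes> x) = (w \<otimes> m) \<otimes> x" if "w \<in> carrier M" for w
      using that m x by (simp add: m_assoc)
    then show ?thesis
      using m by (fastforce simp: r_coset_def)
  qed
  have "?I x \<subseteq> (\<lambda>z. z \<otimes> v) ` ?I (m \<otimes> x)"
  proof
    fix z assume "z \<in> ?I x"
    then obtain w where w: "w \<in> carrier M" "z = w \<otimes> x"
      by (auto simp: r_coset_def)
    have "z = w \<otimes> (u \<otimes> (m \<otimes> x) \<otimes> v)"
      using w(2) eq by simp
    also have "\<dots> = ((w \<otimes> u) \<otimes> (m \<otimes> x)) \<otimes> v"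
      using w(1) uv m x by (simp add: m_assoc)
    finally show "z \<in> (\<lambda>z. z \<otimes> v) ` ?I (m \<otimes> x)"
      using w(1) uv(1) unfolding I by blast
  qed
  then have "card (?I x) \<le> card (?I (m \<otimes> x))"
    using fin surj_card_le by blast
  then have "?I (m \<otimes> x) = ?I x"
    using sub fin by (simp add: card_seteq)
  then show ?thesis
    using x m by (simp add: green_L_def)
qed

lemma green_R_right_stable:
  assumes x: "x \<in> carrier M" and m: "m \<in> carrier M" and "x \<in> gen_ideal (x \<otimes> m)"
  shows "(x, x \<otimes> m) \<in> green_R M"
proof -
  obtain u v where uv: "u \<in> carrier M" "v \<in> carrier M" and eq: "x = u \<otimes> (x \<otimes> m) \<otimes> v"
    using assms(3) by (auto simp: gen_ideal_iff)
  let ?I = "\<lambda>y. y <# carrier M"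
  have I: "?I y = (\<lambda>w. y \<otimes> w) ` carrier M" for y
    by (auto simp: l_coset_def)
  have fin: "finite (?I y)" for y
    by (simp add: I finite_carrier)
  have sub: "?I (x \<otimes> m) \<subseteq> ?I x"
  proof -
    have "x \<otimes> m \<otimes> w = x \<otimes> (m \<otimes> w)" if "w \<in> carrier M" for w
      using that m x by (simp add: m_assoc)
    then show ?thesis
      using m by (fastforce simp: l_coset_def)
  qed
  have "?I x \<subseteq> (\<lambda>z. u \<otimes> z) ` ?I (x \<otimes> m)"
  proof
    fix z assume "z \<in> ?I x"
    then obtain w where w: "w \<in> carrier M" "z = x \<otimes> w"
      by (auto simp: l_coset_def)
    have "z = (u \<otimes> (x \<otimes> m) \<otimes> v) \<otimes> w"
      using w(2) eq by simp
    also have "\<dots> = u \<otimes> ((x \<otimes> m) \<otimes> (v \<otimes> w))"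
      using w(1) uv m x by (simp add: m_assoc)
    finally show "z \<in> (\<lambda>z. u \<otimes> z) ` ?I (x \<otimes> m)"
      using w(1) uv(2) unfolding I by blast
  qed
  then have "card (?I x) \<le> card (?I (x \<otimes> m))"
    using fin surj_card_le by blast
  then have "?I (x \<otimes> m) = ?I x"
    using sub fin by (simp add: card_seteq)
  then show ?thesis
    using x m by (simp add: green_R_def)
qed

lemma green_L_gen_ideal:
  assumes "(x, y) \<in> green_L M"
  shows "x \<in> carrier M" "y \<in> carrier M" "x \<in> gen_ideal y" "y \<in> gen_ideal x"
  using assms unfolding green_L_iff by (metis gen_ideal_leftI)+

lemma green_R_gen_ideal:
  assumes "(x, y) \<in> green_R M"
  shows "x \<in> carrier M" "y \<in> carrier M" "x \<in> gen_ideal y" "y \<in> gen_ideal x"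
  using assms unfolding green_R_iff by (metis gen_ideal_rightI)+

text \<open>
  In a finite monoid \<open>\<D>\<close> is the relation of generating the same two-sided ideal. This makes
  it an equivalence relation, and the relation \<open>D_le\<close> on its classes a partial order.
\<close>

lemma green_D_iff:
  "(x, y) \<in> green_D M \<longleftrightarrow> x \<in> carrier M \<and> y \<in> carrier M \<and> x \<in> gen_ideal y \<and> y \<in> gen_ideal x"
proof
  assume "(x, y) \<in> green_D M"
  then obtain z where z: "(x, z) \<in> green_L M" "(z, y) \<in> green_R M"
    by (auto simp: green_D_def)
  with green_L_gen_ideal[OF z(1)] green_R_gen_ideal[OF z(2)]
  show "x \<in> carrier M \<and> y \<in> carrier M \<and> x \<in> gen_ideal y \<and> y \<in> gen_ideal x"
    using gen_ideal_trans by blast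
next
  assume *: "x \<in> carrier M \<and> y \<in> carrier M \<and> x \<in> gen_ideal y \<and> y \<in> gen_ideal x"
  then obtain u v where uv: "u \<in> carrier M" "v \<in> carrier M" "y = u \<otimes> x \<otimes> v"
    by (auto simp: gen_ideal_iff)
  \<comment> \<open>In the chain \<open>x\<close>, \<open>ux\<close>, \<open>y = uxv\<close> each element generates the same two-sided ideal, so
    stability applies to both steps.\<close>
  have ux: "u \<otimes> x \<in> carrier M" "u \<otimes> x \<in> gen_ideal x" "y \<in> gen_ideal (u \<otimes> x)"
    using * uv by (auto intro: gen_ideal_leftI gen_ideal_rightI)
  have "x \<in> gen_ideal (u \<otimes> x)" "u \<otimes> x \<in> gen_ideal y"
    using * ux gen_ideal_trans by blast+
  then have "(x, u \<otimes> x) \<in> green_L M" "(u \<otimes> x, y) \<in> green_R M"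
    using green_L_left_stable[of x u] green_R_right_stable[of "u \<otimes> x" v] * uv ux by simp_all
  then show "(x, y) \<in> green_D M"
    by (auto simp: green_D_def)
qed

lemma equiv_green_D: "equiv (carrier M) (green_D M)"
proof (rule equivI)
  show "green_D M \<subseteq> carrier M \<times> carrier M"
    by (auto simp: green_D_iff)
  show "refl_on (carrier M) (green_D M)"
    by (auto simp: refl_on_def green_D_iff intro: gen_ideal_refl)
  show "sym (green_D M)"
    by (auto simp: sym_def green_D_iff)
  show "trans (green_D M)"
    by (auto simp: trans_def green_D_iff intro: gen_ideal_trans)
qed

lemma green_L_imp_D: "(x, y) \<in> green_L M \<Longrightarrow> (x, y) \<in> green_D M"
  using green_L_gen_ideal by (simp add: green_D_iff)

lemma green_R_imp_D: "(x, y) \<in> green_R M \<Longrightarrow> (x, y) \<in> green_D M"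
  using green_R_gen_ideal by (simp add: green_D_iff)

lemma D_class_eq: "\<lbrakk>D \<in> D_classes M; x \<in> D\<rbrakk> \<Longrightarrow> D = green_D M `` {x}"
  unfolding D_classes_def by (metis Image_singleton_iff equiv_class_eq equiv_green_D quotientE)

lemma R_class_eq: "\<lbrakk>K \<in> R_classes_in M D; x \<in> K\<rbrakk> \<Longrightarrow> K = green_R M `` {x}"
  unfolding R_classes_in_def
  by (metis (lifting) Image_singleton_iff equiv_class_eq equiv_green_R mem_Collect_eq quotientE)

lemma L_class_eq: "\<lbrakk>K \<in> L_classes_in M D; x \<in> K\<rbrakk> \<Longrightarrow> K = green_L M `` {x}"
  unfolding L_classes_in_def
  by (metis (lifting) Image_singleton_iff equiv_class_eq equiv_green_L mem_Collect_eq quotientE)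

lemma D_class_carrier: "D \<in> D_classes M \<Longrightarrow> D \<subseteq> carrier M"
  unfolding D_classes_def using equiv_green_D by (metis Union_quotient Union_upper)

lemma D_class_of: "x \<in> carrier M \<Longrightarrow> green_D M `` {x} \<in> D_classes M \<and> x \<in> green_D M `` {x}"
  unfolding D_classes_def using equiv_class_self[OF equiv_green_D] by (auto simp: quotientI)

lemma R_class_of:
  assumes "D \<in> D_classes M" "x \<in> D"
  shows "green_R M `` {x} \<in> R_classes_in M D" "x \<in> green_R M `` {x}"
proof -
  have x: "x \<in> carrier M"
    using assms D_class_carrier by blast
  show "green_R M `` {x} \<in> R_classes_in M D"
    using D_class_eq[OF assms] x by (auto simp: R_classes_in_def quotientI intro: green_R_imp_D)
  show "x \<in> green_R M `` {x}"
    using equiv_class_self[OF equiv_green_R x] .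
qed

lemma L_class_of:
  assumes "D \<in> D_classes M" "x \<in> D"
  shows "green_L M `` {x} \<in> L_classes_in M D" "x \<in> green_L M `` {x}"
proof -
  have x: "x \<in> carrier M"
    using assms D_class_carrier by blast
  show "green_L M `` {x} \<in> L_classes_in M D"
    using D_class_eq[OF assms] x by (auto simp: L_classes_in_def quotientI intro: green_L_imp_D)
  show "x \<in> green_L M `` {x}"
    using equiv_class_self[OF equiv_green_L x] .
qed

lemma finite_D_classes: "finite (D_classes M)"
  unfolding D_classes_def
  using equiv_green_D finite_carrier by (simp add: equiv_def finite_quotient)

lemma finite_R_classes_in: "finite (R_classes_in M D)"
  unfolding R_classes_in_def
  using equiv_green_R finite_carrier by (simp add: equiv_def finite_quotient)

lemma finite_L_classes_in: "finite (L_classes_in M D)"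
  unfolding L_classes_in_def
  using equiv_green_L finite_carrier by (simp add: equiv_def finite_quotient)

text \<open>
  The elements of a \<open>\<D>\<close>-class generate the same two-sided ideal, so any representatives may be
  used to compare two classes.
\<close>

lemma D_le_iff:
  assumes "D1 \<in> D_classes M" "D2 \<in> D_classes M" "x \<in> D1" "y \<in> D2"
  shows "D_le M D1 D2 \<longleftrightarrow> x \<in> gen_ideal y"
proof
  assume "D_le M D1 D2"
  then obtain x' y' where *: "x' \<in> D1" "y' \<in> D2" "x' \<in> gen_ideal y'"
    by (auto simp: D_le_def)
  then have "(x, x') \<in> green_D M" "(y', y) \<in> green_D M"
    using D_class_eq assms by (metis Image_singleton_iff)+
  then have "x \<in> gen_ideal x'" "y' \<in> gen_ideal y" "y \<in> carrier M" "y' \<in> carrier M"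
    by (auto simp: green_D_iff)
  with *(3) show "x \<in> gen_ideal y"
    using gen_ideal_trans by blast
qed (use assms in \<open>auto simp: D_le_def\<close>)

lemma D_le_trans:
  assumes "D1 \<in> D_classes M" "D2 \<in> D_classes M" "D3 \<in> D_classes M"
    and "D_le M D1 D2" "D_le M D2 D3"
  shows "D_le M D1 D3"
proof -
  obtain x y z where x: "x \<in> D1" and y: "y \<in> D2" and z: "z \<in> D3"
    using assms(4,5) by (auto simp: D_le_def)
  have "x \<in> gen_ideal y" "y \<in> gen_ideal z"
    using assms(4,5) D_le_iff[OF assms(1,2) x y] D_le_iff[OF assms(2,3) y z] by simp_all
  moreover have "z \<in> carrier M"
    using D_class_carrier[OF assms(3)] z by blast
  ultimately show ?thesis
    using D_le_iff[OF assms(1,3) x z] gen_ideal_trans by simp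
qed

lemma D_le_antisym:
  assumes "D1 \<in> D_classes M" "D2 \<in> D_classes M" "D_le M D1 D2" "D_le M D2 D1"
  shows "D1 = D2"
proof -
  obtain x y where x: "x \<in> D1" and y: "y \<in> D2"
    using assms(3) by (auto simp: D_le_def)
  have "(x, y) \<in> green_D M"
    using assms(3,4) D_le_iff[OF assms(1,2) x y] D_le_iff[OF assms(2,1) y x]
      D_class_carrier[OF assms(1)] D_class_carrier[OF assms(2)] x y
    unfolding green_D_iff by blast
  then show ?thesis
    using equiv_class_eq[OF equiv_green_D] D_class_eq[OF assms(1) x] D_class_eq[OF assms(2) y]
    by simp
qed

lemma eggbox_cell_nonempty:
  assumes D: "D \<in> D_classes M" and K: "K \<in> R_classes_in M D" and L: "L \<in> L_classes_in M D"
  shows "\<exists>z. z \<in> K \<inter> L"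
proof -
  obtain x where x: "x \<in> K"
    using K in_quotient_imp_non_empty[OF equiv_green_R] by (auto simp: R_classes_in_def)
  obtain y where y: "y \<in> L"
    using L in_quotient_imp_non_empty[OF equiv_green_L] by (auto simp: L_classes_in_def)
  have "x \<in> D" "y \<in> D"
    using x y K L by (auto simp: R_classes_in_def L_classes_in_def)
  then have "(y, x) \<in> green_D M"
    using D_class_eq[OF D] by blast
  then obtain z where z: "(y, z) \<in> green_L M" "(z, x) \<in> green_R M"
    by (auto simp: green_D_def)
  then have "(x, z) \<in> green_R M"
    using equiv_green_R by (meson equivE symD)
  then have "z \<in> K" "z \<in> L"
    using R_class_eq[OF K x] L_class_eq[OF L y] z by blast+
  then show ?thesis
    by blast
qed

lemma green_R_left_cong:
  assumes "(x, y) \<in> green_R M" "m \<in> carrier M"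
  shows "(m \<otimes> x, m \<otimes> y) \<in> green_R M"
proof -
  obtain u v where "u \<in> carrier M" "v \<in> carrier M" and "y = x \<otimes> u" "x = y \<otimes> v"
    and "x \<in> carrier M" "y \<in> carrier M"
    using assms(1) by (auto simp: green_R_iff)
  then have "m \<otimes> y = m \<otimes> x \<otimes> u" "m \<otimes> x = m \<otimes> y \<otimes> v"
    using assms(2) by (metis m_assoc)+
  then show ?thesis
    using \<open>u \<in> carrier M\<close> \<open>v \<in> carrier M\<close> \<open>x \<in> carrier M\<close> \<open>y \<in> carrier M\<close> assms(2)
    unfolding green_R_iff by blast
qed

lemma green_L_right_cong:
  assumes "(x, y) \<in> green_L M" "m \<in> carrier M"
  shows "(x \<otimes> m, y \<otimes> m) \<in> green_L M"
proof -
  obtain u v where "u \<in> carrier M" "v \<in> carrier M" and "y = u \<otimes> x" "x = v \<otimes> y"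
    and "x \<in> carrier M" "y \<in> carrier M"
    using assms(1) by (auto simp: green_L_iff)
  then have "y \<otimes> m = u \<otimes> (x \<otimes> m)" "x \<otimes> m = v \<otimes> (y \<otimes> m)"
    using assms(2) by (metis m_assoc)+
  then show ?thesis
    using \<open>u \<in> carrier M\<close> \<open>v \<in> carrier M\<close> \<open>x \<in> carrier M\<close> \<open>y \<in> carrier M\<close> assms(2)
    unfolding green_L_iff by blast
qed

end

section \<open>The Schutzenberger group\<close>

locale based_monoid = finite_monoid M for M (structure) +
  fixes \<gamma>
  assumes base_closed [simp]: "\<gamma> \<in> carrier M"
begin

abbreviation "H \<equiv> green_H M `` {\<gamma>}"
abbreviation "G \<equiv> schutz_group_at M \<gamma>"

declare Image_singleton_iff [iff del]

lemma H_iff: "h \<in> H \<longleftrightarrow> (\<gamma>, h) \<in> green_L M \<and> (\<gamma>, h) \<in> green_R M"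
  by (auto simp: green_H_def Image_singleton_iff)

lemma base_in_H: "\<gamma> \<in> H"
  using equiv_class_self[OF equiv_green_L base_closed] equiv_class_self[OF equiv_green_R base_closed]
  unfolding H_iff by (simp add: Image_singleton_iff)

lemma H_left_multiple: "h \<in> H \<Longrightarrow> \<exists>x\<in>carrier M. h = x \<otimes> \<gamma>"
  by (simp add: H_iff green_L_iff)

lemma H_right_multiple: "h \<in> H \<Longrightarrow> \<exists>x\<in>carrier M. h = \<gamma> \<otimes> x"
  by (simp add: H_iff green_R_iff)

lemma H_carrier: "h \<in> H \<Longrightarrow> h \<in> carrier M"
  by (simp add: H_iff green_R_iff)

text \<open>
  To stabilise \<open>H\<close>, a right multiplication need only keep the base point in \<open>H\<close>. Every \<open>k \<in> H\<close> is a
  left multiple of \<open>\<gamma>\<close> and \<open>\<R>\<close> is a left congruence, so \<open>ku\<close> is \<open>\<R>\<close>-related to \<open>k\<close>; and \<open>\<L>\<close> is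
  a right congruence, so \<open>ku\<close> is \<open>\<L>\<close>-related to \<open>\<gamma>u\<close>.
\<close>

lemma RT_iff: "u \<in> RT M H \<longleftrightarrow> u \<in> carrier M \<and> \<gamma> \<otimes> u \<in> H"
proof
  assume "u \<in> RT M H"
  then show "u \<in> carrier M \<and> \<gamma> \<otimes> u \<in> H"
    using base_in_H by (auto simp: RT_def r_coset_def)
next
  assume u: "u \<in> carrier M \<and> \<gamma> \<otimes> u \<in> H"
  have "k \<otimes> u \<in> H" if k: "k \<in> H" for k
  proof -
    obtain x where x: "x \<in> carrier M" "k = x \<otimes> \<gamma>"
      using H_left_multiple[OF k] by blast
    have "(k, k \<otimes> u) \<in> green_R M"
      using green_R_left_cong[of \<gamma> "\<gamma> \<otimes> u" x] u x by (simp add: H_iff m_assoc)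
    moreover have "(\<gamma> \<otimes> u, k \<otimes> u) \<in> green_L M"
      using green_L_right_cong[of \<gamma> k u] u k by (simp add: H_iff)
    ultimately show ?thesis
      using u k unfolding H_iff
      by (meson equivE equiv_green_L equiv_green_R transD)
  qed
  then show "u \<in> RT M H"
    using u by (auto simp: RT_def r_coset_def)
qed

lemma RT_mult_H: "\<lbrakk>u \<in> RT M H; h \<in> H\<rbrakk> \<Longrightarrow> h \<otimes> u \<in> H"
  by (auto simp: RT_def r_coset_def)

lemma schutz_elem_translation:
  "g \<in> carrier G \<Longrightarrow> \<exists>u\<in>carrier M. g = right_transl M H u \<and> (\<forall>h\<in>H. g h = h \<otimes> u)"
  by (auto simp: schutz_group_def right_transl_def RT_def)

lemma schutz_elem_closed: "\<lbrakk>g \<in> carrier G; h \<in> H\<rbrakk> \<Longrightarrow> g h \<in> H"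
  using RT_mult_H by (auto simp: schutz_group_def right_transl_def )

lemma schutz_mult_apply: "h \<in> H \<Longrightarrow> (f \<otimes>\<^bsub>G\<^esub> g) h = g (f h)"
  by (simp add: schutz_group_def compose_def)

lemma schutz_group_monoid: "finite_monoid G"
proof
  have ext: "g \<in> extensional H" if "g \<in> carrier G" for g
    using that by (auto simp: schutz_group_def right_transl_def)
  have eqI: "f = g" if "f \<in> carrier G" "g \<in> carrier G" "\<And>h. h \<in> H \<Longrightarrow> f h = g h" for f g
    using that ext by (blast intro: extensionalityI)
  have mult: "right_transl M H u \<otimes>\<^bsub>G\<^esub> right_transl M H v = right_transl M H (u \<otimes> v) \<and> u \<otimes> v \<in> RT M H"
    if uv: "u \<in> RT M H" "v \<in> RT M H" for u v
  proof
    have M: "u \<in> carrier M" "v \<in> carrier M"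
      using uv by (auto simp: RT_def)
    show "right_transl M H u \<otimes>\<^bsub>G\<^esub> right_transl M H v = right_transl M H (u \<otimes> v)"
      using M RT_mult_H[OF uv(1)]
      by (auto simp: schutz_group_def compose_def right_transl_def fun_eq_iff m_assoc H_carrier restrict_def)
    show "u \<otimes> v \<in> RT M H"
      using M RT_mult_H[OF uv(2) RT_mult_H[OF uv(1) base_in_H]] by (simp add: RT_iff m_assoc)
  qed
  show closed: "f \<otimes>\<^bsub>G\<^esub> g \<in> carrier G" if fg: "f \<in> carrier G" "g \<in> carrier G" for f g
  proof -
    obtain u v where "u \<in> RT M H" "v \<in> RT M H" "f = right_transl M H u" "g = right_transl M H v"
      using fg by (auto simp: schutz_group_def)
    then show ?thesis
      using mult by (auto simp: schutz_group_def)
  qed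
  show one: "\<one>\<^bsub>G\<^esub> \<in> carrier G"
    using base_in_H by (auto simp: schutz_group_def RT_iff)
  have one_apply: "\<one>\<^bsub>G\<^esub> h = h" if "h \<in> H" for h
    using that H_carrier by (simp add: schutz_group_def right_transl_def)
  show "f \<otimes>\<^bsub>G\<^esub> g \<otimes>\<^bsub>G\<^esub> h = f \<otimes>\<^bsub>G\<^esub> (g \<otimes>\<^bsub>G\<^esub> h)"
    if "f \<in> carrier G" "g \<in> carrier G" "h \<in> carrier G" for f g h
    using that by (intro eqI closed) (simp_all add: schutz_mult_apply schutz_elem_closed)
  show "\<one>\<^bsub>G\<^esub> \<otimes>\<^bsub>G\<^esub> f = f" "f \<otimes>\<^bsub>G\<^esub> \<one>\<^bsub>G\<^esub> = f" if "f \<in> carrier G" for f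
    using that one by (intro eqI closed; simp add: schutz_mult_apply schutz_elem_closed one_apply)+
  have "finite (RT M H)"
    using finite_carrier by (rule finite_subset[rotated]) (auto simp: RT_def)
  then show "finite (carrier G)"
    by (simp add: schutz_group_def)
qed

text \<open>
  The Schutzenberger group acts regularly on \<open>H\<close>: as \<open>H\<close> consists of left multiples of \<open>\<gamma>\<close>, a right
  translation is determined by its value at \<open>\<gamma>\<close>, and as it consists of right multiples of \<open>\<gamma>\<close>, every
  value occurs.
\<close>

lemma schutz_eval_bij: "bij_betw (\<lambda>g. g \<gamma>) (carrier G) H"
proof (rule bij_betwI')
  show "(f \<gamma> = g \<gamma>) = (f = g)" if f: "f \<in> carrier G" and g: "g \<in> carrier G" for f g
  proof
    assume eq: "f \<gamma> = g \<gamma>"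
    obtain u where u: "u \<in> carrier M" "f = right_transl M H u" "\<And>h. h \<in> H \<Longrightarrow> f h = h \<otimes> u"
      using schutz_elem_translation[OF f] by blast
    obtain v where v: "v \<in> carrier M" "g = right_transl M H v" "\<And>h. h \<in> H \<Longrightarrow> g h = h \<otimes> v"
      using schutz_elem_translation[OF g] by blast
    have "h \<otimes> u = h \<otimes> v" if h: "h \<in> H" for h
    proof -
      obtain x where x: "x \<in> carrier M" "h = x \<otimes> \<gamma>"
        using H_left_multiple[OF h] by blast
      have "\<gamma> \<otimes> u = \<gamma> \<otimes> v"
        using eq u(3)[OF base_in_H] v(3)[OF base_in_H] by simp
      then show ?thesis
        using u(1) v(1) x by (simp add: m_assoc)
    qed
    then show "f = g"
      by (auto simp: u(2) v(2) right_transl_def fun_eq_iff restrict_def)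
  qed simp
  show "g \<gamma> \<in> H" if "g \<in> carrier G" for g
    using that base_in_H by (rule schutz_elem_closed)
  show "\<exists>g\<in>carrier G. h = g \<gamma>" if h: "h \<in> H" for h
  proof -
    obtain u where u: "u \<in> carrier M" "h = \<gamma> \<otimes> u"
      using H_right_multiple[OF h] by blast
    then have "right_transl M H u \<in> carrier G"
      using h by (simp add: schutz_group_def RT_iff)
    moreover have "right_transl M H u \<gamma> = h"
      using u base_in_H by (simp add: right_transl_def)
    ultimately show ?thesis
      by blast
  qed
qed

text \<open>
  Elements of the Schutzenberger group are right translations, so they commute with left
  multiplications. This makes the coordinates below equivariant.
\<close>

lemma schutz_left_mult_cong:
  assumes "g \<in> carrier G" "p \<in> carrier M" "q \<in> carrier M" "h \<in> H" "k \<in> H" "p \<otimes> h = q \<otimes> k"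
  shows "p \<otimes> g h = q \<otimes> g k"
proof -
  obtain u where u: "u \<in> carrier M" "g = right_transl M H u" "\<And>h. h \<in> H \<Longrightarrow> g h = h \<otimes> u"
    using schutz_elem_translation[OF assms(1)] by blast
  have "p \<otimes> (h \<otimes> u) = q \<otimes> (k \<otimes> u)"
    using assms(2-) u(1) by (metis H_carrier m_assoc)
  then show ?thesis
    using assms u(3) by simp
qed

lemma H_right_mult_cong:
  assumes h: "h \<in> H" and pq: "p \<in> carrier M" "q \<in> carrier M" "\<gamma> \<otimes> p = \<gamma> \<otimes> q"
  shows "h \<otimes> p = h \<otimes> q"
proof -
  obtain x where "x \<in> carrier M" "h = x \<otimes> \<gamma>"
    using H_left_multiple[OF h] by blast
  then show ?thesis
    using pq by (simp add: m_assoc)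
qed

end

section \<open>Green's lemma and egg-box coordinates\<close>

context finite_monoid
begin

text \<open>
  Green's lemma: if left multiplication by \<open>\<alpha>\<close> can be undone at one point \<open>x\<close>, it can be undone on
  the whole \<open>\<R>\<close>-class of \<open>x\<close>, because that class consists of right multiples of \<open>x\<close>.
\<close>

lemma green_left_translation:
  assumes z: "x \<in> carrier M" "\<alpha> \<in> carrier M" "\<alpha>' \<in> carrier M" "\<alpha>' \<otimes> (\<alpha> \<otimes> x) = x"
    and h: "(x, h) \<in> green_R M"
  shows "(\<alpha> \<otimes> x, \<alpha> \<otimes> h) \<in> green_R M" "\<alpha>' \<otimes> (\<alpha> \<otimes> h) = h" "(h, \<alpha> \<otimes> h) \<in> green_L M"
proof -
  show "(\<alpha> \<otimes> x, \<alpha> \<otimes> h) \<in> green_R M"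
    using green_R_left_cong[OF h] z by simp
  obtain u where u: "u \<in> carrier M" "h = x \<otimes> u"
    using h by (auto simp: green_R_iff)
  have "\<alpha>' \<otimes> (\<alpha> \<otimes> h) = (\<alpha>' \<otimes> (\<alpha> \<otimes> x)) \<otimes> u"
    using u z(1-3) by (simp add: m_assoc)
  then show *: "\<alpha>' \<otimes> (\<alpha> \<otimes> h) = h"
    using z(4) u by simp
  then show "(h, \<alpha> \<otimes> h) \<in> green_L M"
    unfolding green_L_iff using u z(1-3) by (metis m_closed)
qed

lemma green_right_translation:
  assumes z: "x \<in> carrier M" "\<beta> \<in> carrier M" "\<beta>' \<in> carrier M" "x \<otimes> \<beta> \<otimes> \<beta>' = x"
    and h: "(x, h) \<in> green_L M"
  shows "(x \<otimes> \<beta>, h \<otimes> \<beta>) \<in> green_L M" "h \<otimes> \<beta> \<otimes> \<beta>' = h" "(h, h \<otimes> \<beta>) \<in> green_R M"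
proof -
  show "(x \<otimes> \<beta>, h \<otimes> \<beta>) \<in> green_L M"
    using green_L_right_cong[OF h] z by simp
  obtain u where u: "u \<in> carrier M" "h = u \<otimes> x"
    using h by (auto simp: green_L_iff)
  have "h \<otimes> \<beta> \<otimes> \<beta>' = u \<otimes> (x \<otimes> \<beta> \<otimes> \<beta>')"
    using u z(1-3) by (simp add: m_assoc)
  then show *: "h \<otimes> \<beta> \<otimes> \<beta>' = h"
    using z(4) u by simp
  then show "(h, h \<otimes> \<beta>) \<in> green_R M"
    unfolding green_R_iff using u z(1-3) by (metis m_closed)
qed

text \<open>
  The row \<open>K\<close> meets the column of \<open>x\<close> in some \<open>z\<close>, and any left multipliers leading from \<open>x\<close> to \<open>z\<close>
  and back serve, by Green's lemma, for all columns at once.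
\<close>

lemma R_class_left_translation_exists:
  assumes D: "D \<in> D_classes M" and x: "x \<in> D" and K: "K \<in> R_classes_in M D"
  shows "\<exists>\<alpha>\<in>carrier M. \<exists>\<alpha>'\<in>carrier M. \<forall>L\<in>L_classes_in M D.
    bij_betw (\<lambda>h. \<alpha> \<otimes> h) (green_R M `` {x} \<inter> L) (K \<inter> L) \<and>
    (\<forall>h\<in>K \<inter> L. \<alpha>' \<otimes> h = inv_into (green_R M `` {x} \<inter> L) (\<lambda>k. \<alpha> \<otimes> k) h)"
proof -
  obtain z where z: "z \<in> K" "(x, z) \<in> green_L M"
    using eggbox_cell_nonempty[OF D K L_class_of(1)[OF D x]] by auto
  then obtain \<alpha> \<alpha>' where \<alpha>: "\<alpha> \<in> carrier M" "\<alpha>' \<in> carrier M" "z = \<alpha> \<otimes> x" "x = \<alpha>' \<otimes> z"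
    and M: "x \<in> carrier M" "z \<in> carrier M"
    by (auto simp: green_L_iff)
  then have eq: "\<alpha>' \<otimes> (\<alpha> \<otimes> x) = x" "\<alpha> \<otimes> (\<alpha>' \<otimes> z) = z"
    by metis+
  have "bij_betw (\<lambda>h. \<alpha> \<otimes> h) (green_R M `` {x} \<inter> L) (K \<inter> L) \<and>
    (\<forall>h\<in>K \<inter> L. \<alpha>' \<otimes> h = inv_into (green_R M `` {x} \<inter> L) (\<lambda>k. \<alpha> \<otimes> k) h)"
    if L: "L \<in> L_classes_in M D" for L
  proof -
    have 1: "\<alpha> \<otimes> h \<in> K \<inter> L \<and> \<alpha>' \<otimes> (\<alpha> \<otimes> h) = h" if h: "h \<in> green_R M `` {x} \<inter> L" for h
    proof -
      have "(x, h) \<in> green_R M"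
        using h by blast
      from green_left_translation[OF M(1) \<alpha>(1,2) eq(1) this] show ?thesis
        unfolding \<alpha>(3)[symmetric] using R_class_eq[OF K z(1)] L_class_eq[OF L, of h] h by blast
    qed
    have 2: "\<alpha>' \<otimes> h \<in> green_R M `` {x} \<inter> L \<and> \<alpha> \<otimes> (\<alpha>' \<otimes> h) = h" if h: "h \<in> K \<inter> L" for h
    proof -
      have "(z, h) \<in> green_R M"
        using h R_class_eq[OF K z(1)] by blast
      from green_left_translation[OF M(2) \<alpha>(2,1) eq(2) this] show ?thesis
        unfolding \<alpha>(4)[symmetric] using L_class_eq[OF L, of h] h by blast
    qed
    have bij: "bij_betw (\<lambda>h. \<alpha> \<otimes> h) (green_R M `` {x} \<inter> L) (K \<inter> L)"
      using 1 2 by (intro bij_betw_byWitness[where f' = "\<lambda>h. \<alpha>' \<otimes> h"]) blast+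
    moreover have "\<alpha>' \<otimes> h = inv_into (green_R M `` {x} \<inter> L) (\<lambda>k. \<alpha> \<otimes> k) h" if "h \<in> K \<inter> L" for h
      using 2[OF that] bij by (intro inv_into_f_eq[symmetric]) (auto simp: bij_betw_def)
    ultimately show ?thesis
      by blast
  qed
  then show ?thesis
    using \<alpha> by blast
qed

lemma L_class_right_translation_exists:
  assumes D: "D \<in> D_classes M" and x: "x \<in> D" and L: "L \<in> L_classes_in M D"
  shows "\<exists>\<beta>\<in>carrier M. \<exists>\<beta>'\<in>carrier M. \<forall>K\<in>R_classes_in M D.
    bij_betw (\<lambda>h. h \<otimes> \<beta>) (K \<inter> green_L M `` {x}) (K \<inter> L) \<and>
    (\<forall>h\<in>K \<inter> L. h \<otimes> \<beta>' = inv_into (K \<inter> green_L M `` {x}) (\<lambda>k. k \<otimes> \<beta>) h)"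
proof -
  obtain z where z: "z \<in> L" "(x, z) \<in> green_R M"
    using eggbox_cell_nonempty[OF D R_class_of(1)[OF D x] L] by auto
  then obtain \<beta> \<beta>' where \<beta>: "\<beta> \<in> carrier M" "\<beta>' \<in> carrier M" "z = x \<otimes> \<beta>" "x = z \<otimes> \<beta>'"
    and M: "x \<in> carrier M" "z \<in> carrier M"
    by (auto simp: green_R_iff)
  then have eq: "x \<otimes> \<beta> \<otimes> \<beta>' = x" "z \<otimes> \<beta>' \<otimes> \<beta> = z"
    by metis+
  have "bij_betw (\<lambda>h. h \<otimes> \<beta>) (K \<inter> green_L M `` {x}) (K \<inter> L) \<and>
    (\<forall>h\<in>K \<inter> L. h \<otimes> \<beta>' = inv_into (K \<inter> green_L M `` {x}) (\<lambda>k. k \<otimes> \<beta>) h)"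
    if K: "K \<in> R_classes_in M D" for K
  proof -
    have 1: "h \<otimes> \<beta> \<in> K \<inter> L \<and> h \<otimes> \<beta> \<otimes> \<beta>' = h" if h: "h \<in> K \<inter> green_L M `` {x}" for h
    proof -
      have "(x, h) \<in> green_L M"
        using h by blast
      from green_right_translation[OF M(1) \<beta>(1,2) eq(1) this] show ?thesis
        unfolding \<beta>(3)[symmetric] using L_class_eq[OF L z(1)] R_class_eq[OF K, of h] h by blast
    qed
    have 2: "h \<otimes> \<beta>' \<in> K \<inter> green_L M `` {x} \<and> h \<otimes> \<beta>' \<otimes> \<beta> = h" if h: "h \<in> K \<inter> L" for h
    proof -
      have "(z, h) \<in> green_L M"
        using h L_class_eq[OF L z(1)] by blast
      from green_right_translation[OF M(2) \<beta>(2,1) eq(2) this] show ?thesis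
        unfolding \<beta>(4)[symmetric] using R_class_eq[OF K, of h] h by blast
    qed
    have bij: "bij_betw (\<lambda>h. h \<otimes> \<beta>) (K \<inter> green_L M `` {x}) (K \<inter> L)"
      using 1 2 by (intro bij_betw_byWitness[where f' = "\<lambda>h. h \<otimes> \<beta>'"]) blast+
    moreover have "h \<otimes> \<beta>' = inv_into (K \<inter> green_L M `` {x}) (\<lambda>k. k \<otimes> \<beta>) h" if "h \<in> K \<inter> L" for h
      using 2[OF that] bij by (intro inv_into_f_eq[symmetric]) (auto simp: bij_betw_def)
    ultimately show ?thesis
      by blast
  qed
  then show ?thesis
    using \<beta> by blast
qed

lemma D_class_of_subset:
  assumes D: "D \<in> D_classes M" and K: "K \<subseteq> D" "K \<noteq> {}"
  shows "green_D M `` K = D"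
proof -
  have "green_D M `` {x} = D" if "x \<in> K" for x
    using D_class_eq[OF D, of x] that K(1) by blast
  then show ?thesis
    using K(2) by blast
qed

lemma eggbox_choice_exists:
  assumes \<gamma>: "base_choice M \<gamma>"
  shows "\<exists>a a' b b'. eggbox_choice M \<gamma> a a' b b'"
proof -
  define QR where "QR D K p \<longleftrightarrow> fst p \<in> carrier M \<and> snd p \<in> carrier M \<and>
    (\<forall>L\<in>L_classes_in M D.
      bij_betw (\<lambda>h. fst p \<otimes> h) (green_R M `` {\<gamma> D} \<inter> L) (K \<inter> L) \<and>
      (\<forall>h\<in>K \<inter> L. snd p \<otimes> h = inv_into (green_R M `` {\<gamma> D} \<inter> L) (\<lambda>k. fst p \<otimes> k) h))" for D K p
  define QL where "QL D L p \<longleftrightarrow> fst p \<in> carrier M \<and> snd p \<in> carrier M \<and>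
    (\<forall>K\<in>R_classes_in M D.
      bij_betw (\<lambda>h. h \<otimes> fst p) (K \<inter> green_L M `` {\<gamma> D}) (K \<inter> L) \<and>
      (\<forall>h\<in>K \<inter> L. h \<otimes> snd p = inv_into (K \<inter> green_L M `` {\<gamma> D}) (\<lambda>k. k \<otimes> fst p) h))" for D L p
  have \<gamma>D: "\<gamma> D \<in> D" if "D \<in> D_classes M" for D
    using that \<gamma> by (auto simp: base_choice_def)
  have R: "\<exists>p. QR D K p" if "D \<in> D_classes M" "K \<in> R_classes_in M D" for D K
    using R_class_left_translation_exists[OF that(1) \<gamma>D[OF that(1)] that(2)] by (auto simp: QR_def)
  have L: "\<exists>p. QL D K p" if "D \<in> D_classes M" "K \<in> L_classes_in M D" for D K
    using L_class_right_translation_exists[OF that(1) \<gamma>D[OF that(1)] that(2)] by (auto simp: QL_def)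
  \<comment> \<open>A class determines the \<open>\<D>\<close>-class around it, so one choice function on sets suffices.\<close>
  define p where "p K = (SOME p. QR (green_D M `` K) K p)" for K
  define q where "q K = (SOME p. QL (green_D M `` K) K p)" for K
  have p: "QR D K (p K)" if "D \<in> D_classes M" "K \<in> R_classes_in M D" for D K
  proof -
    have "green_D M `` K = D"
      using that in_quotient_imp_non_empty[OF equiv_green_R]
      by (intro D_class_of_subset) (auto simp: R_classes_in_def)
    then show ?thesis
      using someI_ex[OF R[OF that]] by (simp add: p_def)
  qed
  have q: "QL D K (q K)" if "D \<in> D_classes M" "K \<in> L_classes_in M D" for D K
  proof -
    have "green_D M `` K = D"
      using that in_quotient_imp_non_empty[OF equiv_green_L]
      by (intro D_class_of_subset) (auto simp: L_classes_in_def)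
    then show ?thesis
      using someI_ex[OF L[OF that]] by (simp add: q_def)
  qed
  have "eggbox_choice M \<gamma> (fst \<circ> p) (snd \<circ> p) (fst \<circ> q) (snd \<circ> q)"
    using p q unfolding eggbox_choice_def QR_def QL_def Let_def comp_def by blast
  then show ?thesis
    by blast
qed

end

locale eggbox = finite_monoid M for M (structure) +
  fixes \<gamma> :: "'a set \<Rightarrow> 'a" and a a' b b' :: "'a set \<Rightarrow> 'a"
  assumes base_choice: "base_choice M \<gamma>"
    and eggbox_choice: "eggbox_choice M \<gamma> a a' b b'"
begin

abbreviation "SG D \<equiv> schutz_group_at M (\<gamma> D)"

definition coord :: "'a set \<Rightarrow> 'a set \<Rightarrow> 'a set \<Rightarrow> ('a \<Rightarrow> 'a) \<Rightarrow> 'a"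
  where "coord D K L g = a K \<otimes> g (\<gamma> D) \<otimes> b L"

definition strictly_below :: "'a set \<Rightarrow> 'a set"
  where "strictly_below D = \<Union> {D' \<in> D_classes M. D_le M D' D \<and> D' \<noteq> D}"

lemma base_in: "D \<in> D_classes M \<Longrightarrow> \<gamma> D \<in> D"
  using base_choice by (simp add: base_choice_def)

lemma based: "D \<in> D_classes M \<Longrightarrow> based_monoid M (\<gamma> D)"
  using base_in D_class_carrier finite_monoid_axioms
  by (auto simp: based_monoid_def based_monoid_axioms_def)

lemma left_translation:
  assumes "D \<in> D_classes M" "K \<in> R_classes_in M D"
  shows "a K \<in> carrier M"
    and "L \<in> L_classes_in M D \<Longrightarrow>
      bij_betw (\<lambda>h. a K \<otimes> h) (green_R M `` {\<gamma> D} \<inter> L) (K \<inter> L)"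
  using eggbox_choice assms by (simp_all add: eggbox_choice_def Let_def)

lemma right_translation:
  assumes "D \<in> D_classes M" "L \<in> L_classes_in M D"
  shows "b L \<in> carrier M"
    and "K \<in> R_classes_in M D \<Longrightarrow>
      bij_betw (\<lambda>h. h \<otimes> b L) (K \<inter> green_L M `` {\<gamma> D}) (K \<inter> L)"
  using eggbox_choice assms by (simp_all add: eggbox_choice_def Let_def)

lemma base_H_class: "green_R M `` {\<gamma> D} \<inter> green_L M `` {\<gamma> D} = green_H M `` {\<gamma> D}"
  by (auto simp: green_H_def)

text \<open>
  \<open>coord\<close> describes the cell \<open>K \<inter> L\<close> of the egg-box by the elements of the Schutzenberger group:
  first \<open>g \<mapsto> \<gamma>g\<close> maps it onto the \<open>\<H>\<close>-class of the base point, and then the egg-box translations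
  lead to \<open>K \<inter> L\<close>.
\<close>

lemma coord_bij:
  assumes D: "D \<in> D_classes M" and K: "K \<in> R_classes_in M D" and L: "L \<in> L_classes_in M D"
  shows "bij_betw (coord D K L) (carrier (SG D)) (K \<inter> L)"
proof -
  interpret B: based_monoid M "\<gamma> D"
    using based[OF D] .
  have L1: "green_L M `` {\<gamma> D} \<in> L_classes_in M D"
    using L_class_of[OF D base_in[OF D]] by simp
  have "bij_betw ((\<lambda>h. h \<otimes> b L) \<circ> ((\<lambda>h. a K \<otimes> h) \<circ> (\<lambda>g. g (\<gamma> D)))) (carrier (SG D)) (K \<inter> L)"
    using B.schutz_eval_bij left_translation(2)[OF D K L1] right_translation(2)[OF D L K]
    by (intro bij_betw_trans) (simp_all add: base_H_class)
  then show ?thesis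
    by (simp add: coord_def[abs_def] comp_def)
qed

lemma coord_mem:
  assumes "D \<in> D_classes M" "K \<in> R_classes_in M D" "L \<in> L_classes_in M D" "g \<in> carrier (SG D)"
  shows "coord D K L g \<in> K" "coord D K L g \<in> L" "coord D K L g \<in> D" "coord D K L g \<in> carrier M"
proof -
  show "coord D K L g \<in> K" "coord D K L g \<in> L"
    using coord_bij[OF assms(1-3)] assms(4) by (auto simp: bij_betw_def)
  then show "coord D K L g \<in> D"
    using assms(2) by (auto simp: R_classes_in_def)
  then show "coord D K L g \<in> carrier M"
    using D_class_carrier[OF assms(1)] by blast
qed

lemma coord_surj:
  assumes D: "D \<in> D_classes M" and x: "x \<in> D"
  shows "\<exists>K\<in>R_classes_in M D. \<exists>L\<in>L_classes_in M D. \<exists>g\<in>carrier (SG D). x = coord D K L g"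
proof -
  note K = R_class_of[OF D x] and L = L_class_of[OF D x]
  have "x \<in> coord D (green_R M `` {x}) (green_L M `` {x}) ` carrier (SG D)"
    using coord_bij[OF D K(1) L(1)] K(2) L(2) by (auto simp: bij_betw_def)
  then show ?thesis
    using K(1) L(1) by blast
qed

lemma coord_disjoint:
  assumes "D \<in> D_classes M" "K \<in> R_classes_in M D" "L \<in> L_classes_in M D" "g \<in> carrier (SG D)"
    and "D' \<in> D_classes M" "K' \<in> R_classes_in M D'" "L' \<in> L_classes_in M D'" "g' \<in> carrier (SG D')"
    and "coord D K L g = coord D' K' L' g'"
  shows "D = D'" "K = K'" "L = L'"
proof -
  note mem = coord_mem[OF assms(1-4)] and mem' = coord_mem[OF assms(5-8), folded assms(9)]
  show "D = D'"
    using D_class_eq[OF assms(1) mem(3)] D_class_eq[OF assms(5) mem'(3)] by simp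
  show "K = K'"
    using R_class_eq[OF assms(2) mem(1)] R_class_eq[OF assms(6) mem'(1)] by simp
  show "L = L'"
    using L_class_eq[OF assms(3) mem(2)] L_class_eq[OF assms(7) mem'(2)] by simp
qed

lemma in_strictly_belowI:
  assumes D: "D \<in> D_classes M" and y: "y \<in> gen_ideal (\<gamma> D)" "y \<in> carrier M" "y \<notin> D"
  shows "y \<in> strictly_below D"
proof -
  note D' = D_class_of[OF y(2)]
  have "D_le M (green_D M `` {y}) D"
    using D_le_iff[OF _ D _ base_in[OF D]] D' y(1) by blast
  then show ?thesis
    using D' y(3) unfolding strictly_below_def by blast
qed

lemma D_memI:
  assumes D: "D \<in> D_classes M" and "y \<in> carrier M" "y \<in> gen_ideal (\<gamma> D)" "\<gamma> D \<in> gen_ideal y"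
  shows "y \<in> D"
proof -
  have "(\<gamma> D, y) \<in> green_D M"
    using assms base_in[OF D] D_class_carrier[OF D] by (auto simp: green_D_iff)
  then show ?thesis
    using D_class_eq[OF D base_in[OF D]] by blast
qed

lemma D_memD:
  assumes D: "D \<in> D_classes M" and "x \<in> D" "y \<in> D"
  shows "x \<in> gen_ideal y"
  using D_class_eq[OF D \<open>x \<in> D\<close>] assms(3) by (auto simp: green_D_iff)

text \<open>
  The combinatorial heart of the argument. Whether \<open>m\<close> keeps the row \<open>K\<close> inside \<open>D\<close> can be read off
  from the single element \<open>x = a K \<cdot> \<gamma>\<close>, since the whole row consists of right multiples of \<open>x\<close> that
  generate the same ideal as \<open>x\<close>. If \<open>mx\<close> stays in \<open>D\<close>, stability puts it into the column of \<open>\<gamma>\<close>, so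
  \<open>mx = a K' \<cdot> u(\<gamma>)\<close> for a row \<open>K'\<close> and a group element \<open>u\<close>; by equivariance \<open>m\<close> then acts on every cell
  of the row as left multiplication by \<open>u\<close>. Neither \<open>K'\<close> nor \<open>u\<close> depends on the column.
\<close>

lemma coord_left_mult:
  assumes D: "D \<in> D_classes M" and K: "K \<in> R_classes_in M D" and m: "m \<in> carrier M"
  shows "(\<exists>K'\<in>R_classes_in M D. \<exists>u\<in>carrier (SG D). \<forall>L\<in>L_classes_in M D. \<forall>g\<in>carrier (SG D).
      m \<otimes> coord D K L g = coord D K' L (u \<otimes>\<^bsub>SG D\<^esub> g)) \<or>
    (\<forall>L\<in>L_classes_in M D. \<forall>g\<in>carrier (SG D). m \<otimes> coord D K L g \<in> strictly_below D)"
proof -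
  interpret B: based_monoid M "\<gamma> D"
    using based[OF D] .
  let ?R1 = "green_R M `` {\<gamma> D}" and ?L1 = "green_L M `` {\<gamma> D}"
  note R1 = R_class_of[OF D base_in[OF D]] and L1 = L_class_of[OF D base_in[OF D]]
  define x where "x = a K \<otimes> \<gamma> D"
  have aK: "a K \<in> carrier M"
    using left_translation(1)[OF D K] .
  have xKL: "x \<in> K \<inter> ?L1"
    unfolding x_def using bij_betw_apply[OF left_translation(2)[OF D K L1(1)]] R1(2) L1(2) by blast
  have x: "x \<in> carrier M" "x \<in> D"
    using xKL K D_class_carrier[OF D] by (auto simp: R_classes_in_def)
  show ?thesis
  proof (cases "m \<otimes> x \<in> D")
    case True
    have "(x, m \<otimes> x) \<in> green_L M"
      using green_L_left_stable[OF x(1) m] D_memD[OF D x(2) True] by simp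
    then have mx: "m \<otimes> x \<in> ?L1"
      using xKL equiv_green_L by (meson Image_singleton_iff IntD2 equivE transD)
    obtain K' where K': "K' \<in> R_classes_in M D" "m \<otimes> x \<in> K'"
      using R_class_of[OF D True] by blast
    have aK': "a K' \<in> carrier M"
      using left_translation(1)[OF D K'(1)] .
    have "m \<otimes> x \<in> (\<lambda>h. a K' \<otimes> h) ` B.H"
      using bij_betw_imp_surj_on[OF left_translation(2)[OF D K'(1) L1(1)]] K'(2) mx
      unfolding base_H_class by blast
    then obtain h where h: "h \<in> B.H" "m \<otimes> x = a K' \<otimes> h"
      by blast
    obtain u where u: "u \<in> carrier (SG D)" "h = u (\<gamma> D)"
      using bij_betw_imp_surj_on[OF B.schutz_eval_bij] h(1) by blast
    have "m \<otimes> coord D K L g = coord D K' L (u \<otimes>\<^bsub>SG D\<^esub> g)"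
      if L: "L \<in> L_classes_in M D" and g: "g \<in> carrier (SG D)" for L g
    proof -
      have bL: "b L \<in> carrier M"
        using right_translation(1)[OF D L] .
      have gM: "g (\<gamma> D) \<in> carrier M" "g h \<in> carrier M"
        using B.schutz_elem_closed[OF g] B.base_in_H h(1) B.H_carrier by blast+
      have "(m \<otimes> a K) \<otimes> g (\<gamma> D) = a K' \<otimes> g h"
      proof (rule B.schutz_left_mult_cong[OF g])
        show "(m \<otimes> a K) \<otimes> \<gamma> D = a K' \<otimes> h"
          using h(2) m aK by (simp add: x_def m_assoc)
      qed (use h(1) m aK aK' B.base_in_H in simp_all)
      moreover have "m \<otimes> coord D K L g = (m \<otimes> a K) \<otimes> g (\<gamma> D) \<otimes> b L"
        using m aK bL gM by (simp add: coord_def m_assoc)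
      ultimately show ?thesis
        by (simp add: coord_def B.schutz_mult_apply B.base_in_H u(2))
    qed
    then show ?thesis
      using K'(1) u(1) by blast
  next
    case False
    have "m \<otimes> coord D K L g \<in> strictly_below D"
      if L: "L \<in> L_classes_in M D" and g: "g \<in> carrier (SG D)" for L g
    proof -
      have bL: "b L \<in> carrier M"
        using right_translation(1)[OF D L] .
      obtain w where w: "w \<in> carrier M" "g (\<gamma> D) = \<gamma> D \<otimes> w"
        using B.schutz_elem_closed[OF g B.base_in_H] B.H_right_multiple by blast
      let ?y = "m \<otimes> coord D K L g"
      have y: "?y = (m \<otimes> x) \<otimes> (w \<otimes> b L)" "?y = (m \<otimes> a K) \<otimes> \<gamma> D \<otimes> (w \<otimes> b L)"
        using m aK bL w by (simp_all add: coord_def x_def m_assoc)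
      have "?y \<in> gen_ideal (m \<otimes> x)"
        unfolding y(1) using m x(1) w(1) bL by (intro gen_ideal_rightI) simp_all
      have yM: "?y \<in> carrier M"
        using coord_mem(4)[OF D K L g] m by simp
      have "?y \<in> gen_ideal (\<gamma> D)"
        unfolding y(2) using m aK w(1) bL by (intro gen_idealI) simp_all
      moreover have "?y \<notin> D"
      proof
        assume "?y \<in> D"
        then have "\<gamma> D \<in> gen_ideal (m \<otimes> x)"
          using D_memD[OF D base_in[OF D]] \<open>?y \<in> gen_ideal (m \<otimes> x)\<close> m x(1)
          by (meson m_closed gen_ideal_trans)
        moreover have "m \<otimes> x \<in> gen_ideal (\<gamma> D)"
          unfolding x_def using m aK by (simp add: m_assoc[symmetric] gen_ideal_leftI)
        ultimately show False
          using D_memI[OF D] m x(1) False by simp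
      qed
      ultimately show ?thesis
        using in_strictly_belowI[OF D _ yM] by simp
    qed
    then show ?thesis
      by blast
  qed
qed

text \<open>
  The mirror image of \<open>coord_left_mult\<close>. It needs its own computation because the Schutzenberger
  group consists of right translations: here \<open>u\<close> enters through its action on \<open>H\<close>, and the passage
  from \<open>\<gamma>\<close> to the other elements of \<open>H\<close> is by left multiplication.
\<close>

lemma coord_right_mult:
  assumes D: "D \<in> D_classes M" and L: "L \<in> L_classes_in M D" and m: "m \<in> carrier M"
  shows "(\<exists>L'\<in>L_classes_in M D. \<exists>u\<in>carrier (SG D). \<forall>K\<in>R_classes_in M D. \<forall>g\<in>carrier (SG D).
      coord D K L g \<otimes> m = coord D K L' (g \<otimes>\<^bsub>SG D\<^esub> u)) \<or>
    (\<forall>K\<in>R_classes_in M D. \<forall>g\<in>carrier (SG D). coord D K L g \<otimes> m \<in> strictly_below D)"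
proof -
  interpret B: based_monoid M "\<gamma> D"
    using based[OF D] .
  let ?R1 = "green_R M `` {\<gamma> D}" and ?L1 = "green_L M `` {\<gamma> D}"
  note R1 = R_class_of[OF D base_in[OF D]] and L1 = L_class_of[OF D base_in[OF D]]
  define x where "x = \<gamma> D \<otimes> b L"
  have bL: "b L \<in> carrier M"
    using right_translation(1)[OF D L] .
  have xKL: "x \<in> ?R1 \<inter> L"
    unfolding x_def using bij_betw_apply[OF right_translation(2)[OF D L R1(1)]] R1(2) L1(2) by blast
  have x: "x \<in> carrier M" "x \<in> D"
    using xKL L D_class_carrier[OF D] by (auto simp: L_classes_in_def)
  show ?thesis
  proof (cases "x \<otimes> m \<in> D")
    case True
    have "(x, x \<otimes> m) \<in> green_R M"
      using green_R_right_stable[OF x(1) m] D_memD[OF D x(2) True] by simp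
    then have xm: "x \<otimes> m \<in> ?R1"
      using xKL equiv_green_R by (meson Image_singleton_iff IntD1 equivE transD)
    obtain L' where L': "L' \<in> L_classes_in M D" "x \<otimes> m \<in> L'"
      using L_class_of[OF D True] by blast
    have bL': "b L' \<in> carrier M"
      using right_translation(1)[OF D L'(1)] .
    have "x \<otimes> m \<in> (\<lambda>h. h \<otimes> b L') ` B.H"
      using bij_betw_imp_surj_on[OF right_translation(2)[OF D L'(1) R1(1)]] L'(2) xm
      unfolding base_H_class by blast
    then obtain h where h: "h \<in> B.H" "x \<otimes> m = h \<otimes> b L'"
      by blast
    obtain u where u: "u \<in> carrier (SG D)" "h = u (\<gamma> D)"
      using bij_betw_imp_surj_on[OF B.schutz_eval_bij] h(1) by blast
    obtain w where w: "w \<in> carrier M" "u = right_transl M B.H w" "\<And>k. k \<in> B.H \<Longrightarrow> u k = k \<otimes> w"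
      using B.schutz_elem_translation[OF u(1)] by blast
    have "coord D K L g \<otimes> m = coord D K L' (g \<otimes>\<^bsub>SG D\<^esub> u)"
      if K: "K \<in> R_classes_in M D" and g: "g \<in> carrier (SG D)" for K g
    proof -
      have aK: "a K \<in> carrier M"
        using left_translation(1)[OF D K] .
      have gH: "g (\<gamma> D) \<in> B.H"
        using B.schutz_elem_closed[OF g B.base_in_H] .
      then have gM: "g (\<gamma> D) \<in> carrier M"
        by (rule B.H_carrier)
      have "\<gamma> D \<otimes> (b L \<otimes> m) = \<gamma> D \<otimes> (w \<otimes> b L')"
        using h(2) u(2) w(3)[OF B.base_in_H] x_def m bL bL' w(1) by (simp add: m_assoc)
      then have "g (\<gamma> D) \<otimes> (b L \<otimes> m) = g (\<gamma> D) \<otimes> (w \<otimes> b L')"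
        using m bL bL' w(1) by (intro B.H_right_mult_cong[OF gH]) simp_all
      moreover have "coord D K L g \<otimes> m = a K \<otimes> (g (\<gamma> D) \<otimes> (b L \<otimes> m))"
        using m aK bL gM by (simp add: coord_def m_assoc)
      moreover have "coord D K L' (g \<otimes>\<^bsub>SG D\<^esub> u) = a K \<otimes> (g (\<gamma> D) \<otimes> (w \<otimes> b L'))"
        using aK bL' gM w(1)
        by (simp add: coord_def B.schutz_mult_apply B.base_in_H w(3)[OF gH] m_assoc)
      ultimately show ?thesis
        by simp
    qed
    then show ?thesis
      using L'(1) u(1) by blast
  next
    case False
    have "coord D K L g \<otimes> m \<in> strictly_below D"
      if K: "K \<in> R_classes_in M D" and g: "g \<in> carrier (SG D)" for K g
    proof -
      have aK: "a K \<in> carrier M"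
        using left_translation(1)[OF D K] .
      obtain w where w: "w \<in> carrier M" "g (\<gamma> D) = w \<otimes> \<gamma> D"
        using B.schutz_elem_closed[OF g B.base_in_H] B.H_left_multiple by blast
      let ?y = "coord D K L g \<otimes> m"
      have y: "?y = (a K \<otimes> w) \<otimes> (x \<otimes> m)" "?y = (a K \<otimes> w) \<otimes> \<gamma> D \<otimes> (b L \<otimes> m)"
        using m aK bL w by (simp_all add: coord_def x_def m_assoc)
      have "?y \<in> gen_ideal (x \<otimes> m)"
        unfolding y(1) using m x(1) w(1) aK by (intro gen_ideal_leftI) simp_all
      have yM: "?y \<in> carrier M"
        using coord_mem(4)[OF D K L g] m by simp
      have "?y \<in> gen_ideal (\<gamma> D)"
        unfolding y(2) using m aK w(1) bL by (intro gen_idealI) simp_all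
      moreover have "?y \<notin> D"
      proof
        assume "?y \<in> D"
        then have "\<gamma> D \<in> gen_ideal (x \<otimes> m)"
          using D_memD[OF D base_in[OF D]] \<open>?y \<in> gen_ideal (x \<otimes> m)\<close> m x(1)
          by (meson m_closed gen_ideal_trans)
        moreover have "x \<otimes> m \<in> gen_ideal (\<gamma> D)"
          unfolding x_def using m bL by (simp add: m_assoc gen_ideal_rightI)
        ultimately show False
          using D_memI[OF D] m x(1) False by simp
      qed
      ultimately show ?thesis
        using in_strictly_belowI[OF D _ yM] by simp
    qed
    then show ?thesis
      by blast
  qed
qed

end

section \<open>Copies of the group algebras\<close>

context cell_structure
begin

lemma elem_closed:
  "\<lbrakk>\<nu> \<in> cell_poset cd; s \<in> cell_left cd \<nu>; t \<in> cell_right cd \<nu>\<rbrakk> \<Longrightarrow> cell_elem cd \<nu> s t \<in> carrier A"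
  using basis by (force simp: free_basis_def cell_basis_def cell_index_def)

lemma finite_index: "finite (cell_index cd)"
  unfolding cell_index_def using finite_poset finite_left finite_right by blast

lemma indep_elems: "indep_family R A (\<lambda>(\<nu>, s, t). cell_elem cd \<nu> s t) (cell_index cd)"
  using basis finite_index inj_elem
  by (intro indep_family_if_lin_indep) (auto simp: free_basis_def cell_basis_def)

end

locale cell_monoid = domain R + eggbox M \<gamma> a a' b b'
  for R :: "('r, 'x) ring_scheme" (structure) and M :: "('m, 'y) monoid_scheme" and \<gamma> a a' b b' +
  fixes cd :: "'m set \<Rightarrow> ('l, 'i, 'j, ('m \<Rightarrow> 'm) \<Rightarrow> 'r) cell_datum"
  assumes cells: "D \<in> D_classes M \<Longrightarrow> cell_structure R (monoid_algebra R (SG D)) (cd D)"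
begin

sublocale finite_monoid_algebra R M
  by unfold_locales

abbreviation "RG D \<equiv> monoid_algebra R (SG D)"
abbreviation "std \<equiv> standard_cell_datum R M \<gamma> a b cd"

lemma SG_algebra: "D \<in> D_classes M \<Longrightarrow> finite_monoid_algebra R (SG D)"
  unfolding finite_monoid_algebra_def
  using based_monoid.schutz_group_monoid[OF based] is_cring by simp

lemma RG_module: "D \<in> D_classes M \<Longrightarrow> module R (RG D)"
  by (rule finite_monoid_algebra.algebra_module[OF SG_algebra])

text \<open>
  The linear extension of \<open>coord\<close>. As \<open>coord\<close> is injective, it carries a function on the group to
  the same function on the cell \<open>K \<inter> L\<close>, extended by zero to \<open>M\<close>; \<open>restr\<close> reads off the values on that
  cell.
\<close>

definition embed :: "'m set \<Rightarrow> 'm set \<Rightarrow> 'm set \<Rightarrow> (('m \<Rightarrow> 'm) \<Rightarrow> 'r) \<Rightarrow> 'm \<Rightarrow> 'r"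
  where "embed D K L = lin_ext (SG D) RM (\<lambda>g. \<delta> (coord D K L g))"

definition restr :: "'m set \<Rightarrow> 'm set \<Rightarrow> 'm set \<Rightarrow> ('m \<Rightarrow> 'r) \<Rightarrow> ('m \<Rightarrow> 'm) \<Rightarrow> 'r"
  where "restr D K L f = (\<lambda>g\<in>carrier (SG D). f (coord D K L g))"

lemma embed_linear: "D \<in> D_classes M \<Longrightarrow> linear_map R (RG D) RM (embed D K L)"
  unfolding embed_def
  by (intro finite_monoid_algebra.linear_map_lin_ext[OF SG_algebra algebra_module]) (auto simp: algebra_closed)

lemma embed_delta:
  "\<lbrakk>D \<in> D_classes M; g \<in> carrier (SG D)\<rbrakk> \<Longrightarrow> embed D K L (monoid_elem R (SG D) g) = \<delta> (coord D K L g)"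
  unfolding embed_def
  by (intro finite_monoid_algebra.lin_ext_delta[OF SG_algebra algebra_module]) (auto simp: algebra_closed)

lemma linear_map_embed:
  assumes "D \<in> D_classes M" "linear_map R RM RM F" "f \<in> carrier (RG D)"
  shows "F (embed D K L f) = lin_ext (SG D) RM (\<lambda>g. F (\<delta> (coord D K L g))) f"
  unfolding embed_def using assms(3)
  by (intro finite_monoid_algebra.linear_map_of_lin_ext[OF SG_algebra[OF assms(1)] algebra_module algebra_module assms(2)])
    (auto simp: algebra_closed)

lemma restr_linear:
  assumes D: "D \<in> D_classes M" "K \<in> R_classes_in M D" "L \<in> L_classes_in M D"
  shows "linear_map R RM (RG D) (restr D K L)"
proof -
  interpret G: finite_monoid_algebra R "SG D"
    using SG_algebra[OF D(1)] .
  note [simp] = coord_mem(4)[OF D]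
  show ?thesis
  proof (rule linear_mapI)
    fix f assume f: "f \<in> carrier RM"
    show mem: "restr D K L f \<in> carrier (RG D)" if "f \<in> carrier RM" for f
      using that by (auto simp: restr_def G.algebra_apply(1) coeff_closed)
    show "restr D K L (f \<oplus>\<^bsub>RM\<^esub> g) = restr D K L f \<oplus>\<^bsub>RG D\<^esub> restr D K L g" if "g \<in> carrier RM" for g
      using f that mem
      by (intro G.algebra_eqI) (simp_all add: G.algebra_closed algebra_closed, simp add: restr_def G.algebra_apply(3) algebra_apply(3))
    show "restr D K L (c \<odot>\<^bsub>RM\<^esub> f) = c \<odot>\<^bsub>RG D\<^esub> restr D K L f" if "c \<in> carrier R" for c
      using f that mem
      by (intro G.algebra_eqI) (simp_all add: G.algebra_closed algebra_closed, simp add: restr_def G.algebra_apply(4) algebra_apply(4))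
  qed
qed

lemma restr_embed_same:
  assumes D: "D \<in> D_classes M" "K \<in> R_classes_in M D" "L \<in> L_classes_in M D" and f: "f \<in> carrier (RG D)"
  shows "restr D K L (embed D K L f) = f"
proof -
  interpret G: finite_monoid_algebra R "SG D"
    using SG_algebra[OF D(1)] .
  show ?thesis
  proof (rule G.linear_map_eqI[where f = f, OF RG_module[OF D(1)] _ linear_map_id _ f])
    show "linear_map R (RG D) (RG D) (\<lambda>f. restr D K L (embed D K L f))"
      by (rule linear_map_compose[OF embed_linear[OF D(1)] restr_linear[OF D]])
    fix g assume g: "g \<in> carrier (SG D)"
    have "coord D K L h = coord D K L g \<longleftrightarrow> h = g" if "h \<in> carrier (SG D)" for h
      using coord_bij[OF D] g that by (auto simp: bij_betw_def inj_on_eq_iff)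
    then show "restr D K L (embed D K L (monoid_elem R (SG D) g)) = monoid_elem R (SG D) g"
      unfolding embed_delta[OF D(1) g] using D
      by (auto simp: restr_def monoid_elem_def coord_mem(4))
  qed
qed

lemma restr_embed_other:
  assumes D: "D \<in> D_classes M" "K \<in> R_classes_in M D" "L \<in> L_classes_in M D"
    and D': "D' \<in> D_classes M" "K' \<in> R_classes_in M D'" "L' \<in> L_classes_in M D'"
    and f: "f \<in> carrier (RG D')" and ne: "(D, K, L) \<noteq> (D', K', L')"
  shows "restr D K L (embed D' K' L' f) = \<zero>\<^bsub>RG D\<^esub>"
proof -
  interpret G: finite_monoid_algebra R "SG D'"
    using SG_algebra[OF D'(1)] .
  show ?thesis
  proof (rule G.linear_map_eqI[where f = f, OF RG_module[OF D(1)] _ linear_map_zero_map _ f])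
    show "linear_map R (RG D') (RG D) (\<lambda>f. restr D K L (embed D' K' L' f))"
      by (rule linear_map_compose[OF embed_linear[OF D'(1)] restr_linear[OF D]])
    fix g assume g: "g \<in> carrier (SG D')"
    have "coord D K L h \<noteq> coord D' K' L' g" if "h \<in> carrier (SG D)" for h
      using coord_disjoint[OF D that D' g] ne by blast
    then show "restr D K L (embed D' K' L' (monoid_elem R (SG D') g)) = \<zero>\<^bsub>RG D\<^esub>"
      unfolding embed_delta[OF D'(1) g] using D
      by (auto simp: restr_def monoid_elem_def coord_mem(4) monoid_algebra_def)
  qed (use D(1) D'(1) RG_module in auto)
qed

lemma std_simps [simp]:
  "cell_poset std = standard_poset M cd"
  "cell_le std = standard_le M cd"
  "cell_left std (D, \<nu>) = R_classes_in M D \<times> cell_left (cd D) \<nu>"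
  "cell_right std (D, \<nu>) = L_classes_in M D \<times> cell_right (cd D) \<nu>"
  by (simp_all add: standard_cell_datum_def)

lemma poset_iff: "(D, \<nu>) \<in> standard_poset M cd \<longleftrightarrow> D \<in> D_classes M \<and> \<nu> \<in> cell_poset (cd D)"
  by (simp add: standard_poset_def)

text \<open>
  The map \<open>\<phi>\<close> and the multiplications by \<open>a\<^sub>i\<close> and \<open>b\<^sub>j\<close> are linear, so their composition is the linear
  extension of \<open>coord\<close>. Hence a standard cell basis element is the copy, in one cell of an egg-box, of
  a cell basis element of a group algebra.
\<close>

lemma std_elem:
  assumes D: "D \<in> D_classes M" and K: "K \<in> R_classes_in M D" and L: "L \<in> L_classes_in M D"
    and idx: "\<nu> \<in> cell_poset (cd D)" "s \<in> cell_left (cd D) \<nu>" "t \<in> cell_right (cd D) \<nu>"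
  shows "cell_elem std (D, \<nu>) (K, s) (L, t) = embed D K L (cell_elem (cd D) \<nu> s t)"
proof -
  let ?C = "cell_elem (cd D) \<nu> s t"
  interpret G: finite_monoid_algebra R "SG D"
    using SG_algebra[OF D] .
  interpret B: based_monoid M "\<gamma> D"
    using based[OF D] .
  have C: "?C \<in> carrier (RG D)"
    using cell_structure.elem_closed[OF cells[OF D] idx] .
  have aK: "a K \<in> carrier M" and bL: "b L \<in> carrier M"
    using left_translation(1)[OF D K] right_translation(1)[OF D L] .
  have gM: "g (\<gamma> D) \<in> carrier M" if "g \<in> carrier (SG D)" for g
    using B.H_carrier[OF B.schutz_elem_closed[OF that B.base_in_H]] .
  have lin: "linear_map R RM RM (\<lambda>x. \<delta> (a K) \<otimes>\<^bsub>RM\<^esub> x \<otimes>\<^bsub>RM\<^esub> \<delta> (b L))"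
    by (rule linear_map_compose[OF linear_map_mult_left linear_map_mult_right]) (rule algebra_closed)+
  have "cell_elem std (D, \<nu>) (K, s) (L, t)
      = \<delta> (a K) \<otimes>\<^bsub>RM\<^esub> lin_ext (SG D) RM (\<lambda>g. \<delta> (g (\<gamma> D))) ?C \<otimes>\<^bsub>RM\<^esub> \<delta> (b L)"
    by (simp add: standard_cell_datum_def schutz_phi_def lin_ext_def)
  also have "\<dots> = lin_ext (SG D) RM (\<lambda>g. \<delta> (a K) \<otimes>\<^bsub>RM\<^esub> \<delta> (g (\<gamma> D)) \<otimes>\<^bsub>RM\<^esub> \<delta> (b L)) ?C"
    using C by (intro G.linear_map_of_lin_ext[OF algebra_module algebra_module lin]) (auto simp: algebra_closed)
  also have "\<dots> = embed D K L ?C"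
    unfolding embed_def using C aK bL gM
    by (intro G.lin_ext_cong[OF algebra_module]) (auto simp: delta_mult coord_def algebra_closed)
  finally show ?thesis .
qed

lemma std_elem_closed:
  assumes "p \<in> cell_poset std" "s \<in> cell_left std p" "t \<in> cell_right std p"
  shows "cell_elem std p s t \<in> carrier RM"
proof -
  obtain D \<nu> K s' L t' where p: "p = (D, \<nu>)" "s = (K, s')" "t = (L, t')"
    by (metis surj_pair)
  then have D: "D \<in> D_classes M" "K \<in> R_classes_in M D" "L \<in> L_classes_in M D"
    and idx: "\<nu> \<in> cell_poset (cd D)" "s' \<in> cell_left (cd D) \<nu>" "t' \<in> cell_right (cd D) \<nu>"
    using assms by (auto simp: poset_iff)
  show ?thesis
    unfolding p std_elem[OF D idx]
    by (rule linear_mapD(1)[OF embed_linear[OF D(1)] cell_structure.elem_closed[OF cells[OF D(1)] idx]])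
qed

lemma hat_submodule: "submodule (cell_hat R RM std p) R RM"
  unfolding cell_hat_def by (rule RM.lin_span_submodule) (auto intro: std_elem_closed simp del: std_simps)

lemma hat_memI:
  assumes "q \<in> cell_poset std" "(p, q) \<in> cell_le std" "p \<noteq> q"
    and "s \<in> cell_left std q" "t \<in> cell_right std q"
  shows "cell_elem std q s t \<in> cell_hat R RM std p"
  unfolding cell_hat_def
  by (rule RM.lin_span_base) (use assms std_elem_closed in blast)+

text \<open>
  The standard cell basis elements belonging to \<open>D\<close> span the elements of \<open>D\<close>. This is used both for
  the span of the whole basis and for the submodules \<open>cell_hat\<close>.
\<close>

lemma delta_in_submodule:
  assumes N: "submodule N R RM" and D: "D \<in> D_classes M" and x: "x \<in> D"
    and mem: "\<And>\<nu> K s L t. \<lbrakk>\<nu> \<in> cell_poset (cd D); K \<in> R_classes_in M D; s \<in> cell_left (cd D) \<nu>;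
      L \<in> L_classes_in M D; t \<in> cell_right (cd D) \<nu>\<rbrakk> \<Longrightarrow> cell_elem std (D, \<nu>) (K, s) (L, t) \<in> N"
  shows "\<delta> x \<in> N"
proof -
  interpret G: finite_monoid_algebra R "SG D"
    using SG_algebra[OF D] .
  interpret cell_structure R "RG D" "cd D"
    using cells[OF D] .
  obtain K L g where K: "K \<in> R_classes_in M D" and L: "L \<in> L_classes_in M D"
    and g: "g \<in> carrier (SG D)" "x = coord D K L g"
    using coord_surj[OF D x] by blast
  have sub: "cell_basis (cd D) \<subseteq> carrier (RG D)" and span: "lin_span R (RG D) (cell_basis (cd D)) = carrier (RG D)"
    using basis by (simp_all add: free_basis_def)
  have "embed D K L (monoid_elem R (SG D) g) \<in> N"
  proof (rule linear_map_lin_span[OF RG_module[OF D] algebra_module embed_linear[OF D] N sub])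
    show "embed D K L ` cell_basis (cd D) \<subseteq> N"
      using mem[OF _ K _ L] std_elem[OF D K L] by (auto simp: cell_basis_def cell_index_def)
    show "monoid_elem R (SG D) g \<in> lin_span R (RG D) (cell_basis (cd D))"
      unfolding span by (rule G.algebra_closed)
  qed
  then show ?thesis
    using embed_delta[OF D g(1)] g(2) by simp
qed

text \<open>
  Lower \<open>\<D>\<close>-classes come later in the poset, and the standard cell basis elements belonging to a
  \<open>\<D>\<close>-class span all of its elements.
\<close>

lemma strictly_below_in_hat:
  assumes D: "D \<in> D_classes M" "\<nu> \<in> cell_poset (cd D)" and y: "y \<in> strictly_below D"
  shows "\<delta> y \<in> cell_hat R RM std (D, \<nu>)"
proof -
  obtain D' where D': "D' \<in> D_classes M" "D_le M D' D" "D' \<noteq> D" "y \<in> D'"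
    using y by (auto simp: strictly_below_def)
  show ?thesis
  proof (rule delta_in_submodule[OF hat_submodule D'(1,4)])
    fix \<mu> K s L t
    assume "\<mu> \<in> cell_poset (cd D')" "K \<in> R_classes_in M D'" "s \<in> cell_left (cd D') \<mu>"
      "L \<in> L_classes_in M D'" "t \<in> cell_right (cd D') \<mu>"
    then show "cell_elem std (D', \<mu>) (K, s) (L, t) \<in> cell_hat R RM std (D, \<nu>)"
      using D D' by (intro hat_memI) (auto simp: poset_iff standard_le_def)
  qed
qed

lemma embed_hat:
  assumes D: "D \<in> D_classes M" "\<nu> \<in> cell_poset (cd D)"
    and K: "K \<in> R_classes_in M D" and L: "L \<in> L_classes_in M D"
    and f: "f \<in> cell_hat R (RG D) (cd D) \<nu>"
  shows "embed D K L f \<in> cell_hat R RM std (D, \<nu>)"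
proof (rule linear_map_lin_span[OF RG_module[OF D(1)] algebra_module embed_linear[OF D(1)] hat_submodule
      _ _ f[unfolded cell_hat_def]])
  interpret cell_structure R "RG D" "cd D"
    using cells[OF D(1)] .
  let ?S = "{cell_elem (cd D) \<mu> s t |\<mu> s t. \<mu> \<in> cell_poset (cd D) \<and> (\<nu>, \<mu>) \<in> cell_le (cd D) \<and> \<nu> \<noteq> \<mu> \<and>
       s \<in> cell_left (cd D) \<mu> \<and> t \<in> cell_right (cd D) \<mu>}"
  show "?S \<subseteq> carrier (RG D)"
    using elem_closed by blast
  have "embed D K L (cell_elem (cd D) \<mu> s t) \<in> cell_hat R RM std (D, \<nu>)"
    if "\<mu> \<in> cell_poset (cd D)" "(\<nu>, \<mu>) \<in> cell_le (cd D)" "\<nu> \<noteq> \<mu>"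
      "s \<in> cell_left (cd D) \<mu>" "t \<in> cell_right (cd D) \<mu>" for \<mu> s t
    unfolding std_elem[OF D(1) K L that(1,4,5), symmetric]
    using D K L that by (intro hat_memI) (auto simp: poset_iff standard_le_def)
  then show "embed D K L ` ?S \<subseteq> cell_hat R RM std (D, \<nu>)"
    by blast
qed

end

section \<open>Multiplication of standard cell basis elements\<close>

context cell_monoid
begin

lemma embed_congruence:
  assumes D: "D \<in> D_classes M" "\<nu> \<in> cell_poset (cd D)"
    and K: "K \<in> R_classes_in M D" and L: "L \<in> L_classes_in M D"
    and r: "r \<in> J \<rightarrow> carrier R" and c: "c \<in> J \<rightarrow> carrier (RG D)" and f: "f \<in> carrier (RG D)"
    and cong: "f \<ominus>\<^bsub>RG D\<^esub> (\<Oplus>\<^bsub>RG D\<^esub>j\<in>J. r j \<odot>\<^bsub>RG D\<^esub> c j) \<in> cell_hat R (RG D) (cd D) \<nu>"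
  shows "embed D K L f \<ominus>\<^bsub>RM\<^esub> (\<Oplus>\<^bsub>RM\<^esub>j\<in>J. r j \<odot>\<^bsub>RM\<^esub> embed D K L (c j)) \<in> cell_hat R RM std (D, \<nu>)"
proof -
  interpret G: module R "RG D"
    using RG_module[OF D(1)] .
  note E = embed_linear[OF D(1), of K L]
  have "(\<Oplus>\<^bsub>RG D\<^esub>j\<in>J. r j \<odot>\<^bsub>RG D\<^esub> c j) \<in> carrier (RG D)"
    using r c by (intro G.M.finsum_closed) auto
  then have "embed D K L (f \<ominus>\<^bsub>RG D\<^esub> (\<Oplus>\<^bsub>RG D\<^esub>j\<in>J. r j \<odot>\<^bsub>RG D\<^esub> c j))
      = embed D K L f \<ominus>\<^bsub>RM\<^esub> (\<Oplus>\<^bsub>RM\<^esub>j\<in>J. r j \<odot>\<^bsub>RM\<^esub> embed D K L (c j))"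
    by (simp add: linear_map_minus[OF RG_module[OF D(1)] algebra_module E f]
        linear_map_finsum[OF RG_module[OF D(1)] algebra_module E r c])
  then show ?thesis
    using embed_hat[OF D K L cong] by simp
qed

lemma lin_ext_in_submodule:
  assumes "D \<in> D_classes M" "submodule N R RM" "f \<in> carrier (RG D)" "v \<in> carrier (SG D) \<rightarrow> N"
  shows "lin_ext (SG D) RM v f \<in> N"
  unfolding lin_ext_def
  using finite_monoid_algebra.coeff_closed[OF SG_algebra[OF assms(1)] assms(3)] assms(4)
  by (intro RM.submodule_finsum[OF assms(2)]) auto

lemma embed_mult_left:
  assumes D: "D \<in> D_classes M" and m: "m \<in> carrier M" and u: "u \<in> carrier (SG D)" and f: "f \<in> carrier (RG D)"
    and eq: "\<And>g. g \<in> carrier (SG D) \<Longrightarrow> m \<otimes>\<^bsub>M\<^esub> coord D K L g = coord D K' L' (u \<otimes>\<^bsub>SG D\<^esub> g)"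
    and K: "K \<in> R_classes_in M D" and L: "L \<in> L_classes_in M D"
  shows "\<delta> m \<otimes>\<^bsub>RM\<^esub> embed D K L f = embed D K' L' (monoid_elem R (SG D) u \<otimes>\<^bsub>RG D\<^esub> f)"
proof -
  interpret G: finite_monoid_algebra R "SG D"
    using SG_algebra[OF D] .
  have u': "monoid_elem R (SG D) u \<in> carrier (RG D)"
    by (rule G.algebra_closed)
  show ?thesis
  proof (rule G.linear_map_eqI[where f = f, OF algebra_module])
    show "linear_map R (RG D) RM (\<lambda>f. \<delta> m \<otimes>\<^bsub>RM\<^esub> embed D K L f)"
      by (rule linear_map_compose[OF embed_linear[OF D] linear_map_mult_left]) (rule algebra_closed)
    show "linear_map R (RG D) RM (\<lambda>f. embed D K' L' (monoid_elem R (SG D) u \<otimes>\<^bsub>RG D\<^esub> f))"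
      by (rule linear_map_compose[OF G.linear_map_mult_left[OF u'] embed_linear[OF D]])
  qed (use assms in \<open>simp_all add: embed_delta G.delta_mult delta_mult coord_mem(4)\<close>)
qed

lemma embed_mult_right:
  assumes D: "D \<in> D_classes M" and m: "m \<in> carrier M" and u: "u \<in> carrier (SG D)" and f: "f \<in> carrier (RG D)"
    and eq: "\<And>g. g \<in> carrier (SG D) \<Longrightarrow> coord D K L g \<otimes>\<^bsub>M\<^esub> m = coord D K' L' (g \<otimes>\<^bsub>SG D\<^esub> u)"
    and K: "K \<in> R_classes_in M D" and L: "L \<in> L_classes_in M D"
  shows "embed D K L f \<otimes>\<^bsub>RM\<^esub> \<delta> m = embed D K' L' (f \<otimes>\<^bsub>RG D\<^esub> monoid_elem R (SG D) u)"
proof -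
  interpret G: finite_monoid_algebra R "SG D"
    using SG_algebra[OF D] .
  have u': "monoid_elem R (SG D) u \<in> carrier (RG D)"
    by (rule G.algebra_closed)
  show ?thesis
  proof (rule G.linear_map_eqI[where f = f, OF algebra_module])
    show "linear_map R (RG D) RM (\<lambda>f. embed D K L f \<otimes>\<^bsub>RM\<^esub> \<delta> m)"
      by (rule linear_map_compose[OF embed_linear[OF D] linear_map_mult_right]) (rule algebra_closed)
    show "linear_map R (RG D) RM (\<lambda>f. embed D K' L' (f \<otimes>\<^bsub>RG D\<^esub> monoid_elem R (SG D) u))"
      by (rule linear_map_compose[OF G.linear_map_mult_right[OF u'] embed_linear[OF D]])
  qed (use assms in \<open>simp_all add: embed_delta G.delta_mult delta_mult coord_mem(4)\<close>)
qed

lemma hat_minus_zero_sum: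
  assumes x: "x \<in> cell_hat R RM std p" and e: "\<And>j. j \<in> J \<Longrightarrow> e j \<in> carrier RM"
  shows "x \<ominus>\<^bsub>RM\<^esub> (\<Oplus>\<^bsub>RM\<^esub>j\<in>J. \<zero> \<odot>\<^bsub>RM\<^esub> e j) \<in> cell_hat R RM std p"
proof -
  have sum: "(\<Oplus>\<^bsub>RM\<^esub>j\<in>J. \<zero> \<odot>\<^bsub>RM\<^esub> e j) = \<zero>\<^bsub>RM\<^esub>"
    using e by (intro RM.M.add.finprod_one_eqI) simp
  have zero: "\<ominus>\<^bsub>RM\<^esub> \<zero>\<^bsub>RM\<^esub> = \<zero>\<^bsub>RM\<^esub>"
    by (rule RM.M.minus_equality) simp_all
  have "x \<oplus>\<^bsub>RM\<^esub> \<zero>\<^bsub>RM\<^esub> = x"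
    using x RM.submoduleE(1)[OF hat_submodule] by (intro RM.M.r_zero) blast
  then show ?thesis
    using x unfolding sum a_minus_def zero by metis
qed

text \<open>
  Multiplication by \<open>m\<close> either sends the whole row \<open>K\<close> strictly below \<open>D\<close>, and then all
  coefficients are zero, or it acts on the row as a group element \<open>u\<close>. In the latter case
  the coefficients are those of \<open>u\<close> in \<open>R[G\<^sub>D]\<close>, placed in the row \<open>K'\<close>; they do not depend on the
  column because neither \<open>u\<close> nor \<open>K'\<close> does.
\<close>

lemma left_mult_delta:
  assumes D: "D \<in> D_classes M" "\<nu> \<in> cell_poset (cd D)"
    and K: "K \<in> R_classes_in M D" and s: "s \<in> cell_left (cd D) \<nu>" and m: "m \<in> carrier M"
  shows "\<exists>r\<in>cell_left std (D, \<nu>) \<rightarrow> carrier R. \<forall>q\<in>cell_right std (D, \<nu>).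
    \<delta> m \<otimes>\<^bsub>RM\<^esub> cell_elem std (D, \<nu>) (K, s) q
      \<ominus>\<^bsub>RM\<^esub> (\<Oplus>\<^bsub>RM\<^esub>p\<in>cell_left std (D, \<nu>). r p \<odot>\<^bsub>RM\<^esub> cell_elem std (D, \<nu>) p q)
    \<in> cell_hat R RM std (D, \<nu>)"
proof -
  interpret G: finite_monoid_algebra R "SG D"
    using SG_algebra[OF D(1)] .
  interpret C: cell_structure R "RG D" "cd D"
    using cells[OF D(1)] .
  have poset: "(D, \<nu>) \<in> cell_poset std"
    using D by (simp add: poset_iff)
  let ?C = "cell_elem (cd D) \<nu>"
  from coord_left_mult[OF D(1) K m] show ?thesis
  proof (elim disjE bexE)
    fix K' u
    assume K': "K' \<in> R_classes_in M D" and u: "u \<in> carrier (SG D)"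
      and eq: "\<forall>L\<in>L_classes_in M D. \<forall>g\<in>carrier (SG D).
        m \<otimes>\<^bsub>M\<^esub> coord D K L g = coord D K' L (u \<otimes>\<^bsub>SG D\<^esub> g)"
    have u': "monoid_elem R (SG D) u \<in> carrier (RG D)"
      by (rule G.algebra_closed)
    obtain r where r: "r \<in> cell_left (cd D) \<nu> \<rightarrow> carrier R"
      and cong: "\<And>t. t \<in> cell_right (cd D) \<nu> \<Longrightarrow>
        monoid_elem R (SG D) u \<otimes>\<^bsub>RG D\<^esub> ?C s t
          \<ominus>\<^bsub>RG D\<^esub> (\<Oplus>\<^bsub>RG D\<^esub>s'\<in>cell_left (cd D) \<nu>. r s' \<odot>\<^bsub>RG D\<^esub> ?C s' t)
        \<in> cell_hat R (RG D) (cd D) \<nu>"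
      using C.left_mult[OF u' D(2) s] by blast
    let ?r = "\<lambda>p. if fst p = K' then r (snd p) else \<zero>"
    have "\<delta> m \<otimes>\<^bsub>RM\<^esub> cell_elem std (D, \<nu>) (K, s) (L, t)
        \<ominus>\<^bsub>RM\<^esub> (\<Oplus>\<^bsub>RM\<^esub>p\<in>R_classes_in M D \<times> cell_left (cd D) \<nu>. ?r p \<odot>\<^bsub>RM\<^esub> cell_elem std (D, \<nu>) p (L, t))
      \<in> cell_hat R RM std (D, \<nu>)"
      if L: "L \<in> L_classes_in M D" and t: "t \<in> cell_right (cd D) \<nu>" for L t
    proof -
      have "(\<Oplus>\<^bsub>RM\<^esub>p\<in>R_classes_in M D \<times> cell_left (cd D) \<nu>. ?r p \<odot>\<^bsub>RM\<^esub> cell_elem std (D, \<nu>) p (L, t))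
          = (\<Oplus>\<^bsub>RM\<^esub>s'\<in>cell_left (cd D) \<nu>. r s' \<odot>\<^bsub>RM\<^esub> cell_elem std (D, \<nu>) (K', s') (L, t))"
        using finite_R_classes_in C.finite_left[OF D(2)] K' r L t
        by (intro RM.finsum_single_block std_elem_closed[OF poset]) simp_all
      also have "\<dots> = (\<Oplus>\<^bsub>RM\<^esub>s'\<in>cell_left (cd D) \<nu>. r s' \<odot>\<^bsub>RM\<^esub> embed D K' L (?C s' t))"
        using r t C.elem_closed[OF D(2) _ t] linear_mapD(1)[OF embed_linear[OF D(1)]]
        by (intro RM.M.finsum_cong') (auto simp: std_elem[OF D(1) K' L D(2)])
      finally have sum: "(\<Oplus>\<^bsub>RM\<^esub>p\<in>R_classes_in M D \<times> cell_left (cd D) \<nu>. ?r p \<odot>\<^bsub>RM\<^esub> cell_elem std (D, \<nu>) p (L, t))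
        = (\<Oplus>\<^bsub>RM\<^esub>s'\<in>cell_left (cd D) \<nu>. r s' \<odot>\<^bsub>RM\<^esub> embed D K' L (?C s' t))" .
      have "\<delta> m \<otimes>\<^bsub>RM\<^esub> cell_elem std (D, \<nu>) (K, s) (L, t)
          = embed D K' L (monoid_elem R (SG D) u \<otimes>\<^bsub>RG D\<^esub> ?C s t)"
        unfolding std_elem[OF D(1) K L D(2) s t] using eq L
        by (intro embed_mult_left[OF D(1) m u C.elem_closed[OF D(2) s t] _ K L]) blast
      moreover have "embed D K' L (monoid_elem R (SG D) u \<otimes>\<^bsub>RG D\<^esub> ?C s t)
          \<ominus>\<^bsub>RM\<^esub> (\<Oplus>\<^bsub>RM\<^esub>s'\<in>cell_left (cd D) \<nu>. r s' \<odot>\<^bsub>RM\<^esub> embed D K' L (?C s' t)) \<in> cell_hat R RM std (D, \<nu>)"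
        using C.elem_closed[OF D(2) _ t] s
        by (intro embed_congruence[OF D K' L r _ _ cong[OF t]] G.algebra_mult_closed u') auto
      ultimately show ?thesis
        unfolding sum by simp
    qed
    moreover have "?r \<in> R_classes_in M D \<times> cell_left (cd D) \<nu> \<rightarrow> carrier R"
      using r by (auto simp: Pi_iff)
    ultimately show ?thesis
      by (intro bexI[where x = ?r]) (simp_all add: split_paired_all)
  next
    assume low: "\<forall>L\<in>L_classes_in M D. \<forall>g\<in>carrier (SG D). m \<otimes>\<^bsub>M\<^esub> coord D K L g \<in> strictly_below D"
    have "\<delta> m \<otimes>\<^bsub>RM\<^esub> cell_elem std (D, \<nu>) (K, s) (L, t) \<in> cell_hat R RM std (D, \<nu>)"
      if L: "L \<in> L_classes_in M D" and t: "t \<in> cell_right (cd D) \<nu>" for L t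
    proof -
      have "\<delta> m \<otimes>\<^bsub>RM\<^esub> cell_elem std (D, \<nu>) (K, s) (L, t)
          = lin_ext (SG D) RM (\<lambda>g. \<delta> m \<otimes>\<^bsub>RM\<^esub> \<delta> (coord D K L g)) (?C s t)"
        unfolding std_elem[OF D(1) K L D(2) s t]
        by (intro linear_map_embed[OF D(1) linear_map_mult_left] algebra_closed C.elem_closed[OF D(2) s t])
      also have "\<dots> \<in> cell_hat R RM std (D, \<nu>)"
        using low L m strictly_below_in_hat[OF D]
        by (intro lin_ext_in_submodule[OF D(1) hat_submodule C.elem_closed[OF D(2) s t]])
          (auto simp: delta_mult coord_mem(4)[OF D(1) K L])
      finally show ?thesis .
    qed
    then have "\<delta> m \<otimes>\<^bsub>RM\<^esub> cell_elem std (D, \<nu>) (K, s) q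
        \<ominus>\<^bsub>RM\<^esub> (\<Oplus>\<^bsub>RM\<^esub>p\<in>cell_left std (D, \<nu>). \<zero> \<odot>\<^bsub>RM\<^esub> cell_elem std (D, \<nu>) p q)
      \<in> cell_hat R RM std (D, \<nu>)" if "q \<in> cell_right std (D, \<nu>)" for q
      using that std_elem_closed[OF poset _ that] by (intro hat_minus_zero_sum) auto
    then show ?thesis
      by (intro bexI[where x = "\<lambda>_. \<zero>"]) auto
  qed
qed

lemma right_mult_delta:
  assumes D: "D \<in> D_classes M" "\<nu> \<in> cell_poset (cd D)"
    and L: "L \<in> L_classes_in M D" and t: "t \<in> cell_right (cd D) \<nu>" and m: "m \<in> carrier M"
  shows "\<exists>r\<in>cell_right std (D, \<nu>) \<rightarrow> carrier R. \<forall>p\<in>cell_left std (D, \<nu>).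
    cell_elem std (D, \<nu>) p (L, t) \<otimes>\<^bsub>RM\<^esub> \<delta> m
      \<ominus>\<^bsub>RM\<^esub> (\<Oplus>\<^bsub>RM\<^esub>q\<in>cell_right std (D, \<nu>). r q \<odot>\<^bsub>RM\<^esub> cell_elem std (D, \<nu>) p q)
    \<in> cell_hat R RM std (D, \<nu>)"
proof -
  interpret G: finite_monoid_algebra R "SG D"
    using SG_algebra[OF D(1)] .
  interpret C: cell_structure R "RG D" "cd D"
    using cells[OF D(1)] .
  have poset: "(D, \<nu>) \<in> cell_poset std"
    using D by (simp add: poset_iff)
  let ?C = "cell_elem (cd D) \<nu>"
  from coord_right_mult[OF D(1) L m] show ?thesis
  proof (elim disjE bexE)
    fix L' u
    assume L': "L' \<in> L_classes_in M D" and u: "u \<in> carrier (SG D)"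
      and eq: "\<forall>K\<in>R_classes_in M D. \<forall>g\<in>carrier (SG D).
        coord D K L g \<otimes>\<^bsub>M\<^esub> m = coord D K L' (g \<otimes>\<^bsub>SG D\<^esub> u)"
    have u': "monoid_elem R (SG D) u \<in> carrier (RG D)"
      by (rule G.algebra_closed)
    obtain r where r: "r \<in> cell_right (cd D) \<nu> \<rightarrow> carrier R"
      and cong: "\<And>s. s \<in> cell_left (cd D) \<nu> \<Longrightarrow>
        ?C s t \<otimes>\<^bsub>RG D\<^esub> monoid_elem R (SG D) u
          \<ominus>\<^bsub>RG D\<^esub> (\<Oplus>\<^bsub>RG D\<^esub>t'\<in>cell_right (cd D) \<nu>. r t' \<odot>\<^bsub>RG D\<^esub> ?C s t')
        \<in> cell_hat R (RG D) (cd D) \<nu>"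
      using C.right_mult[OF u' D(2) t] by blast
    let ?r = "\<lambda>q. if fst q = L' then r (snd q) else \<zero>"
    have "cell_elem std (D, \<nu>) (K, s) (L, t) \<otimes>\<^bsub>RM\<^esub> \<delta> m
        \<ominus>\<^bsub>RM\<^esub> (\<Oplus>\<^bsub>RM\<^esub>q\<in>L_classes_in M D \<times> cell_right (cd D) \<nu>. ?r q \<odot>\<^bsub>RM\<^esub> cell_elem std (D, \<nu>) (K, s) q)
      \<in> cell_hat R RM std (D, \<nu>)"
      if K: "K \<in> R_classes_in M D" and s: "s \<in> cell_left (cd D) \<nu>" for K s
    proof -
      have "(\<Oplus>\<^bsub>RM\<^esub>q\<in>L_classes_in M D \<times> cell_right (cd D) \<nu>. ?r q \<odot>\<^bsub>RM\<^esub> cell_elem std (D, \<nu>) (K, s) q)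
          = (\<Oplus>\<^bsub>RM\<^esub>t'\<in>cell_right (cd D) \<nu>. r t' \<odot>\<^bsub>RM\<^esub> cell_elem std (D, \<nu>) (K, s) (L', t'))"
        using finite_L_classes_in C.finite_right[OF D(2)] L' r K s
        by (intro RM.finsum_single_block std_elem_closed[OF poset]) simp_all
      also have "\<dots> = (\<Oplus>\<^bsub>RM\<^esub>t'\<in>cell_right (cd D) \<nu>. r t' \<odot>\<^bsub>RM\<^esub> embed D K L' (?C s t'))"
        using r s C.elem_closed[OF D(2) s] linear_mapD(1)[OF embed_linear[OF D(1)]]
        by (intro RM.M.finsum_cong') (auto simp: std_elem[OF D(1) K L' D(2)])
      finally have sum: "(\<Oplus>\<^bsub>RM\<^esub>q\<in>L_classes_in M D \<times> cell_right (cd D) \<nu>. ?r q \<odot>\<^bsub>RM\<^esub> cell_elem std (D, \<nu>) (K, s) q)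
        = (\<Oplus>\<^bsub>RM\<^esub>t'\<in>cell_right (cd D) \<nu>. r t' \<odot>\<^bsub>RM\<^esub> embed D K L' (?C s t'))" .
      have "cell_elem std (D, \<nu>) (K, s) (L, t) \<otimes>\<^bsub>RM\<^esub> \<delta> m
          = embed D K L' (?C s t \<otimes>\<^bsub>RG D\<^esub> monoid_elem R (SG D) u)"
        unfolding std_elem[OF D(1) K L D(2) s t] using eq K
        by (intro embed_mult_right[OF D(1) m u C.elem_closed[OF D(2) s t] _ K L]) blast
      moreover have "embed D K L' (?C s t \<otimes>\<^bsub>RG D\<^esub> monoid_elem R (SG D) u)
          \<ominus>\<^bsub>RM\<^esub> (\<Oplus>\<^bsub>RM\<^esub>t'\<in>cell_right (cd D) \<nu>. r t' \<odot>\<^bsub>RM\<^esub> embed D K L' (?C s t')) \<in> cell_hat R RM std (D, \<nu>)"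
        using C.elem_closed[OF D(2) s] t
        by (intro embed_congruence[OF D K L' r _ _ cong[OF s]] G.algebra_mult_closed u') auto
      ultimately show ?thesis
        unfolding sum by simp
    qed
    moreover have "?r \<in> L_classes_in M D \<times> cell_right (cd D) \<nu> \<rightarrow> carrier R"
      using r by (auto simp: Pi_iff)
    ultimately show ?thesis
      by (intro bexI[where x = ?r]) (simp_all add: split_paired_all)
  next
    assume low: "\<forall>K\<in>R_classes_in M D. \<forall>g\<in>carrier (SG D). coord D K L g \<otimes>\<^bsub>M\<^esub> m \<in> strictly_below D"
    have "cell_elem std (D, \<nu>) (K, s) (L, t) \<otimes>\<^bsub>RM\<^esub> \<delta> m \<in> cell_hat R RM std (D, \<nu>)"
      if K: "K \<in> R_classes_in M D" and s: "s \<in> cell_left (cd D) \<nu>" for K s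
    proof -
      have "cell_elem std (D, \<nu>) (K, s) (L, t) \<otimes>\<^bsub>RM\<^esub> \<delta> m
          = lin_ext (SG D) RM (\<lambda>g. \<delta> (coord D K L g) \<otimes>\<^bsub>RM\<^esub> \<delta> m) (?C s t)"
        unfolding std_elem[OF D(1) K L D(2) s t]
        by (intro linear_map_embed[OF D(1) linear_map_mult_right] algebra_closed C.elem_closed[OF D(2) s t])
      also have "\<dots> \<in> cell_hat R RM std (D, \<nu>)"
        using low K m strictly_below_in_hat[OF D]
        by (intro lin_ext_in_submodule[OF D(1) hat_submodule C.elem_closed[OF D(2) s t]])
          (auto simp: delta_mult coord_mem(4)[OF D(1) K L])
      finally show ?thesis .
    qed
    then have "cell_elem std (D, \<nu>) p (L, t) \<otimes>\<^bsub>RM\<^esub> \<delta> m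
        \<ominus>\<^bsub>RM\<^esub> (\<Oplus>\<^bsub>RM\<^esub>q\<in>cell_right std (D, \<nu>). \<zero> \<odot>\<^bsub>RM\<^esub> cell_elem std (D, \<nu>) p q)
      \<in> cell_hat R RM std (D, \<nu>)" if "p \<in> cell_left std (D, \<nu>)" for p
      using that std_elem_closed[OF poset that] by (intro hat_minus_zero_sum) auto
    then show ?thesis
      by (intro bexI[where x = "\<lambda>_. \<zero>"]) auto
  qed
qed

lemma finite_std_poset: "finite (cell_poset std)"
  using finite_D_classes cell_structure.finite_poset[OF cells] by (auto simp: standard_poset_def)

lemma finite_std_left: "p \<in> cell_poset std \<Longrightarrow> finite (cell_left std p)"
  using finite_R_classes_in cell_structure.finite_left[OF cells]
  by (cases p) (auto simp: poset_iff)

lemma finite_std_right: "p \<in> cell_poset std \<Longrightarrow> finite (cell_right std p)"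
  using finite_L_classes_in cell_structure.finite_right[OF cells]
  by (cases p) (auto simp: poset_iff)

lemma std_left_mult:
  assumes x: "x \<in> carrier RM" and p: "p \<in> cell_poset std" and s: "s \<in> cell_left std p"
  shows "\<exists>r\<in>cell_left std p \<rightarrow> carrier R. \<forall>t\<in>cell_right std p.
    x \<otimes>\<^bsub>RM\<^esub> cell_elem std p s t
      \<ominus>\<^bsub>RM\<^esub> (\<Oplus>\<^bsub>RM\<^esub>s'\<in>cell_left std p. r s' \<odot>\<^bsub>RM\<^esub> cell_elem std p s' t) \<in> cell_hat R RM std p"
proof -
  let ?J = "{x \<in> carrier RM. \<exists>r\<in>cell_left std p \<rightarrow> carrier R. \<forall>t\<in>cell_right std p.
    x \<otimes>\<^bsub>RM\<^esub> cell_elem std p s t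
      \<ominus>\<^bsub>RM\<^esub> (\<Oplus>\<^bsub>RM\<^esub>s'\<in>cell_left std p. r s' \<odot>\<^bsub>RM\<^esub> cell_elem std p s' t) \<in> cell_hat R RM std p}"
  have "submodule ?J R RM"
    by (rule RM.uniform_congruence_submodule[OF hat_submodule finite_std_left[OF p] std_elem_closed[OF p]
        linear_map_mult_right[OF std_elem_closed[OF p s]] refl])
  moreover have "\<delta> m \<in> ?J" if m: "m \<in> carrier M" for m
  proof -
    obtain D \<nu> K s' where eq: "p = (D, \<nu>)" "s = (K, s')"
      by (metis surj_pair)
    then have "D \<in> D_classes M" "\<nu> \<in> cell_poset (cd D)" "K \<in> R_classes_in M D" "s' \<in> cell_left (cd D) \<nu>"
      using p s by (simp_all add: poset_iff)
    from left_mult_delta[OF this m] show ?thesis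
      unfolding eq using algebra_closed(4) by blast
  qed
  ultimately have "carrier RM \<subseteq> ?J"
    by (rule submodule_eq_carrierI)
  then show ?thesis
    using x by blast
qed

lemma std_right_mult:
  assumes x: "x \<in> carrier RM" and p: "p \<in> cell_poset std" and t: "t \<in> cell_right std p"
  shows "\<exists>r\<in>cell_right std p \<rightarrow> carrier R. \<forall>s\<in>cell_left std p.
    cell_elem std p s t \<otimes>\<^bsub>RM\<^esub> x
      \<ominus>\<^bsub>RM\<^esub> (\<Oplus>\<^bsub>RM\<^esub>t'\<in>cell_right std p. r t' \<odot>\<^bsub>RM\<^esub> cell_elem std p s t') \<in> cell_hat R RM std p"
proof -
  let ?J = "{x \<in> carrier RM. \<exists>r\<in>cell_right std p \<rightarrow> carrier R. \<forall>s\<in>cell_left std p.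
    cell_elem std p s t \<otimes>\<^bsub>RM\<^esub> x
      \<ominus>\<^bsub>RM\<^esub> (\<Oplus>\<^bsub>RM\<^esub>t'\<in>cell_right std p. r t' \<odot>\<^bsub>RM\<^esub> cell_elem std p s t') \<in> cell_hat R RM std p}"
  have "submodule ?J R RM"
    by (rule RM.uniform_congruence_submodule[OF hat_submodule finite_std_right[OF p] std_elem_closed[OF p]
        linear_map_mult_left[OF std_elem_closed[OF p _ t]] refl])
  moreover have "\<delta> m \<in> ?J" if m: "m \<in> carrier M" for m
  proof -
    obtain D \<nu> L t' where eq: "p = (D, \<nu>)" "t = (L, t')"
      by (metis surj_pair)
    then have "D \<in> D_classes M" "\<nu> \<in> cell_poset (cd D)" "L \<in> L_classes_in M D" "t' \<in> cell_right (cd D) \<nu>"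
      using p t by (simp_all add: poset_iff)
    from right_mult_delta[OF this m] show ?thesis
      unfolding eq using algebra_closed(4) by blast
  qed
  ultimately have "carrier RM \<subseteq> ?J"
    by (rule submodule_eq_carrierI)
  then show ?thesis
    using x by blast
qed

end

section \<open>The standard cell structure\<close>

context cell_monoid
begin

lemma standard_le_iff:
  "((D2, \<nu>2), (D1, \<nu>1)) \<in> standard_le M cd \<longleftrightarrow>
    D2 \<in> D_classes M \<and> \<nu>2 \<in> cell_poset (cd D2) \<and> D1 \<in> D_classes M \<and> \<nu>1 \<in> cell_poset (cd D1) \<and>
    (D_le M D1 D2 \<and> D1 \<noteq> D2 \<or> D1 = D2 \<and> (\<nu>2, \<nu>1) \<in> cell_le (cd D1))"
  by (auto simp: standard_le_def poset_iff)

lemma partial_order_standard_le: "partial_order_on (standard_poset M cd) (standard_le M cd)"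
proof -
  have po: "refl_on (cell_poset (cd D)) (cell_le (cd D))" "trans (cell_le (cd D))" "antisym (cell_le (cd D))"
    if "D \<in> D_classes M" for D
    using cell_structure.partial_order[OF cells[OF that]] by (auto dest: partial_order_onD)
  have "refl_on (standard_poset M cd) (standard_le M cd)"
    using po(1) by (auto simp: refl_on_def standard_le_iff poset_iff)
  moreover have "trans (standard_le M cd)"
  proof (rule transI)
    fix p q r assume pq: "(p, q) \<in> standard_le M cd" and qr: "(q, r) \<in> standard_le M cd"
    obtain D1 \<nu>1 D2 \<nu>2 D3 \<nu>3 where eq: "p = (D1, \<nu>1)" "q = (D2, \<nu>2)" "r = (D3, \<nu>3)"
      by (metis surj_pair)
    have mem: "D1 \<in> D_classes M" "D2 \<in> D_classes M" "D3 \<in> D_classes M"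
      using pq qr by (simp_all add: eq standard_le_iff)
    have "D_le M D3 D1 \<and> D3 \<noteq> D1" if "D_le M D3 D2" "D3 \<noteq> D2" "D_le M D2 D1"
      using that D_le_trans[OF mem(3,2,1)] D_le_antisym[OF mem(3,2)] by blast
    then show "(p, r) \<in> standard_le M cd"
      using pq qr transD[OF po(2)[OF mem(1)], of \<nu>1 \<nu>2 \<nu>3]
      unfolding eq standard_le_iff by blast
  qed
  moreover have "antisym (standard_le M cd)"
  proof (rule antisymI)
    fix p q assume pq: "(p, q) \<in> standard_le M cd" and qp: "(q, p) \<in> standard_le M cd"
    obtain D1 \<nu>1 D2 \<nu>2 where eq: "p = (D1, \<nu>1)" "q = (D2, \<nu>2)"
      by (metis surj_pair)
    have mem: "D1 \<in> D_classes M" "D2 \<in> D_classes M"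
      using pq by (simp_all add: eq standard_le_iff)
    show "p = q"
      using pq qp D_le_antisym[OF mem] antisymD[OF po(3)[OF mem(1)], of \<nu>1 \<nu>2]
      unfolding eq standard_le_iff by blast
  qed
  moreover have "standard_le M cd \<subseteq> standard_poset M cd \<times> standard_poset M cd"
    by (auto simp: standard_le_def)
  ultimately show ?thesis
    by (simp add: partial_order_on_def preorder_on_def)
qed

lemma std_index_iff:
  "((D, \<nu>), (K, s), (L, t)) \<in> cell_index std \<longleftrightarrow>
    D \<in> D_classes M \<and> K \<in> R_classes_in M D \<and> L \<in> L_classes_in M D \<and> (\<nu>, s, t) \<in> cell_index (cd D)"
  by (auto simp: cell_index_def poset_iff)

lemma finite_std_index: "finite (cell_index std)"
  unfolding cell_index_def using finite_std_poset finite_std_left finite_std_right by blast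

text \<open>
  Restricting a linear relation to one cell of one egg-box gives a relation among the cell basis
  elements of a single group algebra, because the other elements vanish on that cell.
\<close>

lemma std_indep: "indep_family R RM (\<lambda>(p, s, t). cell_elem std p s t) (cell_index std)"
  unfolding indep_family_def
proof (intro ballI impI)
  let ?e = "\<lambda>(p, s, t). cell_elem std p s t"
  fix c i
  assume c: "c \<in> cell_index std \<rightarrow> carrier R" and i: "i \<in> cell_index std"
    and zero: "(\<Oplus>\<^bsub>RM\<^esub>i\<in>cell_index std. c i \<odot>\<^bsub>RM\<^esub> ?e i) = \<zero>\<^bsub>RM\<^esub>"
  obtain D \<nu> K s L t where i_eq: "i = ((D, \<nu>), (K, s), (L, t))"
    by (metis surj_pair)
  have D: "D \<in> D_classes M" "K \<in> R_classes_in M D" "L \<in> L_classes_in M D"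
    and idx: "(\<nu>, s, t) \<in> cell_index (cd D)"
    using i by (simp_all add: i_eq std_index_iff)
  interpret G: finite_monoid_algebra R "SG D"
    using SG_algebra[OF D(1)] .
  interpret C: cell_structure R "RG D" "cd D"
    using cells[OF D(1)] .
  let ?f = "\<lambda>(\<nu>, s, t). cell_elem (cd D) \<nu> s t"
  let ?h = "\<lambda>(\<nu>, s, t). ((D, \<nu>), (K, s), (L, t))"
  let ?E = "restr D K L"
  note lin = restr_linear[OF D]
  have e_mem: "?e j \<in> carrier RM" if "j \<in> cell_index std" for j
    using that std_elem_closed by (auto simp: cell_index_def simp del: std_simps)
  have f_mem: "?f j \<in> carrier (RG D)" if "j \<in> cell_index (cd D)" for j
    using that C.elem_closed by (auto simp: cell_index_def)
  have h_mem: "?h j \<in> cell_index std" if "j \<in> cell_index (cd D)" for j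
    using that D by (cases j) (simp add: std_index_iff)
  have block: "?E (?e (?h j)) = ?f j" if "j \<in> cell_index (cd D)" for j
    using that D C.elem_closed
    by (cases j) (auto simp: cell_index_def std_elem restr_embed_same)
  have other: "?E (?e j) = \<zero>\<^bsub>RG D\<^esub>" if j: "j \<in> cell_index std" "j \<notin> ?h ` cell_index (cd D)" for j
  proof -
    obtain D' \<nu>' K' s' L' t' where j_eq: "j = ((D', \<nu>'), (K', s'), (L', t'))"
      by (metis surj_pair)
    have D': "D' \<in> D_classes M" "K' \<in> R_classes_in M D'" "L' \<in> L_classes_in M D'"
      and idx': "(\<nu>', s', t') \<in> cell_index (cd D')"
      using j(1) by (simp_all add: j_eq std_index_iff)
    have idx'': "\<nu>' \<in> cell_poset (cd D')" "s' \<in> cell_left (cd D') \<nu>'" "t' \<in> cell_right (cd D') \<nu>'"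
      using idx' by (simp_all add: cell_index_def)
    have "(D, K, L) \<noteq> (D', K', L')"
      using j(2) idx' by (force simp: j_eq)
    then show ?thesis
      using restr_embed_other[OF D D' cell_structure.elem_closed[OF cells[OF D'(1)] idx'']]
      by (simp add: j_eq std_elem[OF D' idx''])
  qed
  have "(\<Oplus>\<^bsub>RG D\<^esub>j\<in>cell_index (cd D). c (?h j) \<odot>\<^bsub>RG D\<^esub> ?f j)
      = (\<Oplus>\<^bsub>RG D\<^esub>j\<in>cell_index (cd D). c (?h j) \<odot>\<^bsub>RG D\<^esub> ?E (?e (?h j)))"
    using c h_mem f_mem block by (intro G.RM.M.finsum_cong') (auto simp: Pi_iff simp del: std_simps)
  also have "\<dots> = (\<Oplus>\<^bsub>RG D\<^esub>j\<in>?h ` cell_index (cd D). c j \<odot>\<^bsub>RG D\<^esub> ?E (?e j))"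
  proof (rule G.RM.M.finsum_reindex[symmetric])
    show "(\<lambda>j. c j \<odot>\<^bsub>RG D\<^esub> ?E (?e j)) \<in> ?h ` cell_index (cd D) \<rightarrow> carrier (RG D)"
      using c h_mem e_mem linear_mapD(1)[OF lin] by fast
    show "inj_on ?h (cell_index (cd D))"
      by (auto simp: inj_on_def)
  qed
  also have "\<dots> = (\<Oplus>\<^bsub>RG D\<^esub>j\<in>cell_index std. c j \<odot>\<^bsub>RG D\<^esub> ?E (?e j))"
  proof (rule G.RM.M.add.finprod_mono_neutral_cong_left[OF finite_std_index])
    show "?h ` cell_index (cd D) \<subseteq> cell_index std"
      using h_mem by blast
    show "c j \<odot>\<^bsub>RG D\<^esub> ?E (?e j) = \<zero>\<^bsub>RG D\<^esub>" if "j \<in> cell_index std - ?h ` cell_index (cd D)" for j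
      using other[of j] that c by (simp add: Pi_iff)
    show "(\<lambda>j. c j \<odot>\<^bsub>RG D\<^esub> ?E (?e j)) \<in> cell_index std \<rightarrow> carrier (RG D)"
      using c e_mem linear_mapD(1)[OF lin] by fast
  qed simp
  also have "\<dots> = ?E (\<Oplus>\<^bsub>RM\<^esub>j\<in>cell_index std. c j \<odot>\<^bsub>RM\<^esub> ?e j)"
    using linear_map_finsum[OF algebra_module RG_module[OF D(1)] lin c, of ?e] e_mem by simp
  also have "\<dots> = \<zero>\<^bsub>RG D\<^esub>"
    unfolding zero by (rule linear_map_zero[OF algebra_module RG_module[OF D(1)] lin])
  finally have "c (?h (\<nu>, s, t)) = \<zero>"
    using c h_mem by (intro indep_familyD[OF C.indep_elems _ _ idx, of "\<lambda>j. c (?h j)"]) auto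
  then show "c i = \<zero>"
    by (simp add: i_eq)
qed

lemma std_basis:
  "inj_on (\<lambda>(p, s, t). cell_elem std p s t) (cell_index std)" "free_basis R RM (cell_basis std)"
proof -
  let ?e = "\<lambda>(p, s, t). cell_elem std p s t"
  have sub: "?e ` cell_index std \<subseteq> carrier RM"
    using std_elem_closed by (auto simp: cell_index_def simp del: std_simps)
  note ind = RM.lin_indep_if_indep_family[OF one_not_zero finite_std_index sub std_indep]
  show "inj_on ?e (cell_index std)"
    by (rule ind(1))
  have N: "submodule (lin_span R RM (?e ` cell_index std)) R RM"
    by (rule RM.lin_span_submodule[OF sub])
  have "carrier RM \<subseteq> lin_span R RM (?e ` cell_index std)"
  proof (rule submodule_eq_carrierI[OF N])
    fix x assume "x \<in> carrier M"
    then have D: "green_D M `` {x} \<in> D_classes M" "x \<in> green_D M `` {x}"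
      using D_class_of by blast+
    show "\<delta> x \<in> lin_span R RM (?e ` cell_index std)"
    proof (rule delta_in_submodule[OF N D])
      fix \<nu> K s L t
      assume "\<nu> \<in> cell_poset (cd (green_D M `` {x}))" "K \<in> R_classes_in M (green_D M `` {x})"
        "s \<in> cell_left (cd (green_D M `` {x})) \<nu>" "L \<in> L_classes_in M (green_D M `` {x})"
        "t \<in> cell_right (cd (green_D M `` {x})) \<nu>"
      then have "((green_D M `` {x}, \<nu>), (K, s), (L, t)) \<in> cell_index std"
        using D(1) by (simp add: cell_index_def poset_iff)
      then have "?e ((green_D M `` {x}, \<nu>), (K, s), (L, t)) \<in> ?e ` cell_index std"
        by (rule imageI)
      then show "cell_elem std (green_D M `` {x}, \<nu>) (K, s) (L, t) \<in> lin_span R RM (?e ` cell_index std)"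
        using RM.lin_span_base[OF sub] by simp
    qed
  qed
  then show "free_basis R RM (cell_basis std)"
    using ind(2) sub RM.submoduleE(1)[OF N] by (simp add: free_basis_def cell_basis_def set_eq_subset)
qed

theorem standard_cell_structure: "cell_structure R RM std"
proof (intro cell_structure.intro cell_structure_axioms.intro algebra_assoc_algebra)
  show "domain R"
    by unfold_locales
qed (fact finite_std_poset finite_std_left finite_std_right std_basis std_left_mult std_right_mult
  partial_order_standard_le[folded std_simps(1,2)])+

end

section \<open>Relabelling cell structures\<close>

text \<open>
  Renaming the poset and the index sets injectively changes neither the basis nor the submodules
  \<open>cell_hat\<close>.
\<close>

lemma cell_structure_relabel:
  fixes cd :: "('l, 'i, 'j, 'a) cell_datum"
    and f :: "'l \<Rightarrow> 'l2" and g :: "'i \<Rightarrow> 'i2" and h :: "'j \<Rightarrow> 'j2"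
  assumes "cell_structure R A cd"
    and f: "inj_on f (cell_poset cd)"
    and g: "inj_on g (\<Union>\<nu>\<in>cell_poset cd. cell_left cd \<nu>)"
    and h: "inj_on h (\<Union>\<nu>\<in>cell_poset cd. cell_right cd \<nu>)"
  shows "\<exists>cd'. cell_structure R A
    (cd' :: ('l2, 'i2, 'j2, 'a) cell_datum)"
proof -
  interpret cell_structure R A cd
    by fact
  define f' g' h' where "f' = inv_into (cell_poset cd) f"
    and "g' = inv_into (\<Union>\<nu>\<in>cell_poset cd. cell_left cd \<nu>) g"
    and "h' = inv_into (\<Union>\<nu>\<in>cell_poset cd. cell_right cd \<nu>) h"
  have f': "f' (f \<nu>) = \<nu>" if "\<nu> \<in> cell_poset cd" for \<nu>
    using that f by (simp add: f'_def)
  have g': "g' (g s) = s" if "\<nu> \<in> cell_poset cd" "s \<in> cell_left cd \<nu>" for \<nu> s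
    unfolding g'_def using that by (intro inv_into_f_f[OF g]) blast
  have h': "h' (h t) = t" if "\<nu> \<in> cell_poset cd" "t \<in> cell_right cd \<nu>" for \<nu> t
    unfolding h'_def using that by (intro inv_into_f_f[OF h]) blast
  define cd' :: "('l2, 'i2, 'j2, 'a) cell_datum" where
    "cd' = \<lparr>cell_poset = f ` cell_poset cd, cell_le = map_prod f f ` cell_le cd,
      cell_left = (\<lambda>n. g ` cell_left cd (f' n)), cell_right = (\<lambda>n. h ` cell_right cd (f' n)),
      cell_elem = (\<lambda>n i j. cell_elem cd (f' n) (g' i) (h' j))\<rparr>"
  note po = partial_order_onD[OF partial_order]
  have poset: "cell_poset cd' = f ` cell_poset cd"
    by (simp add: cd'_def)
  have left: "cell_left cd' (f \<nu>) = g ` cell_left cd \<nu>"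
    and right: "cell_right cd' (f \<nu>) = h ` cell_right cd \<nu>" if "\<nu> \<in> cell_poset cd" for \<nu>
    using that f' by (simp_all add: cd'_def)
  have elem: "cell_elem cd' (f \<nu>) (g s) (h t) = cell_elem cd \<nu> s t"
    if "\<nu> \<in> cell_poset cd" "s \<in> cell_left cd \<nu>" "t \<in> cell_right cd \<nu>" for \<nu> s t
    using that f' g' h' by (simp add: cd'_def)
  have le: "(f \<mu>, f \<nu>) \<in> cell_le cd' \<longleftrightarrow> (\<mu>, \<nu>) \<in> cell_le cd" if "\<mu> \<in> cell_poset cd" "\<nu> \<in> cell_poset cd" for \<mu> \<nu>
  proof
    assume "(f \<mu>, f \<nu>) \<in> cell_le cd'"
    then obtain \<mu>' \<nu>' where "(\<mu>', \<nu>') \<in> cell_le cd" "f \<mu> = f \<mu>'" "f \<nu> = f \<nu>'"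
      by (auto simp: cd'_def)
    moreover from this have "\<mu>' \<in> cell_poset cd" "\<nu>' \<in> cell_poset cd"
      using po(4) by auto
    ultimately show "(\<mu>, \<nu>) \<in> cell_le cd"
      using that f by (metis inj_onD)
  qed (auto simp: cd'_def)
  have le_sub: "cell_le cd' \<subseteq> f ` cell_poset cd \<times> f ` cell_poset cd"
    using po(4) by (auto simp: cd'_def)
  let ?\<phi> = "\<lambda>(\<nu>, s, t). (f \<nu>, g s, h t)"
  let ?e = "\<lambda>(\<nu>, s, t). cell_elem cd \<nu> s t"
  let ?e' = "\<lambda>(\<nu>, s, t). cell_elem cd' \<nu> s t"
  have index: "cell_index cd' = ?\<phi> ` cell_index cd"
  proof
    show "cell_index cd' \<subseteq> ?\<phi> ` cell_index cd"
    proof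
      fix x assume "x \<in> cell_index cd'"
      then obtain \<nu> s t where "\<nu> \<in> cell_poset cd" "s \<in> cell_left cd \<nu>" "t \<in> cell_right cd \<nu>"
        "x = ?\<phi> (\<nu>, s, t)"
        using left right by (fastforce simp: cell_index_def poset)
      moreover from this have "(\<nu>, s, t) \<in> cell_index cd"
        by (simp add: cell_index_def)
      ultimately show "x \<in> ?\<phi> ` cell_index cd"
        by blast
    qed
    show "?\<phi> ` cell_index cd \<subseteq> cell_index cd'"
      using left right by (auto simp: cell_index_def poset)
  qed
  have e': "?e' (?\<phi> x) = ?e x" if "x \<in> cell_index cd" for x
    using that elem by (auto simp: cell_index_def)
  have basis': "cell_basis cd' = cell_basis cd"
    unfolding cell_basis_def index image_image using e' by (rule image_cong[OF refl])
  have hat: "cell_hat R A cd' (f \<nu>) = cell_hat R A cd \<nu>" if \<nu>: "\<nu> \<in> cell_poset cd" for \<nu>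
  proof -
    have "{cell_elem cd' \<mu> s t |\<mu> s t. \<mu> \<in> cell_poset cd' \<and> (f \<nu>, \<mu>) \<in> cell_le cd' \<and> f \<nu> \<noteq> \<mu> \<and>
        s \<in> cell_left cd' \<mu> \<and> t \<in> cell_right cd' \<mu>}
      = {cell_elem cd \<mu> s t |\<mu> s t. \<mu> \<in> cell_poset cd \<and> (\<nu>, \<mu>) \<in> cell_le cd \<and> \<nu> \<noteq> \<mu> \<and>
        s \<in> cell_left cd \<mu> \<and> t \<in> cell_right cd \<mu>}" (is "?S' = ?S")
    proof
      show "?S' \<subseteq> ?S"
      proof
        fix x assume "x \<in> ?S'"
        then obtain \<mu> s t where *: "\<mu> \<in> cell_poset cd" "(f \<nu>, f \<mu>) \<in> cell_le cd'" "f \<nu> \<noteq> f \<mu>"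
          "s \<in> cell_left cd \<mu>" "t \<in> cell_right cd \<mu>" "x = cell_elem cd' (f \<mu>) (g s) (h t)"
          using left right by (auto simp: poset)
        then show "x \<in> ?S"
          using le[OF \<nu>] elem by blast
      qed
      show "?S \<subseteq> ?S'"
      proof
        fix x assume "x \<in> ?S"
        then obtain \<mu> s t where *: "\<mu> \<in> cell_poset cd" "(\<nu>, \<mu>) \<in> cell_le cd" "\<nu> \<noteq> \<mu>"
          "s \<in> cell_left cd \<mu>" "t \<in> cell_right cd \<mu>" "x = cell_elem cd \<mu> s t"
          by blast
        have "f \<nu> \<noteq> f \<mu>"
          using *(1,3) \<nu> f by (meson inj_onD)
        then have "f \<mu> \<in> cell_poset cd' \<and> (f \<nu>, f \<mu>) \<in> cell_le cd' \<and> f \<nu> \<noteq> f \<mu> \<and>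
          g s \<in> cell_left cd' (f \<mu>) \<and> h t \<in> cell_right cd' (f \<mu>)"
          using * le[OF \<nu>] left right by (simp add: poset)
        moreover have "x = cell_elem cd' (f \<mu>) (g s) (h t)"
          using * elem by simp
        ultimately show "x \<in> ?S'"
          by blast
      qed
    qed
    then show ?thesis
      by (simp add: cell_hat_def)
  qed
  have "cell_structure R A cd'"
  proof (intro cell_structure.intro cell_structure_axioms.intro)
    show "assoc_algebra R A" "domain R"
      by unfold_locales
    show "finite (cell_poset cd')"
      using finite_poset by (simp add: poset)
    show "finite (cell_left cd' n)" "finite (cell_right cd' n)" if "n \<in> cell_poset cd'" for n
      using that finite_left finite_right left right by (auto simp: poset)
    show "partial_order_on (cell_poset cd') (cell_le cd')"
      unfolding partial_order_on_def preorder_on_def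
    proof (intro conjI)
      show "cell_le cd' \<subseteq> cell_poset cd' \<times> cell_poset cd'"
        using le_sub by (simp add: poset)
      show "refl_on (cell_poset cd') (cell_le cd')"
        using po(1) le by (auto simp: refl_on_def poset)
      show "trans (cell_le cd')"
      proof (rule transI)
        fix x y z assume xy: "(x, y) \<in> cell_le cd'" and yz: "(y, z) \<in> cell_le cd'"
        obtain \<mu> \<nu> \<xi> where "\<mu> \<in> cell_poset cd" "\<nu> \<in> cell_poset cd" "\<xi> \<in> cell_poset cd"
          "x = f \<mu>" "y = f \<nu>" "z = f \<xi>"
          using le_sub xy yz by blast
        then show "(x, z) \<in> cell_le cd'"
          using xy yz le po(2) by (metis transD)
      qed
      show "antisym (cell_le cd')"
      proof (rule antisymI)
        fix x y assume xy: "(x, y) \<in> cell_le cd'" and yx: "(y, x) \<in> cell_le cd'"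
        obtain \<mu> \<nu> where "\<mu> \<in> cell_poset cd" "\<nu> \<in> cell_poset cd" "x = f \<mu>" "y = f \<nu>"
          using le_sub xy by blast
        then show "x = y"
          using xy yx le po(3) by (metis antisymD)
      qed
    qed
    show "free_basis R A (cell_basis cd')"
      using basis by (simp add: basis')
    have "inj_on (?e' \<circ> ?\<phi>) (cell_index cd)"
      using inj_elem e' by (simp add: inj_on_def)
    then show "inj_on ?e' (cell_index cd')"
      unfolding index by (rule inj_on_imageI)
    fix a n assume a: "a \<in> carrier A" and n: "n \<in> cell_poset cd'"
    obtain \<nu> where \<nu>: "\<nu> \<in> cell_poset cd" "n = f \<nu>"
      using n by (auto simp: poset)
    have inj: "inj_on g (cell_left cd \<nu>)" "inj_on h (cell_right cd \<nu>)"
      using g h \<nu>(1) by (meson UN_upper inj_on_subset)+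
    show "\<exists>r\<in>cell_left cd' n \<rightarrow> carrier R. \<forall>t\<in>cell_right cd' n.
        a \<otimes>\<^bsub>A\<^esub> cell_elem cd' n i t
          \<ominus>\<^bsub>A\<^esub> (\<Oplus>\<^bsub>A\<^esub>s'\<in>cell_left cd' n. r s' \<odot>\<^bsub>A\<^esub> cell_elem cd' n s' t) \<in> cell_hat R A cd' n"
      if "i \<in> cell_left cd' n" for i
    proof -
      obtain s where s: "s \<in> cell_left cd \<nu>" "i = g s"
        using \<open>i \<in> cell_left cd' n\<close> left \<nu> by auto
      obtain r where r: "r \<in> cell_left cd \<nu> \<rightarrow> carrier R"
        and cong: "\<And>t. t \<in> cell_right cd \<nu> \<Longrightarrow> a \<otimes>\<^bsub>A\<^esub> cell_elem cd \<nu> s t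
          \<ominus>\<^bsub>A\<^esub> (\<Oplus>\<^bsub>A\<^esub>s'\<in>cell_left cd \<nu>. r s' \<odot>\<^bsub>A\<^esub> cell_elem cd \<nu> s' t) \<in> cell_hat R A cd \<nu>"
        using left_mult[OF a \<nu>(1) s(1)] by blast
      have "(\<Oplus>\<^bsub>A\<^esub>s'\<in>g ` cell_left cd \<nu>. r (g' s') \<odot>\<^bsub>A\<^esub> cell_elem cd' (f \<nu>) s' (h t))
          = (\<Oplus>\<^bsub>A\<^esub>s'\<in>cell_left cd \<nu>. r s' \<odot>\<^bsub>A\<^esub> cell_elem cd \<nu> s' t)"
        if t: "t \<in> cell_right cd \<nu>" for t
      proof -
        have mem: "r s' \<odot>\<^bsub>A\<^esub> cell_elem cd \<nu> s' t \<in> carrier A" if "s' \<in> cell_left cd \<nu>" for s'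
          using that r elem_closed[OF \<nu>(1) that t] by auto
        have "(\<Oplus>\<^bsub>A\<^esub>s'\<in>g ` cell_left cd \<nu>. r (g' s') \<odot>\<^bsub>A\<^esub> cell_elem cd' (f \<nu>) s' (h t))
          = (\<Oplus>\<^bsub>A\<^esub>s'\<in>cell_left cd \<nu>. r (g' (g s')) \<odot>\<^bsub>A\<^esub> cell_elem cd' (f \<nu>) (g s') (h t))"
          using inj(1) mem g'[OF \<nu>(1)] elem[OF \<nu>(1) _ t]
          by (intro M.finsum_reindex) auto
        also have "\<dots> = (\<Oplus>\<^bsub>A\<^esub>s'\<in>cell_left cd \<nu>. r s' \<odot>\<^bsub>A\<^esub> cell_elem cd \<nu> s' t)"
          using mem g'[OF \<nu>(1)] elem[OF \<nu>(1) _ t] by (intro M.finsum_cong') auto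
        finally show ?thesis .
      qed
      then show ?thesis
        using r cong s elem[OF \<nu>(1) s(1)] g'[OF \<nu>(1)] unfolding \<nu>(2) hat[OF \<nu>(1)] left[OF \<nu>(1)] right[OF \<nu>(1)]
        by (intro bexI[where x = "\<lambda>i. r (g' i)"]) (auto simp: Pi_iff)
    qed
    show "\<exists>r\<in>cell_right cd' n \<rightarrow> carrier R. \<forall>s\<in>cell_left cd' n.
        cell_elem cd' n s j \<otimes>\<^bsub>A\<^esub> a
          \<ominus>\<^bsub>A\<^esub> (\<Oplus>\<^bsub>A\<^esub>t'\<in>cell_right cd' n. r t' \<odot>\<^bsub>A\<^esub> cell_elem cd' n s t') \<in> cell_hat R A cd' n"
      if "j \<in> cell_right cd' n" for j
    proof -
      obtain t where t: "t \<in> cell_right cd \<nu>" "j = h t"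
        using \<open>j \<in> cell_right cd' n\<close> right \<nu> by auto
      obtain r where r: "r \<in> cell_right cd \<nu> \<rightarrow> carrier R"
        and cong: "\<And>s. s \<in> cell_left cd \<nu> \<Longrightarrow> cell_elem cd \<nu> s t \<otimes>\<^bsub>A\<^esub> a
          \<ominus>\<^bsub>A\<^esub> (\<Oplus>\<^bsub>A\<^esub>t'\<in>cell_right cd \<nu>. r t' \<odot>\<^bsub>A\<^esub> cell_elem cd \<nu> s t') \<in> cell_hat R A cd \<nu>"
        using right_mult[OF a \<nu>(1) t(1)] by blast
      have "(\<Oplus>\<^bsub>A\<^esub>t'\<in>h ` cell_right cd \<nu>. r (h' t') \<odot>\<^bsub>A\<^esub> cell_elem cd' (f \<nu>) (g s) t')
          = (\<Oplus>\<^bsub>A\<^esub>t'\<in>cell_right cd \<nu>. r t' \<odot>\<^bsub>A\<^esub> cell_elem cd \<nu> s t')"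
        if s: "s \<in> cell_left cd \<nu>" for s
      proof -
        have mem: "r t' \<odot>\<^bsub>A\<^esub> cell_elem cd \<nu> s t' \<in> carrier A" if "t' \<in> cell_right cd \<nu>" for t'
          using that r elem_closed[OF \<nu>(1) s that] by auto
        have "(\<Oplus>\<^bsub>A\<^esub>t'\<in>h ` cell_right cd \<nu>. r (h' t') \<odot>\<^bsub>A\<^esub> cell_elem cd' (f \<nu>) (g s) t')
          = (\<Oplus>\<^bsub>A\<^esub>t'\<in>cell_right cd \<nu>. r (h' (h t')) \<odot>\<^bsub>A\<^esub> cell_elem cd' (f \<nu>) (g s) (h t'))"
          using inj(2) mem h'[OF \<nu>(1)] elem[OF \<nu>(1) s]
          by (intro M.finsum_reindex) auto
        also have "\<dots> = (\<Oplus>\<^bsub>A\<^esub>t'\<in>cell_right cd \<nu>. r t' \<odot>\<^bsub>A\<^esub> cell_elem cd \<nu> s t')"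
          using mem h'[OF \<nu>(1)] elem[OF \<nu>(1) s] by (intro M.finsum_cong') auto
        finally show ?thesis .
      qed
      then show ?thesis
        using r cong t elem[OF \<nu>(1) _ t(1)] h'[OF \<nu>(1)] unfolding \<nu>(2) hat[OF \<nu>(1)] left[OF \<nu>(1)] right[OF \<nu>(1)]
        by (intro bexI[where x = "\<lambda>j. r (h' j)"]) (auto simp: Pi_iff)
    qed
  qed
  then show ?thesis
    by blast
qed

lemma is_cell_algebra_if_cell_structure:
  assumes "cell_structure R A cd"
  shows "is_cell_algebra R A"
proof -
  interpret cell_structure R A cd
    by fact
  have fin: "finite (\<Union>\<nu>\<in>cell_poset cd. cell_left cd \<nu>)" "finite (\<Union>\<nu>\<in>cell_poset cd. cell_right cd \<nu>)"
    using finite_poset finite_left finite_right by auto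
  obtain f :: "_ \<Rightarrow> nat" where "inj_on f (cell_poset cd)"
    using finite_imp_inj_to_nat_seg[OF finite_poset] by blast
  moreover obtain g :: "_ \<Rightarrow> nat" where "inj_on g (\<Union>\<nu>\<in>cell_poset cd. cell_left cd \<nu>)"
    using finite_imp_inj_to_nat_seg[OF fin(1)] by blast
  moreover obtain h :: "_ \<Rightarrow> nat" where "inj_on h (\<Union>\<nu>\<in>cell_poset cd. cell_right cd \<nu>)"
    using finite_imp_inj_to_nat_seg[OF fin(2)] by blast
  ultimately show ?thesis
    unfolding is_cell_algebra_def by (rule cell_structure_relabel[OF assms])
qed

lemma cell_monoidI:
  assumes "domain R" "finite_monoid M" "base_choice M \<gamma>" "eggbox_choice M \<gamma> a a' b b'"
    and "\<forall>D\<in>D_classes M. cell_structure R (monoid_algebra R (schutz_group_at M (\<gamma> D))) (cd D)"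
  shows "cell_monoid R M \<gamma> a a' b b' cd"
  using assms by (simp add: cell_monoid_def cell_monoid_axioms_def eggbox_def eggbox_axioms_def)

theorem theorem3p1:
  fixes R :: "('r, 'x) ring_scheme"
    and M :: "('m, 'y) monoid_scheme"
    and \<gamma> :: "'m set \<Rightarrow> 'm"
  assumes "domain R"
    and "monoid M"
    and "finite (carrier M)"
    and "base_choice M \<gamma>"
    and "CA_condition R M \<gamma>"
  shows "is_cell_algebra R (monoid_algebra R M) \<and>
    (\<forall>a a' b b'. \<forall>cd :: 'm set \<Rightarrow> ('l, 'i, 'j, ('m \<Rightarrow> 'm) \<Rightarrow> 'r) cell_datum.
      eggbox_choice M \<gamma> a a' b b' \<longrightarrow>
      (\<forall>D\<in>D_classes M.
         cell_structure R (monoid_algebra R (schutz_group_at M (\<gamma> D))) (cd D)) \<longrightarrow>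
      cell_structure R (monoid_algebra R M) (standard_cell_datum R M \<gamma> a b cd))"
proof (intro conjI allI impI)
  have fm: "finite_monoid M"
    using assms(2,3) by (simp add: finite_monoid_def finite_monoid_axioms_def)
  show "cell_structure R (monoid_algebra R M) (standard_cell_datum R M \<gamma> a b cd)"
    if "eggbox_choice M \<gamma> a a' b b'"
      "\<forall>D\<in>D_classes M. cell_structure R (monoid_algebra R (schutz_group_at M (\<gamma> D))) (cd D)"
    for a a' b b' and cd :: "'m set \<Rightarrow> ('l, 'i, 'j, ('m \<Rightarrow> 'm) \<Rightarrow> 'r) cell_datum"
    using cell_monoid.standard_cell_structure[OF cell_monoidI[OF assms(1) fm assms(4) that]] .
  obtain a a' b b' where egg: "eggbox_choice M \<gamma> a a' b b'"
    using finite_monoid.eggbox_choice_exists[OF fm assms(4)] by blast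
  have "\<forall>D. \<exists>cd :: (nat, nat, nat, ('m \<Rightarrow> 'm) \<Rightarrow> 'r) cell_datum. D \<in> D_classes M \<longrightarrow>
      cell_structure R (monoid_algebra R (schutz_group_at M (\<gamma> D))) cd"
    using assms(5) by (auto simp: CA_condition_def is_cell_algebra_def)
  then obtain cd :: "'m set \<Rightarrow> (nat, nat, nat, ('m \<Rightarrow> 'm) \<Rightarrow> 'r) cell_datum" where
    "\<forall>D\<in>D_classes M. cell_structure R (monoid_algebra R (schutz_group_at M (\<gamma> D))) (cd D)"
    by metis
  then show "is_cell_algebra R (monoid_algebra R M)"
    using cell_monoid.standard_cell_structure[OF cell_monoidI[OF assms(1) fm assms(4) egg]]
    by (intro is_cell_algebra_if_cell_structure)
qed

end
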